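(* Let $\mathcal K$ be a regular $d$-polytope whose automorphism group is a finite 2-group or an infinite 2-group. Then the free extension $\mathcal P$ of $\mathcal K$ is a regular $(d+1)$-polytope whose automorphism group is an infinite 2-group.
   Context: **Infinite 2-groups.** A finitely generated infinite group $G$ is called an infinite 2-group if every element of $G$ of finite order has 2-power order. **Polytopes.** An (abstract) polytope of rank $d$ (a $d$-polytope) is a partially ordered set $\mathcal P$ with a strictly monotone rank function with values in $\{-1,0,\ldots,d\}$, having a unique least face $F_{-1}$ (rank $-1$) and a unique greatest face $F_d$ (rank $d$), such that: every flag (maximal totally ordered subset) has exactly $d+2$ faces, one of each rank; $\mathcal P$ is strongly flag-connected (any two flags $\Phi,\Psi$ are joined by a finite sequence of flags, each containing $\Phi\cap\Psi$, in which successive flags are adjacent, i.e. differ in exactly one face); and the diamond condition holds (if $F\le G$ have ranks $j-1$ and $j+1$, there are exactly two $j$-faces $H$ with $F\le H\le G$). Facets are the $(d-1)$-faces; a facet $F$ is identified with the section $F/F_{-1}=\{H: F_{-1}\le H\le F\}$, a $(d-1)$-polytope. $\Phi^j$ denotes the unique flag differing from the flag $\Phi$ exactly in its $j$-face. $\mathcal P$ is regular if its automorphism group $\Gamma(\mathcal P)$ is transitive on flags. Then, for a fixed base flag $\Phi$, $\Gamma(\mathcal P)=\langle\rho_0,\ldots,\rho_{d-1}\rangle$, where the involution $\rho_i$ maps $\Phi$ to $\Phi^i$; a regular polytope is determined up to isomorphism by its group with these distinguished generators, and the group of its facets is $\langle\rho_0,\ldots,\rho_{d-2}\rangle$. **Free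 extension.** A (regular) extension of a regular $d$-polytope $\mathcal K$ is a regular $(d+1)$-polytope with facets isomorphic to $\mathcal K$. It is known that there is a regular extension $\mathcal P$ of $\mathcal K$, called the free extension of $\mathcal K$, that covers every regular extension of $\mathcal K$. If $\Gamma(\mathcal K)=\langle\rho_0,\ldots,\rho_{d-1}\rangle$, $\mathcal F$ denotes the facet of $\mathcal K$ with $\Gamma(\mathcal F)=\langle\rho_0,\ldots,\rho_{d-2}\rangle$, and $\rho_d$ denotes the generator of a cyclic group $C_2$, then the group of $\mathcal P$ is the amalgamated free product $$\Gamma(\mathcal P)=\Gamma(\mathcal K)\ast_{\Gamma(\mathcal F)}(\Gamma(\mathcal F)\times C_2)=\langle\rho_0,\ldots,\rho_{d-1}\rangle\ast_{\langle\rho_0,\ldots,\rho_{d-2}\rangle}\langle\rho_0,\ldots,\rho_{d-2},\rho_d\rangle,$$ with distinguished generators $\rho_0,\ldots,\rho_d$, where the generators $\rho_i$ ($0\le i\le d-2$) of the two copies of $\Gamma(\mathcal F)$ are identified in the obvious way.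
   Formalization: The statement is proved for d ≥ 1; for d = 0 (K a single vertex, with trivial group) the free extension is a segment with group C_2, which is finite, so the claim fails there. *)

theory Defs
  imports
    "HOL-Algebra.Multiplicative_Group"
    "HOL-Algebra.Bij"
    "HOL-Library.Countable_Set"
begin

section \<open>Infinite 2-groups\<close>

text \<open>The predicate \<open>group.ord G g \<noteq> 0\<close> holds iff \<open>g\<close> has finite order.\<close>

definition infinite_2_group :: "('g, 'm) monoid_scheme \<Rightarrow> bool" where
  "infinite_2_group G \<longleftrightarrow>
     group G \<and>
     (\<exists>S. finite S \<and> S \<subseteq> carrier G \<and> generate G S = carrier G) \<and>
     infinite (carrier G) \<and>
     (\<forall>g\<in>carrier G. group.ord G g \<noteq> 0 \<longrightarrow> (\<exists>k::nat. group.ord G g = 2 ^ k))"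

definition finite_2_group :: "('g, 'm) monoid_scheme \<Rightarrow> bool" where
  "finite_2_group G \<longleftrightarrow> group G \<and> finite (carrier G) \<and> (\<exists>k::nat. order G = 2 ^ k)"


section \<open>Abstract polytopes\<close>

text \<open>
  The order is a reflexive relation, so its field is the set of faces. Values of \<open>rk\<close> outside
  that field are irrelevant.
\<close>

record 'a ranked_poset =
  leq :: "('a \<times> 'a) set"
  rk :: "'a \<Rightarrow> int"

definition faces :: "'a ranked_poset \<Rightarrow> 'a set" where
  "faces P = Field (leq P)"

definition flags :: "'a ranked_poset \<Rightarrow> 'a set set" where
  "flags P = {\<Phi> \<in> Chains (leq P). \<forall>C\<in>Chains (leq P). \<Phi> \<subseteq> C \<longrightarrow> C = \<Phi>}"

definition adjacent :: "'a set \<Rightarrow> 'a set \<Rightarrow> bool" where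
  "adjacent \<Phi> \<Psi> \<longleftrightarrow> card (\<Phi> - \<Psi>) = 1 \<and> card (\<Psi> - \<Phi>) = 1"

definition strongly_flag_connected :: "'a ranked_poset \<Rightarrow> bool" where
  "strongly_flag_connected P \<longleftrightarrow>
     (\<forall>\<Phi>\<in>flags P. \<forall>\<Psi>\<in>flags P.
        (\<Phi>, \<Psi>) \<in> {(A, B). A \<in> flags P \<and> B \<in> flags P \<and>
                        \<Phi> \<inter> \<Psi> \<subseteq> A \<and> \<Phi> \<inter> \<Psi> \<subseteq> B \<and> adjacent A B}\<^sup>*)"

definition polytope :: "nat \<Rightarrow> 'a ranked_poset \<Rightarrow> bool" where
  "polytope d P \<longleftrightarrow>
     Partial_order (leq P) \<and>
     rk P ` faces P \<subseteq> {-1..int d} \<and>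
     (\<forall>F\<in>faces P. \<forall>G\<in>faces P. (F, G) \<in> leq P \<and> F \<noteq> G \<longrightarrow> rk P F < rk P G) \<and>
     (\<exists>E\<in>faces P. rk P E = -1 \<and> (\<forall>G\<in>faces P. (E, G) \<in> leq P)) \<and>
     (\<exists>M\<in>faces P. rk P M = int d \<and> (\<forall>G\<in>faces P. (G, M) \<in> leq P)) \<and>
     (\<forall>\<Phi>\<in>flags P. bij_betw (rk P) \<Phi> {-1..int d}) \<and>
     strongly_flag_connected P \<and>
     (\<forall>F\<in>faces P. \<forall>G\<in>faces P. (F, G) \<in> leq P \<and> rk P G = rk P F + 2 \<longrightarrow>
        card {H \<in> faces P. (F, H) \<in> leq P \<and> (H, G) \<in> leq P \<and> rk P H = rk P F + 1} = 2)"

definition order_iso :: "('a \<Rightarrow> 'b) \<Rightarrow> 'a ranked_poset \<Rightarrow> 'b ranked_poset \<Rightarrow> bool" where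
  "order_iso f P Q \<longleftrightarrow>
     bij_betw f (faces P) (faces Q) \<and>
     (\<forall>F\<in>faces P. \<forall>G\<in>faces P. (F, G) \<in> leq P \<longleftrightarrow> (f F, f G) \<in> leq Q)"

definition isomorphic :: "'a ranked_poset \<Rightarrow> 'b ranked_poset \<Rightarrow> bool" where
  "isomorphic P Q \<longleftrightarrow> (\<exists>f. order_iso f P Q)"

definition aut_group :: "'a ranked_poset \<Rightarrow> ('a \<Rightarrow> 'a) monoid" where
  "aut_group P = BijGroup (faces P) \<lparr>carrier := {f \<in> Bij (faces P). order_iso f P P}\<rparr>"

definition regular_polytope :: "nat \<Rightarrow> 'a ranked_poset \<Rightarrow> bool" where
  "regular_polytope d P \<longleftrightarrow>
     polytope d P \<and> (\<forall>\<Phi>\<in>flags P. \<forall>\<Psi>\<in>flags P. \<exists>f\<in>carrier (aut_group P). f ` \<Phi> = \<Psi>)"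

definition face_section :: "'a ranked_poset \<Rightarrow> 'a \<Rightarrow> 'a \<Rightarrow> 'a ranked_poset" where
  "face_section P F G = P\<lparr>leq := Restr (leq P) {H. (F, H) \<in> leq P \<and> (H, G) \<in> leq P}\<rparr>"

definition regular_extension :: "nat \<Rightarrow> 'a ranked_poset \<Rightarrow> 'b ranked_poset \<Rightarrow> bool" where
  "regular_extension d K P \<longleftrightarrow>
     regular_polytope d K \<and> regular_polytope (Suc d) P \<and>
     (\<forall>E\<in>faces P. \<forall>F\<in>faces P. rk P E = -1 \<and> rk P F = int d \<longrightarrow>
        isomorphic (face_section P E F) K)"

text \<open>
  Coverings in the usual sense of the theory of abstract polytopes: surjective homomorphisms that
  preserve rank and send adjacent flags to (distinct) adjacent flags.
\<close>

definition covers :: "'a ranked_poset \<Rightarrow> 'b ranked_poset \<Rightarrow> bool" where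
  "covers P Q \<longleftrightarrow>
     (\<exists>\<gamma>. \<gamma> ` faces P = faces Q \<and>
          (\<forall>F\<in>faces P. rk Q (\<gamma> F) = rk P F) \<and>
          (\<forall>F G. (F, G) \<in> leq P \<longrightarrow> (\<gamma> F, \<gamma> G) \<in> leq Q) \<and>
          (\<forall>\<Phi>\<in>flags P. \<forall>\<Psi>\<in>flags P. adjacent \<Phi> \<Psi> \<longrightarrow>
             \<gamma> ` \<Phi> \<in> flags Q \<and> \<gamma> ` \<Psi> \<in> flags Q \<and> adjacent (\<gamma> ` \<Phi>) (\<gamma> ` \<Psi>)))"

text \<open>
  A definition cannot quantify over all types, so the regular extensions \<open>Q\<close> to be covered are
  taken with faces in \<^typ>\<open>nat\<close>. This is no restriction, as every polytope is countable; the
  lemma \<open>free_extension_covers\<close> below gives the property for extensions over an arbitrary type.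
\<close>

definition free_extension :: "nat \<Rightarrow> 'a ranked_poset \<Rightarrow> 'b ranked_poset \<Rightarrow> bool" where
  "free_extension d K P \<longleftrightarrow>
     regular_extension d K P \<and>
     (\<forall>Q :: nat ranked_poset. regular_extension d K Q \<longrightarrow> covers P Q)"


section \<open>Independence of the type used in the definition of the free extension\<close>

lemma leq_faces: "(F, G) \<in> leq P \<Longrightarrow> F \<in> faces P \<and> G \<in> faces P"
  by (auto simp: faces_def Field_def)

lemma Chains_faces: "C \<in> Chains (leq P) \<Longrightarrow> C \<subseteq> faces P"
  by (auto simp: Chains_def dest: leq_faces)

lemma flag_faces: "\<Phi> \<in> flags P \<Longrightarrow> \<Phi> \<subseteq> faces P"
  by (auto simp: flags_def dest: Chains_faces)

lemma polytope_least:
  "polytope d P \<Longrightarrow> \<exists>E\<in>faces P. rk P E = -1 \<and> (\<forall>G\<in>faces P. (E, G) \<in> leq P)"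
  by (simp add: polytope_def)

lemma polytope_greatest:
  "polytope d P \<Longrightarrow> \<exists>M\<in>faces P. rk P M = int d \<and> (\<forall>G\<in>faces P. (G, M) \<in> leq P)"
  by (simp add: polytope_def)

lemma order_iso_inv:
  assumes "order_iso f P Q"
  shows "order_iso (inv_into (faces P) f) Q P"
  unfolding order_iso_def
proof (intro conjI ballI)
  have b: "bij_betw f (faces P) (faces Q)"
    using assms by (auto simp: order_iso_def)
  then show "bij_betw (inv_into (faces P) f) (faces Q) (faces P)"
    by (rule bij_betw_inv_into)
  fix F G assume "F \<in> faces Q" "G \<in> faces Q"
  then obtain F' G' where "F' \<in> faces P" "G' \<in> faces P" "F = f F'" "G = f G'"
    using b unfolding bij_betw_def by (metis imageE)
  then show "(F, G) \<in> leq Q \<longleftrightarrow> (inv_into (faces P) f F, inv_into (faces P) f G) \<in> leq P"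
    using assms b by (simp add: order_iso_def bij_betw_inv_into_left)
qed

lemma order_iso_trans:
  assumes "order_iso f P Q" "order_iso g Q R"
  shows "order_iso (g \<circ> f) P R"
proof -
  have "f F \<in> faces Q" if "F \<in> faces P" for F
    using assms(1) that by (auto simp: order_iso_def bij_betw_def)
  then show ?thesis
    using assms by (auto simp: order_iso_def intro: bij_betw_trans)
qed

lemma order_iso_Chains:
  assumes "order_iso f P Q" "C \<in> Chains (leq P)"
  shows "f ` C \<in> Chains (leq Q)"
proof -
  have "(f a, f b) \<in> leq Q \<or> (f b, f a) \<in> leq Q" if ab: "a \<in> C" "b \<in> C" for a b
  proof -
    have "a \<in> faces P" "b \<in> faces P" using ab Chains_faces[OF assms(2)] by auto
    moreover have "(a, b) \<in> leq P \<or> (b, a) \<in> leq P" using ab assms(2) by (simp add: Chains_def)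
    ultimately show ?thesis using assms(1) by (simp add: order_iso_def)
  qed
  then show ?thesis by (auto simp: Chains_def)
qed

lemma order_iso_flags:
  assumes f: "order_iso f P Q" and \<Phi>: "\<Phi> \<in> flags P"
  shows "f ` \<Phi> \<in> flags Q"
proof -
  let ?g = "inv_into (faces P) f"
  have b: "bij_betw f (faces P) (faces Q)"
    using f by (simp add: order_iso_def)
  have C: "\<Phi> \<in> Chains (leq P)" and M: "\<And>C. C \<in> Chains (leq P) \<Longrightarrow> \<Phi> \<subseteq> C \<Longrightarrow> C = \<Phi>"
    using \<Phi> by (auto simp: flags_def)
  have "D = f ` \<Phi>" if D: "D \<in> Chains (leq Q)" "f ` \<Phi> \<subseteq> D" for D
  proof -
    have "?g ` D \<in> Chains (leq P)"
      using order_iso_Chains[OF order_iso_inv[OF f] D(1)] .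
    moreover have "?g ` f ` \<Phi> = \<Phi>"
      using b flag_faces[OF \<Phi>] by (simp add: bij_betw_def inv_into_image_cancel)
    ultimately have "?g ` D = \<Phi>"
      using M D(2) by (metis image_mono)
    moreover have "f ` ?g ` D = D"
      using b Chains_faces[OF D(1)] by (simp add: bij_betw_def image_inv_into_cancel)
    ultimately show ?thesis by simp
  qed
  then show ?thesis
    using order_iso_Chains[OF f C] by (auto simp: flags_def)
qed

lemma adjacent_image:
  assumes "inj_on f A" "\<Phi> \<subseteq> A" "\<Psi> \<subseteq> A" "adjacent \<Phi> \<Psi>"
  shows "adjacent (f ` \<Phi>) (f ` \<Psi>)"
proof -
  have "f ` \<Phi> - f ` \<Psi> = f ` (\<Phi> - \<Psi>)" "f ` \<Psi> - f ` \<Phi> = f ` (\<Psi> - \<Phi>)"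
    using assms by (auto simp: inj_on_def)
  moreover have "inj_on f (\<Phi> - \<Psi>)" "inj_on f (\<Psi> - \<Phi>)"
    using assms by (auto intro: inj_on_subset)
  ultimately show ?thesis
    using assms(4) by (simp add: adjacent_def card_image)
qed

lemma countable_flags:
  assumes P: "polytope d P"
  shows "countable (flags P)"
proof (cases "flags P = {}")
  case False
  define adj where "adj = {(A, B). A \<in> flags P \<and> B \<in> flags P \<and> adjacent A B}"
  have rank: "bij_betw (rk P) \<Phi> {-1..int d}" if "\<Phi> \<in> flags P" for \<Phi>
    using P that by (auto simp: polytope_def)
  have nbrs: "finite (adj `` {\<Phi>})" if \<Phi>: "\<Phi> \<in> flags P" for \<Phi>
  proof -
    define H where "H = (\<lambda>(A, B). {H \<in> faces P. (A, H) \<in> leq P \<and> (H, B) \<in> leq P \<and>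
                                rk P H = rk P A + 1})"
    define I where "I = {(A, B) \<in> \<Phi> \<times> \<Phi>. (A, B) \<in> leq P \<and> rk P B = rk P A + 2}"
    have fin\<Phi>: "finite \<Phi>"
      using rank[OF \<Phi>] bij_betw_finite by blast
    have "finite (H x)" if "x \<in> I" for x
    proof -
      obtain A B where x: "x = (A, B)" by (cases x)
      then have "card (H x) = 2"
        using P that leq_faces[of A B P] unfolding H_def I_def polytope_def by auto
      then show ?thesis using card.infinite by fastforce
    qed
    moreover have "finite I"
      using fin\<Phi> by (auto simp: I_def intro: finite_subset[of _ "\<Phi> \<times> \<Phi>"])
    ultimately have "finite (\<Union>F\<in>\<Phi>. \<Union>x\<in>I. (\<lambda>G. insert G (\<Phi> - {F})) ` H x)"
      using fin\<Phi> by blast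
    moreover have "\<Psi> \<in> (\<Union>F\<in>\<Phi>. \<Union>x\<in>I. (\<lambda>G. insert G (\<Phi> - {F})) ` H x)"
      if "\<Psi> \<in> adj `` {\<Phi>}" for \<Psi>
    proof -
      have \<Psi>: "\<Psi> \<in> flags P" and a: "adjacent \<Phi> \<Psi>"
        using that by (auto simp: adj_def)
      obtain F G where F: "\<Phi> - \<Psi> = {F}" and G: "\<Psi> - \<Phi> = {G}"
        using a unfolding adjacent_def by (meson card_1_singletonE)
      have \<Psi>_eq: "\<Psi> = insert G (\<Phi> - {F})" and FG: "F \<in> \<Phi>" "G \<in> \<Psi>" "F \<noteq> G"
        using F G by auto
      have fc: "\<Phi> \<subseteq> faces P" "\<Psi> \<subseteq> faces P"
        using \<Phi> \<Psi> flag_faces by auto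
      have mono: "A = B \<or> rk P A < rk P B" if "(A, B) \<in> leq P" for A B
        using P that leq_faces[OF that] unfolding polytope_def by blast
      have le: "(A, B) \<in> leq P" if "A \<in> \<Omega>" "B \<in> \<Omega>" "rk P A < rk P B" "\<Omega> \<in> flags P" for A B \<Omega>
        using that mono[of B A] by (force simp: flags_def Chains_def)
      have rkG: "rk P G = rk P F"
      proof -
        have i\<Phi>: "inj_on (rk P) \<Phi>" "rk P ` \<Phi> = {-1..int d}"
         and i\<Psi>: "inj_on (rk P) \<Psi>" "rk P ` \<Psi> = {-1..int d}"
          using rank[OF \<Phi>] rank[OF \<Psi>] by (auto simp: bij_betw_def)
        have "rk P F \<in> rk P ` \<Psi>"
          using FG(1) i\<Phi>(2) i\<Psi>(2) by blast
        then obtain X where X: "X \<in> \<Psi>" "rk P X = rk P F" by auto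
        have "X = G"
        proof (rule ccontr)
          assume "X \<noteq> G"
          then have "X \<in> \<Phi>" "X \<noteq> F" using X(1) \<Psi>_eq by auto
          then show False using X(2) FG(1) i\<Phi>(1) by (auto dest: inj_onD)
        qed
        then show ?thesis using X(2) by simp
      qed
      obtain E M where E: "E \<in> faces P" "rk P E = -1" "\<forall>G\<in>faces P. (E, G) \<in> leq P"
        and M: "M \<in> faces P" "rk P M = int d" "\<forall>G\<in>faces P. (G, M) \<in> leq P"
        using polytope_least[OF P] polytope_greatest[OF P] by blast
      have "F \<in> faces P" "G \<in> faces P" using FG fc by auto
      then have lb: "(E, F) \<in> leq P" "(E, G) \<in> leq P" and ub: "(F, M) \<in> leq P" "(G, M) \<in> leq P"
        using E(3) M(3) by blast+
      have "rk P F \<noteq> -1"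
        using mono[of E F] mono[of E G] lb E(2) rkG FG(3) by (metis less_irrefl)
      moreover have "rk P F \<noteq> int d"
        using mono[of F M] mono[of G M] ub M(2) rkG FG(3) by (metis less_irrefl)
      moreover have "rk P F \<in> {-1..int d}"
        using P \<open>F \<in> faces P\<close> unfolding polytope_def by blast
      ultimately have "rk P F - 1 \<in> {-1..int d}" "rk P F + 1 \<in> {-1..int d}" by auto
      then have "rk P F - 1 \<in> rk P ` \<Phi>" "rk P F + 1 \<in> rk P ` \<Phi>"
        using rank[OF \<Phi>] by (simp_all add: bij_betw_def)
      then obtain A B where A: "A \<in> \<Phi>" "rk P A = rk P F - 1" and B: "B \<in> \<Phi>" "rk P B = rk P F + 1"
        by force
      then have AB: "A \<in> \<Psi>" "B \<in> \<Psi>" using \<Psi>_eq by auto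
      have "(A, B) \<in> I"
        using le[of A \<Phi> B] A B \<Phi> by (simp add: I_def)
      moreover have "G \<in> H (A, B)"
        using le[of A \<Psi> G] le[of G \<Psi> B] A B AB FG \<Psi> rkG \<open>G \<in> faces P\<close> by (simp add: H_def)
      ultimately show ?thesis
        using FG(1) \<Psi>_eq by blast
    qed
    ultimately show ?thesis
      by (meson finite_subset subsetI)
  qed
  obtain \<Phi> where \<Phi>: "\<Phi> \<in> flags P" using False by blast
  have "countable ((adj ^^ n) `` {\<Phi>} \<inter> flags P)" for n
  proof (induction n)
    case 0
    then show ?case by (auto intro: countable_subset[of _ "{\<Phi>}"])
  next
    case (Suc n)
    have "(adj ^^ Suc n) `` {\<Phi>} \<inter> flags P \<subseteq> (\<Union>\<Psi>\<in>(adj ^^ n) `` {\<Phi>} \<inter> flags P. adj `` {\<Psi>})"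
      by (auto simp: adj_def)
    moreover have "countable \<dots>"
      using Suc nbrs by (intro countable_UN) (auto intro: countable_finite)
    ultimately show ?case by (rule countable_subset)
  qed
  then have "countable (\<Union>n. (adj ^^ n) `` {\<Phi>} \<inter> flags P)" by blast
  moreover have "flags P \<subseteq> (\<Union>n. (adj ^^ n) `` {\<Phi>} \<inter> flags P)"
  proof
    fix \<Psi> assume \<Psi>: "\<Psi> \<in> flags P"
    have "(\<Phi>, \<Psi>) \<in> {(A, B). A \<in> flags P \<and> B \<in> flags P \<and>
                       \<Phi> \<inter> \<Psi> \<subseteq> A \<and> \<Phi> \<inter> \<Psi> \<subseteq> B \<and> adjacent A B}\<^sup>*"
      using P \<Phi> \<Psi> unfolding polytope_def strongly_flag_connected_def by blast
    moreover have "{(A, B). A \<in> flags P \<and> B \<in> flags P \<and>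
                     \<Phi> \<inter> \<Psi> \<subseteq> A \<and> \<Phi> \<inter> \<Psi> \<subseteq> B \<and> adjacent A B} \<subseteq> adj"
      by (auto simp: adj_def)
    ultimately have "(\<Phi>, \<Psi>) \<in> adj\<^sup>*" using rtrancl_mono by blast
    then show "\<Psi> \<in> (\<Union>n. (adj ^^ n) `` {\<Phi>} \<inter> flags P)"
      using \<Psi> by (auto simp: rtrancl_power)
  qed
  ultimately show ?thesis by (rule countable_subset[rotated])
qed simp

lemma face_in_flag:
  assumes "Partial_order (leq P)" "F \<in> faces P"
  shows "\<exists>\<Phi>\<in>flags P. F \<in> \<Phi>"
proof -
  let ?A = "{C \<in> Chains (leq P). F \<in> C}"
  have "(F, F) \<in> leq P"
    using assms by (auto simp: faces_def partial_order_on_def preorder_on_def refl_on_def)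
  then have ne: "{F} \<in> ?A" by (auto simp: Chains_def)
  have "\<exists>U\<in>?A. \<forall>X\<in>\<C>. X \<subseteq> U" if "subset.chain ?A \<C>" for \<C>
  proof (cases "\<C> = {}")
    case False
    have sub: "\<C> \<subseteq> ?A" using that by (auto simp: subset.chain_def)
    have "(a, b) \<in> leq P \<or> (b, a) \<in> leq P" if ab: "a \<in> \<Union>\<C>" "b \<in> \<Union>\<C>" for a b
    proof -
      obtain X Y where XY: "X \<in> \<C>" "Y \<in> \<C>" "a \<in> X" "b \<in> Y" using ab by blast
      then have "X \<subseteq> Y \<or> Y \<subseteq> X"
        using \<open>subset.chain ?A \<C>\<close> by (auto simp: subset_chain_def)
      then obtain Z where "Z \<in> \<C>" "a \<in> Z" "b \<in> Z" using XY by blast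
      then show ?thesis using sub by (auto simp: Chains_def)
    qed
    then have "\<Union>\<C> \<in> ?A" using False sub by (auto simp: Chains_def)
    then show ?thesis by blast
  qed (use ne in blast)
  then have "\<exists>M\<in>?A. \<forall>X\<in>?A. M \<subseteq> X \<longrightarrow> X = M" by (rule subset_Zorn)
  then show ?thesis by (auto simp: flags_def)
qed

lemma countable_faces:
  assumes P: "polytope d P"
  shows "countable (faces P)"
proof -
  have "finite \<Phi>" if "\<Phi> \<in> flags P" for \<Phi>
    using P that unfolding polytope_def by (meson bij_betw_finite finite_atLeastAtMost_int)
  then have "countable (\<Union>(flags P))"
    using countable_flags[OF P] countable_UN[of "flags P" "\<lambda>\<Phi>. \<Phi>"] by (simp add: countable_finite)
  moreover have "faces P \<subseteq> \<Union>(flags P)"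
  proof
    fix F assume F: "F \<in> faces P"
    have "Partial_order (leq P)" using P unfolding polytope_def by (rule conjunct1)
    from face_in_flag[OF this F] show "F \<in> \<Union>(flags P)" by (simp add: Union_iff)
  qed
  ultimately show ?thesis by (rule countable_subset[rotated])
qed

lemma polytope_iso:
  assumes P: "polytope d P" and f: "order_iso f P Q"
    and rk: "\<And>F. F \<in> faces P \<Longrightarrow> rk Q (f F) = rk P F"
  shows "polytope d Q"
proof -
  define g where "g = inv_into (faces P) f"
  have g: "order_iso g Q P" using order_iso_inv[OF f] by (simp add: g_def)
  have b: "bij_betw f (faces P) (faces Q)" using f by (simp add: order_iso_def)
  have gf: "\<And>F. F \<in> faces P \<Longrightarrow> g (f F) = F" and fg: "\<And>F. F \<in> faces Q \<Longrightarrow> f (g F) = F"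
    and gP: "\<And>F. F \<in> faces Q \<Longrightarrow> g F \<in> faces P" and fQ: "\<And>F. F \<in> faces P \<Longrightarrow> f F \<in> faces Q"
    using b bij_betw_inv_into[OF b] unfolding g_def
    by (auto simp: bij_betw_inv_into_left bij_betw_inv_into_right dest: bij_betwE)
  have rkg: "\<And>F. F \<in> faces Q \<Longrightarrow> rk P (g F) = rk Q F" using rk gP fg by metis
  have leg: "\<And>F G. F \<in> faces Q \<Longrightarrow> G \<in> faces Q \<Longrightarrow> (F, G) \<in> leq Q \<longleftrightarrow> (g F, g G) \<in> leq P"
    using g by (simp add: order_iso_def)
  have inj: "inj_on g (faces Q)" using g by (auto simp: order_iso_def bij_betw_def)
  have fim: "f ` g ` X = X" if "X \<subseteq> faces Q" for X
    using fg that by (force simp: image_image subset_iff)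
  have po: "refl_on (faces P) (leq P)" "trans (leq P)" "antisym (leq P)"
    using P by (auto simp: polytope_def partial_order_on_def preorder_on_def faces_def)
  have "Partial_order (leq Q)"
    unfolding partial_order_on_def preorder_on_def faces_def[symmetric]
  proof (intro conjI)
    show "leq Q \<subseteq> faces Q \<times> faces Q" by (auto dest: leq_faces)
    show "refl_on (faces Q) (leq Q)"
      using po(1) leg gP by (auto simp: refl_on_def)
    show "trans (leq Q)"
    proof (rule transI)
      fix x y z assume "(x, y) \<in> leq Q" "(y, z) \<in> leq Q"
      then show "(x, z) \<in> leq Q"
        using leq_faces[of x y Q] leq_faces[of y z Q] leg po(2) by (metis transD)
    qed
    show "antisym (leq Q)"
    proof (rule antisymI)
      fix x y assume "(x, y) \<in> leq Q" "(y, x) \<in> leq Q"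
      then have "x \<in> faces Q" "y \<in> faces Q" "g x = g y"
        using leq_faces[of x y Q] leg po(3) by (auto dest: antisymD)
      then show "x = y" using inj by (simp add: inj_on_eq_iff)
    qed
  qed
  moreover have "rk Q ` faces Q \<subseteq> {-1..int d}"
  proof -
    have "rk Q ` faces Q \<subseteq> rk P ` faces P" using rkg gP by (metis image_eqI image_subsetI)
    then show ?thesis using P by (auto simp: polytope_def)
  qed
  moreover have "\<forall>F\<in>faces Q. \<forall>G\<in>faces Q. (F, G) \<in> leq Q \<and> F \<noteq> G \<longrightarrow> rk Q F < rk Q G"
  proof (intro ballI impI)
    fix F G assume FG: "F \<in> faces Q" "G \<in> faces Q" "(F, G) \<in> leq Q \<and> F \<noteq> G"
    then have "g F \<in> faces P" "g G \<in> faces P" "(g F, g G) \<in> leq P" "g F \<noteq> g G"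
      using gP leg inj by (auto simp: inj_on_eq_iff)
    then have "rk P (g F) < rk P (g G)" using P unfolding polytope_def by blast
    then show "rk Q F < rk Q G" using rkg FG by simp
  qed
  moreover have "\<exists>E\<in>faces Q. rk Q E = -1 \<and> (\<forall>G\<in>faces Q. (E, G) \<in> leq Q)"
  proof -
    obtain E where "E \<in> faces P" "rk P E = -1" "\<forall>G\<in>faces P. (E, G) \<in> leq P"
      using polytope_least[OF P] by blast
    then show ?thesis using fQ rk leg gP gf by (intro bexI[of _ "f E"]) auto
  qed
  moreover have "\<exists>M\<in>faces Q. rk Q M = int d \<and> (\<forall>G\<in>faces Q. (G, M) \<in> leq Q)"
  proof -
    obtain M where "M \<in> faces P" "rk P M = int d" "\<forall>G\<in>faces P. (G, M) \<in> leq P"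
      using polytope_greatest[OF P] by blast
    then show ?thesis using fQ rk leg gP gf by (intro bexI[of _ "f M"]) auto
  qed
  moreover have "\<forall>\<Phi>\<in>flags Q. bij_betw (rk Q) \<Phi> {-1..int d}"
  proof
    fix \<Phi> assume \<Phi>: "\<Phi> \<in> flags Q"
    have sub: "\<Phi> \<subseteq> faces Q" using \<Phi> by (rule flag_faces)
    have "bij_betw (rk P) (g ` \<Phi>) {-1..int d}"
      using order_iso_flags[OF g \<Phi>] P unfolding polytope_def by blast
    moreover have "bij_betw g \<Phi> (g ` \<Phi>)"
      using inj sub by (simp add: bij_betw_def inj_on_subset)
    ultimately have "bij_betw (rk P \<circ> g) \<Phi> {-1..int d}" by (rule bij_betw_trans[rotated])
    then show "bij_betw (rk Q) \<Phi> {-1..int d}"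
      using rkg sub by (subst bij_betw_cong[of _ _ "rk P \<circ> g"]) auto
  qed
  moreover have "strongly_flag_connected Q"
    unfolding strongly_flag_connected_def
  proof (intro ballI)
    fix \<Phi> \<Psi> assume \<Phi>: "\<Phi> \<in> flags Q" and \<Psi>: "\<Psi> \<in> flags Q"
    let ?R = "\<lambda>P \<Phi> \<Psi>. {(A, B). A \<in> flags P \<and> B \<in> flags P \<and>
                           \<Phi> \<inter> \<Psi> \<subseteq> A \<and> \<Phi> \<inter> \<Psi> \<subseteq> B \<and> adjacent A B}"
    have sub: "\<Phi> \<subseteq> faces Q" "\<Psi> \<subseteq> faces Q" using \<Phi> \<Psi> by (auto dest: flag_faces)
    have int: "f ` (g ` \<Phi> \<inter> g ` \<Psi>) = \<Phi> \<inter> \<Psi>"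
      using fim[of "\<Phi> \<inter> \<Psi>"] inj_on_image_Int[OF inj sub] sub by (simp add: le_infI1)
    have R: "(f ` A, f ` B) \<in> ?R Q \<Phi> \<Psi>" if "(A, B) \<in> ?R P (g ` \<Phi>) (g ` \<Psi>)" for A B
    proof -
      have "f ` A \<in> flags Q" "f ` B \<in> flags Q"
        using that order_iso_flags[OF f] by auto
      moreover have "adjacent (f ` A) (f ` B)"
        using that b by (intro adjacent_image[of f "faces P"]) (auto simp: bij_betw_def dest: flag_faces)
      moreover have "\<Phi> \<inter> \<Psi> \<subseteq> f ` A" "\<Phi> \<inter> \<Psi> \<subseteq> f ` B"
        using that int by (metis (mono_tags, lifting) case_prodD image_mono mem_Collect_eq)+
      ultimately show ?thesis by blast
    qed
    have "(g ` \<Phi>, g ` \<Psi>) \<in> (?R P (g ` \<Phi>) (g ` \<Psi>))\<^sup>*"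
      using P order_iso_flags[OF g \<Phi>] order_iso_flags[OF g \<Psi>]
      unfolding polytope_def strongly_flag_connected_def by blast
    then have "(f ` g ` \<Phi>, f ` g ` \<Psi>) \<in> (?R Q \<Phi> \<Psi>)\<^sup>*"
    proof (induction rule: rtrancl_induct)
      case (step A B)
      then show ?case using R by (meson rtrancl.rtrancl_into_rtrancl)
    qed simp
    then show "(\<Phi>, \<Psi>) \<in> (?R Q \<Phi> \<Psi>)\<^sup>*" using fim sub by simp
  qed
  moreover have "\<forall>F\<in>faces Q. \<forall>G\<in>faces Q. (F, G) \<in> leq Q \<and> rk Q G = rk Q F + 2 \<longrightarrow>
        card {H \<in> faces Q. (F, H) \<in> leq Q \<and> (H, G) \<in> leq Q \<and> rk Q H = rk Q F + 1} = 2"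
  proof (intro ballI impI)
    fix F G assume FG: "F \<in> faces Q" "G \<in> faces Q" "(F, G) \<in> leq Q \<and> rk Q G = rk Q F + 2"
    let ?S = "{H \<in> faces Q. (F, H) \<in> leq Q \<and> (H, G) \<in> leq Q \<and> rk Q H = rk Q F + 1}"
    let ?T = "{H \<in> faces P. (g F, H) \<in> leq P \<and> (H, g G) \<in> leq P \<and> rk P H = rk P (g F) + 1}"
    have "H \<in> g ` ?S" if "H \<in> ?T" for H
    proof (rule image_eqI[of _ _ "f H"])
      show "H = g (f H)" using that gf by simp
      show "f H \<in> ?S" using that gf fQ FG leg rk rkg by auto
    qed
    moreover have "g H \<in> ?T" if "H \<in> ?S" for H
      using that gP FG leg rkg by auto
    ultimately have "g ` ?S = ?T" by blast
    moreover have "inj_on g ?S" using inj by (auto simp: inj_on_def)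
    ultimately have "card ?S = card ?T" using card_image[of g ?S] by simp
    also have "(g F, g G) \<in> leq P" "rk P (g G) = rk P (g F) + 2" "g F \<in> faces P" "g G \<in> faces P"
      using FG leg rkg gP by auto
    then have "card ?T = 2" using P unfolding polytope_def by blast
    finally show "card ?S = 2" .
  qed
  ultimately show ?thesis by (simp add: polytope_def)
qed

lemma regular_polytope_iso:
  assumes P: "regular_polytope d P" and f: "order_iso f P Q"
    and rk: "\<And>F. F \<in> faces P \<Longrightarrow> rk Q (f F) = rk P F"
  shows "regular_polytope d Q"
  unfolding regular_polytope_def
proof (intro conjI ballI)
  show "polytope d Q"
    using polytope_iso[OF _ f rk] P by (simp add: regular_polytope_def)
  fix \<Phi> \<Psi> assume \<Phi>: "\<Phi> \<in> flags Q" and \<Psi>: "\<Psi> \<in> flags Q"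
  define g where "g = inv_into (faces P) f"
  have g: "order_iso g Q P" using order_iso_inv[OF f] by (simp add: g_def)
  obtain h where h: "order_iso h P P" "h ` g ` \<Phi> = g ` \<Psi>"
    using P order_iso_flags[OF g \<Phi>] order_iso_flags[OF g \<Psi>]
    by (fastforce simp: regular_polytope_def aut_group_def)
  define k where "k = restrict (f \<circ> (h \<circ> g)) (faces Q)"
  have o: "order_iso (f \<circ> (h \<circ> g)) Q Q" using g h f by (blast intro: order_iso_trans)
  have "bij_betw k (faces Q) (faces Q)"
    using o unfolding k_def order_iso_def by (simp add: bij_betw_restrict_eq)
  then have "k \<in> Bij (faces Q)" by (simp add: Bij_def k_def)
  moreover have "order_iso k Q Q"
    using o \<open>bij_betw k _ _\<close> by (simp add: k_def order_iso_def)
  moreover have "k ` \<Phi> = \<Psi>"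
  proof -
    have "k ` \<Phi> = f ` h ` g ` \<Phi>"
      using flag_faces[OF \<Phi>] by (force simp: k_def image_image subset_iff)
    also have "\<dots> = f ` g ` \<Psi>" using h by simp
    also have "\<dots> = \<Psi>"
      using flag_faces[OF \<Psi>] f unfolding g_def order_iso_def
      by (simp add: bij_betw_def image_inv_into_cancel)
    finally show ?thesis .
  qed
  ultimately show "\<exists>f\<in>carrier (aut_group Q). f ` \<Phi> = \<Psi>"
    by (auto simp: aut_group_def)
qed

lemma faces_section:
  assumes "Partial_order (leq P)"
  shows "faces (face_section P E F) = {H. (E, H) \<in> leq P \<and> (H, F) \<in> leq P}"
proof -
  have "(H, H) \<in> leq P" if "(E, H) \<in> leq P" for H
    using assms that leq_faces[OF that]
    by (auto simp: faces_def partial_order_on_def preorder_on_def refl_on_def)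
  then show ?thesis by (auto simp: faces_def face_section_def Field_def)
qed

lemma section_iso:
  assumes po: "Partial_order (leq P)" "Partial_order (leq Q)" and f: "order_iso f P Q"
    and EF: "E \<in> faces P" "F \<in> faces P"
  shows "order_iso f (face_section P E F) (face_section Q (f E) (f F))"
proof -
  have b: "bij_betw f (faces P) (faces Q)"
    and le: "\<And>A B. A \<in> faces P \<Longrightarrow> B \<in> faces P \<Longrightarrow> (A, B) \<in> leq P \<longleftrightarrow> (f A, f B) \<in> leq Q"
    using f by (auto simp: order_iso_def)
  let ?S = "{H. (E, H) \<in> leq P \<and> (H, F) \<in> leq P}"
  let ?T = "{H. (f E, H) \<in> leq Q \<and> (H, f F) \<in> leq Q}"
  have sub: "?S \<subseteq> faces P" by (auto dest: leq_faces)
  have "f ` ?S = ?T"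
  proof
    show "f ` ?S \<subseteq> ?T" using le EF sub by auto
    show "?T \<subseteq> f ` ?S"
    proof
      fix H assume H: "H \<in> ?T"
      then have "H \<in> faces Q" by (auto dest: leq_faces)
      then obtain H' where "H' \<in> faces P" "H = f H'" using b by (auto simp: bij_betw_def)
      then show "H \<in> f ` ?S" using H le EF by auto
    qed
  qed
  then have "bij_betw f ?S ?T" using b sub by (auto simp: bij_betw_def intro: inj_on_subset)
  moreover have "(A, B) \<in> leq (face_section P E F) \<longleftrightarrow> (f A, f B) \<in> leq (face_section Q (f E) (f F))"
    if "A \<in> ?S" "B \<in> ?S" for A B
    using that sub le EF by (auto simp: face_section_def)
  ultimately show ?thesis
    unfolding order_iso_def by (simp add: faces_section po)
qed

lemma regular_extension_iso:
  assumes P: "regular_extension d K P" and f: "order_iso f P Q"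
    and rk: "\<And>F. F \<in> faces P \<Longrightarrow> rk Q (f F) = rk P F"
  shows "regular_extension d K Q"
proof -
  have rQ: "regular_polytope (Suc d) Q"
    using regular_polytope_iso[OF _ f rk] P by (simp add: regular_extension_def)
  have po: "Partial_order (leq P)" "Partial_order (leq Q)"
    using P rQ by (auto simp: regular_extension_def regular_polytope_def polytope_def)
  have bf: "bij_betw f (faces P) (faces Q)" using f by (simp add: order_iso_def)
  have "isomorphic (face_section Q E F) K"
    if EF: "E \<in> faces Q" "F \<in> faces Q" "rk Q E = -1" "rk Q F = int d" for E F
  proof -
    obtain E' F' where *: "E' \<in> faces P" "F' \<in> faces P" "E = f E'" "F = f F'"
      using bf EF(1,2) unfolding bij_betw_def by (metis imageE)
    have "rk P E' = -1" "rk P F' = int d" using EF(3,4) rk * by auto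
    then obtain h where h: "order_iso h (face_section P E' F') K"
      using P * by (auto simp: regular_extension_def isomorphic_def)
    have "order_iso f (face_section P E' F') (face_section Q E F)"
      using section_iso[OF po f *(1,2)] * by simp
    then show ?thesis
      using h order_iso_inv order_iso_trans unfolding isomorphic_def by blast
  qed
  then show ?thesis using P rQ by (simp add: regular_extension_def)
qed

lemma covers_iso:
  assumes "covers P Q" and f: "order_iso f Q R"
    and rk: "\<And>F. F \<in> faces Q \<Longrightarrow> rk R (f F) = rk Q F"
  shows "covers P R"
proof -
  obtain \<gamma> where \<gamma>: "\<gamma> ` faces P = faces Q" "\<forall>F\<in>faces P. rk Q (\<gamma> F) = rk P F"
    "\<forall>F G. (F, G) \<in> leq P \<longrightarrow> (\<gamma> F, \<gamma> G) \<in> leq Q"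
    "\<forall>\<Phi>\<in>flags P. \<forall>\<Psi>\<in>flags P. adjacent \<Phi> \<Psi> \<longrightarrow>
       \<gamma> ` \<Phi> \<in> flags Q \<and> \<gamma> ` \<Psi> \<in> flags Q \<and> adjacent (\<gamma> ` \<Phi>) (\<gamma> ` \<Psi>)"
    using assms(1) unfolding covers_def by blast
  have b: "bij_betw f (faces Q) (faces R)" using f by (simp add: order_iso_def)
  have "(f \<circ> \<gamma>) ` faces P = faces R"
    using \<gamma>(1) b unfolding image_comp[symmetric] by (simp add: bij_betw_def)
  moreover have "\<forall>F\<in>faces P. rk R ((f \<circ> \<gamma>) F) = rk P F"
    using \<gamma>(1,2) rk by (metis comp_apply image_eqI)
  moreover have "\<forall>F G. (F, G) \<in> leq P \<longrightarrow> ((f \<circ> \<gamma>) F, (f \<circ> \<gamma>) G) \<in> leq R"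
  proof (intro allI impI)
    fix F G assume "(F, G) \<in> leq P"
    then have FG: "(\<gamma> F, \<gamma> G) \<in> leq Q" using \<gamma>(3) by blast
    then show "((f \<circ> \<gamma>) F, (f \<circ> \<gamma>) G) \<in> leq R"
      using leq_faces[OF FG] f by (simp add: order_iso_def)
  qed
  moreover have "(f \<circ> \<gamma>) ` \<Phi> \<in> flags R \<and> (f \<circ> \<gamma>) ` \<Psi> \<in> flags R \<and>
                 adjacent ((f \<circ> \<gamma>) ` \<Phi>) ((f \<circ> \<gamma>) ` \<Psi>)"
    if "\<Phi> \<in> flags P" "\<Psi> \<in> flags P" "adjacent \<Phi> \<Psi>" for \<Phi> \<Psi>
  proof -
    have *: "\<gamma> ` \<Phi> \<in> flags Q" "\<gamma> ` \<Psi> \<in> flags Q" "adjacent (\<gamma> ` \<Phi>) (\<gamma> ` \<Psi>)"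
      using \<gamma>(4) that by auto
    then have "adjacent (f ` \<gamma> ` \<Phi>) (f ` \<gamma> ` \<Psi>)"
      using b by (intro adjacent_image[of f "faces Q"]) (auto simp: bij_betw_def dest: flag_faces)
    then show ?thesis
      unfolding image_comp[symmetric] using * order_iso_flags[OF f] by blast
  qed
  ultimately show ?thesis unfolding covers_def by blast
qed

lemma polytope_copy_on_nat:
  assumes "polytope d P"
  shows "\<exists>(Q :: nat ranked_poset) f. order_iso f Q P \<and> (\<forall>F\<in>faces Q. rk P (f F) = rk Q F)"
proof -
  let ?e = "to_nat_on (faces P)"
  have inj: "inj_on ?e (faces P)" using countable_faces[OF assms] by (rule inj_on_to_nat_on)
  define Q where "Q = \<lparr>leq = map_prod ?e ?e ` leq P, rk = rk P \<circ> inv_into (faces P) ?e\<rparr>"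
  have fQ: "faces Q = ?e ` faces P"
    by (force simp: Q_def faces_def Field_def image_iff)
  have "(A, B) \<in> leq P \<longleftrightarrow> (?e A, ?e B) \<in> leq Q" if "A \<in> faces P" "B \<in> faces P" for A B
    using that inj leq_faces[of _ _ P] by (auto simp: Q_def inj_on_eq_iff)
  then have e: "order_iso ?e P Q"
    using inj fQ by (simp add: order_iso_def bij_betw_def)
  have "\<forall>F\<in>faces Q. rk P (inv_into (faces P) ?e F) = rk Q F" by (simp add: Q_def)
  then show ?thesis using order_iso_inv[OF e] by blast
qed

theorem free_extension_covers:
  fixes Q :: "'c ranked_poset"
  assumes P: "free_extension d K P" and Q: "regular_extension d K Q"
  shows "covers P Q"
proof -
  have "polytope (Suc d) Q"
    using Q by (simp add: regular_extension_def regular_polytope_def)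
  then obtain N :: "nat ranked_poset" and f where
    f: "order_iso f N Q" and rk: "\<forall>F\<in>faces N. rk Q (f F) = rk N F"
    using polytope_copy_on_nat by blast
  have "rk N (inv_into (faces N) f F) = rk Q F" if "F \<in> faces Q" for F
  proof -
    have b: "bij_betw f (faces N) (faces Q)" using f by (simp add: order_iso_def)
    then have "inv_into (faces N) f F \<in> faces N" "f (inv_into (faces N) f F) = F"
      using that by (auto simp: bij_betw_inv_into_right dest: bij_betw_inv_into bij_betwE)
    then show ?thesis using rk by force
  qed
  then have "regular_extension d K N"
    by (rule regular_extension_iso[OF Q order_iso_inv[OF f]])
  then have "covers P N" using P by (simp add: free_extension_def)
  then show ?thesis using covers_iso[OF _ f] rk by blast
qed

end

(* Label the facets of K by generators r_x of order 2 of their free product W. The free extension is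
   modelled by one copy of K for every element w of W, with the copies w and w r_x glued along the
   facet x; so the faces are the cosets (F, w W_F), where W_F is generated by the r_x with F <= x, and
   a greatest face is added. Reflecting a copy of K through its facets inside any regular extension
   yields a map from this model onto it, which gives both the covering property and the regularity of
   the model. The same map property determines every free extension up to isomorphism.

   An automorphism g acts on the copies of K by w |-> u . alpha(w) for some u in W and alpha in the
   group of K. If u is cyclically reduced in the twisted sense (its last letter differs from alpha of
   its first letter), the words u, u alpha(u), u alpha(u) alpha^2(u), ... never collapse and g has
   infinite order. Otherwise conjugation by a letter shortens u. So if g has finite order, g^2 fixes
   some copy of K, hence its order is a power of 2 by the assumption on the group of K. *)

theory Submission
  imports Defs "HOL-Computational_Algebra.Primes"
begin

section \<open>Flags\<close>

text \<open>The group of \<open>P\<close> is W extended by the group of \<open>K\<close>, another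
  form of the amalgam; it acts on the tree formed by the glued copies. In an amalgam an element of
  finite order is conjugate into a factor, and the length argument on u plays the role of this
  theorem. A conjugate into the group of \<open>K\<close> fixes a copy, but a conjugate into
  Gamma(F) x C_2 may exchange two copies glued along a facet; this exchange is the reason for
  passing to g^2.

  Maps out of the model are assembled copy by copy, so the basic notion has to cover maps of
  \<open>K\<close> into a polytope of larger rank: they preserve rank and order and do not fold
  adjacent flags together. Such a map is determined by its values on one flag, and most uniqueness
  claims reduce to this rigidity.

  Isomorphisms are defined by the order alone, so ranks have to be recovered from it. Finite
  generation holds for every regular polytope; the torsion condition is carried from the model to an
  arbitrary free extension as a statement about iterates on faces.\<close>

lemma polytope_refl: "polytope d P \<Longrightarrow> F \<in> faces P \<Longrightarrow> (F, F) \<in> leq P"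
  by (auto simp: polytope_def faces_def partial_order_on_def preorder_on_def refl_on_def)

lemma polytope_trans: "polytope d P \<Longrightarrow> (F, G) \<in> leq P \<Longrightarrow> (G, H) \<in> leq P \<Longrightarrow> (F, H) \<in> leq P"
  unfolding polytope_def partial_order_on_def preorder_on_def by (meson transD)

lemma polytope_antisym: "polytope d P \<Longrightarrow> (F, G) \<in> leq P \<Longrightarrow> (G, F) \<in> leq P \<Longrightarrow> F = G"
  unfolding polytope_def partial_order_on_def by (meson antisymD)

lemma polytope_rk_less: "polytope d P \<Longrightarrow> (F, G) \<in> leq P \<Longrightarrow> F \<noteq> G \<Longrightarrow> rk P F < rk P G"
  using leq_faces[of F G P] unfolding polytope_def by blast

lemma polytope_rk_le: "polytope d P \<Longrightarrow> (F, G) \<in> leq P \<Longrightarrow> rk P F \<le> rk P G"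
  using polytope_rk_less by fastforce

lemma polytope_rk_range: "polytope d P \<Longrightarrow> F \<in> faces P \<Longrightarrow> rk P F \<in> {-1..int d}"
  unfolding polytope_def by blast

lemma polytope_diamond:
  assumes "polytope d P" "(F, G) \<in> leq P" "rk P G = rk P F + 2"
  shows "card {H \<in> faces P. (F, H) \<in> leq P \<and> (H, G) \<in> leq P \<and> rk P H = rk P F + 1} = 2"
  using assms leq_faces[of F G P] unfolding polytope_def by blast

lemma flag_rk: "polytope d P \<Longrightarrow> \<Phi> \<in> flags P \<Longrightarrow> bij_betw (rk P) \<Phi> {-1..int d}"
  unfolding polytope_def by blast

lemma flag_face_of_rank:
  assumes "polytope d P" "\<Phi> \<in> flags P" "-1 \<le> i" "i \<le> int d"
  shows "\<exists>F\<in>\<Phi>. rk P F = i"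
proof -
  have "i \<in> rk P ` \<Phi>" using flag_rk[OF assms(1,2)] assms(3,4) by (simp add: bij_betw_def)
  then show ?thesis by auto
qed

lemma flag_rk_inj:
  "polytope d P \<Longrightarrow> \<Phi> \<in> flags P \<Longrightarrow> F \<in> \<Phi> \<Longrightarrow> G \<in> \<Phi> \<Longrightarrow> rk P F = rk P G \<Longrightarrow> F = G"
  using flag_rk by (auto simp: bij_betw_def dest: inj_onD)

lemma flag_finite: "polytope d P \<Longrightarrow> \<Phi> \<in> flags P \<Longrightarrow> finite \<Phi>"
  using flag_rk bij_betw_finite by blast

lemma flag_comparable:
  "\<Phi> \<in> flags P \<Longrightarrow> F \<in> \<Phi> \<Longrightarrow> G \<in> \<Phi> \<Longrightarrow> (F, G) \<in> leq P \<or> (G, F) \<in> leq P"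
  by (auto simp: flags_def Chains_def)

lemma flag_leq_iff:
  assumes "polytope d P" "\<Phi> \<in> flags P" "F \<in> \<Phi>" "G \<in> \<Phi>"
  shows "(F, G) \<in> leq P \<longleftrightarrow> rk P F \<le> rk P G"
  using flag_comparable[OF assms(2-4)] polytope_rk_le[OF assms(1)] flag_rk_inj[OF assms]
  by (metis order_antisym)

lemma comparable_rk_inj:
  assumes "polytope d P" "(F, G) \<in> leq P \<or> (G, F) \<in> leq P" "rk P F = rk P G"
  shows "F = G"
  using assms polytope_rk_less by fastforce

text \<open>A face comparable with all of \<open>C\<close> has the rank of some member, and
  comparable faces of equal rank coincide, so \<open>C\<close> cannot be enlarged.\<close>

lemma flagI:
  assumes P: "polytope d P" and C: "C \<in> Chains (leq P)" and rk: "{-1..int d} \<subseteq> rk P ` C"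
  shows "C \<in> flags P"
proof -
  have "F \<in> C" if D: "D \<in> Chains (leq P)" "C \<subseteq> D" "F \<in> D" for D F
  proof -
    have "F \<in> faces P" using D Chains_faces by blast
    then have "rk P F \<in> rk P ` C" using polytope_rk_range[OF P] rk by blast
    then obtain G where G: "G \<in> C" "rk P F = rk P G" by auto
    then have "F = G"
      using D comparable_rk_inj[OF P] by (auto simp: Chains_def)
    then show ?thesis using G by simp
  qed
  then show ?thesis using C by (auto simp: flags_def)
qed

lemma flag_maximal:
  assumes P: "polytope d P" and \<Phi>: "\<Phi> \<in> flags P" and F: "F \<in> faces P"
    and comp: "\<And>G. G \<in> \<Phi> \<Longrightarrow> (F, G) \<in> leq P \<or> (G, F) \<in> leq P"
  shows "F \<in> \<Phi>"
proof -
  obtain G where "G \<in> \<Phi>" "rk P G = rk P F"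
    using flag_face_of_rank[OF P \<Phi>] polytope_rk_range[OF P F] by auto
  then show ?thesis using comparable_rk_inj[OF P comp] by metis
qed

text \<open>Zorn's lemma for the chains containing \<open>C\<close>. The empty chain gives the
  existence of a flag, a pair of comparable faces a flag through both.\<close>

lemma chain_in_flag:
  assumes C: "C \<in> Chains (leq P)"
  shows "\<exists>\<Phi>\<in>flags P. C \<subseteq> \<Phi>"
proof -
  let ?A = "{D \<in> Chains (leq P). C \<subseteq> D}"
  have "\<exists>U\<in>?A. \<forall>X\<in>\<C>. X \<subseteq> U" if "subset.chain ?A \<C>" for \<C>
  proof (cases "\<C> = {}")
    case False
    have sub: "\<C> \<subseteq> ?A" using that by (auto simp: subset.chain_def)
    have "(a, b) \<in> leq P \<or> (b, a) \<in> leq P" if ab: "a \<in> \<Union>\<C>" "b \<in> \<Union>\<C>" for a b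
    proof -
      obtain X Y where XY: "X \<in> \<C>" "Y \<in> \<C>" "a \<in> X" "b \<in> Y" using ab by blast
      then have "X \<subseteq> Y \<or> Y \<subseteq> X"
        using \<open>subset.chain ?A \<C>\<close> by (auto simp: subset_chain_def)
      then obtain Z where "Z \<in> \<C>" "a \<in> Z" "b \<in> Z" using XY by blast
      then show ?thesis using sub by (auto simp: Chains_def)
    qed
    then have "\<Union>\<C> \<in> Chains (leq P)" by (auto simp: Chains_def)
    then have "\<Union>\<C> \<in> ?A" using False sub by blast
    then show ?thesis by blast
  qed (use C in blast)
  then have "\<exists>M\<in>?A. \<forall>X\<in>?A. M \<subseteq> X \<longrightarrow> X = M" by (rule subset_Zorn)
  then show ?thesis by (fastforce simp: flags_def)
qed

lemma leq_in_flag: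
  assumes "polytope d P" "(F, G) \<in> leq P"
  shows "\<exists>\<Phi>\<in>flags P. F \<in> \<Phi> \<and> G \<in> \<Phi>"
proof -
  have "{F, G} \<in> Chains (leq P)"
    using assms leq_faces[OF assms(2)] polytope_refl[OF assms(1)] by (auto simp: Chains_def)
  from chain_in_flag[OF this] show ?thesis by auto
qed

lemma flags_nonempty: "polytope d P \<Longrightarrow> flags P \<noteq> {}"
  using chain_in_flag[of "{}" P] by (auto simp: Chains_def)

lemma greatest_in_flag:
  "polytope d P \<Longrightarrow> \<Phi> \<in> flags P \<Longrightarrow> M \<in> faces P \<Longrightarrow> \<forall>G\<in>faces P. (G, M) \<in> leq P \<Longrightarrow> M \<in> \<Phi>"
  using flag_maximal[of d P \<Phi> M] flag_faces[of \<Phi> P] by blast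

lemma least_in_flag:
  "polytope d P \<Longrightarrow> \<Phi> \<in> flags P \<Longrightarrow> E \<in> faces P \<Longrightarrow> \<forall>G\<in>faces P. (E, G) \<in> leq P \<Longrightarrow> E \<in> \<Phi>"
  using flag_maximal[of d P \<Phi> E] flag_faces[of \<Phi> P] by blast

section \<open>Adjacent flags and the diamond condition\<close>

lemma adjacent_sym: "adjacent \<Phi> \<Psi> \<Longrightarrow> adjacent \<Psi> \<Phi>"
  by (simp add: adjacent_def)

lemma adjacent_exchange:
  assumes "b \<in> \<Phi>" "b' \<notin> \<Phi>"
  shows "adjacent \<Phi> (insert b' (\<Phi> - {b}))"
proof -
  have "\<Phi> - insert b' (\<Phi> - {b}) = {b}" "insert b' (\<Phi> - {b}) - \<Phi> = {b'}" using assms by auto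
  then show ?thesis by (simp add: adjacent_def)
qed

text \<open>Exhibits the diamond in which two adjacent flags differ, with \<open>l\<close> and
  \<open>u\<close> at its ends. The exchanged face is neither least nor greatest, because those two
  faces lie in every flag.\<close>

lemma adjacent_flagsE:
  assumes P: "polytope d P" and \<Phi>: "\<Phi> \<in> flags P" and \<Psi>: "\<Psi> \<in> flags P" and adj: "adjacent \<Phi> \<Psi>"
  obtains b b' l u where "\<Phi> - \<Psi> = {b}" "\<Psi> - \<Phi> = {b'}" "rk P b' = rk P b"
    "l \<in> \<Phi> \<inter> \<Psi>" "u \<in> \<Phi> \<inter> \<Psi>" "rk P l = rk P b - 1" "rk P u = rk P b + 1"
proof -
  obtain b b' where b: "\<Phi> - \<Psi> = {b}" and b': "\<Psi> - \<Phi> = {b'}"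
    using adj unfolding adjacent_def by (meson card_1_singletonE)
  then have in': "b \<in> \<Phi>" "b \<notin> \<Psi>" "b' \<in> \<Psi>" "b' \<notin> \<Phi>" by auto
  have fc: "b \<in> faces P" "b' \<in> faces P" using in' flag_faces \<Phi> \<Psi> by blast+
  obtain X where X: "X \<in> \<Psi>" "rk P X = rk P b"
    using flag_face_of_rank[OF P \<Psi>] polytope_rk_range[OF P fc(1)] by auto
  have "X = b'"
    using X in' b b' flag_rk_inj[OF P \<Phi>, of X b] by blast
  then have rk: "rk P b' = rk P b" using X by simp
  obtain E M where E: "E \<in> faces P" "rk P E = -1" "\<forall>G\<in>faces P. (E, G) \<in> leq P"
    and M: "M \<in> faces P" "rk P M = int d" "\<forall>G\<in>faces P. (G, M) \<in> leq P"
    using polytope_least[OF P] polytope_greatest[OF P] by blast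
  have "E \<in> \<Phi>" "E \<in> \<Psi>" "M \<in> \<Phi>" "M \<in> \<Psi>"
    using E M least_in_flag[OF P] greatest_in_flag[OF P] \<Phi> \<Psi> by auto
  then have "E \<noteq> b" "b \<noteq> M" using in' by auto
  then have "rk P b > -1" "rk P b < int d"
    using E M fc polytope_rk_less[OF P, of E b] polytope_rk_less[OF P, of b M] by auto
  then obtain l u where lu: "l \<in> \<Phi>" "rk P l = rk P b - 1" "u \<in> \<Phi>" "rk P u = rk P b + 1"
    using flag_face_of_rank[OF P \<Phi>, of "rk P b - 1"] flag_face_of_rank[OF P \<Phi>, of "rk P b + 1"] by auto
  then have "l \<in> \<Psi>" "u \<in> \<Psi>" using b by force+
  then show ?thesis using that b b' rk lu by blast
qed

text \<open>Existence of the flag \<Phi>^j for a proper rank j: the new face is the second middle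
  face of the diamond between the members of \<Phi> one rank below and one rank above
  \<open>b\<close>.\<close>

lemma adjacent_flag_exists:
  assumes P: "polytope d P" and \<Phi>: "\<Phi> \<in> flags P" and b: "b \<in> \<Phi>" "-1 < rk P b" "rk P b < int d"
  shows "\<exists>b'. b' \<notin> \<Phi> \<and> rk P b' = rk P b \<and> insert b' (\<Phi> - {b}) \<in> flags P"
proof -
  obtain l u where lu: "l \<in> \<Phi>" "rk P l = rk P b - 1" "u \<in> \<Phi>" "rk P u = rk P b + 1"
    using b flag_face_of_rank[OF P \<Phi>, of "rk P b - 1"] flag_face_of_rank[OF P \<Phi>, of "rk P b + 1"] by auto
  let ?S = "{H \<in> faces P. (l, H) \<in> leq P \<and> (H, u) \<in> leq P \<and> rk P H = rk P l + 1}"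
  have "card ?S = 2"
    using lu flag_leq_iff[OF P \<Phi>, of l u] by (intro polytope_diamond[OF P]) auto
  then obtain x y where "?S = {x, y}" "x \<noteq> y" by (auto simp: card_2_iff)
  then obtain b' where b': "b' \<in> ?S" "b' \<noteq> b" by blast
  have rkb': "rk P b' = rk P b" using b' lu by auto
  have nin: "b' \<notin> \<Phi>" using b' rkb' flag_rk_inj[OF P \<Phi> _ b(1)] by blast
  have cmp: "(b', G) \<in> leq P \<or> (G, b') \<in> leq P" if G: "G \<in> \<Phi>" "G \<noteq> b" for G
  proof -
    have "rk P G \<noteq> rk P b" using G flag_rk_inj[OF P \<Phi> _ b(1)] by blast
    then consider "rk P u \<le> rk P G" | "rk P G \<le> rk P l" using lu by linarith
    then show ?thesis
    proof cases
      case 1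
      then have "(u, G) \<in> leq P" using flag_leq_iff[OF P \<Phi>] lu G by simp
      then show ?thesis using b' polytope_trans[OF P] by blast
    next
      case 2
      then have "(G, l) \<in> leq P" using flag_leq_iff[OF P \<Phi>] lu G by simp
      then show ?thesis using b' polytope_trans[OF P] by blast
    qed
  qed
  have "insert b' (\<Phi> - {b}) \<in> Chains (leq P)"
    using cmp flag_comparable[OF \<Phi>] b' polytope_refl[OF P, of b'] by (auto simp: Chains_def)
  moreover have "rk P ` insert b' (\<Phi> - {b}) = rk P ` \<Phi>"
    using rkb' b(1) by (auto simp: image_iff)
  then have "rk P ` insert b' (\<Phi> - {b}) = {-1..int d}"
    using flag_rk[OF P \<Phi>] by (simp add: bij_betw_def)
  ultimately have "insert b' (\<Phi> - {b}) \<in> flags P"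
    by (intro flagI[OF P]) auto
  then show ?thesis using nin rkb' by blast
qed

lemma diamond_unique:
  assumes P: "polytope d P" and lu: "(l, u) \<in> leq P" "rk P u = rk P l + 2"
    and "(l, x) \<in> leq P" "(x, u) \<in> leq P" "rk P x = rk P l + 1"
    and "(l, y) \<in> leq P" "(y, u) \<in> leq P" "rk P y = rk P l + 1"
    and "(l, z) \<in> leq P" "(z, u) \<in> leq P" "rk P z = rk P l + 1"
    and "x \<noteq> z" "y \<noteq> z"
  shows "x = y"
proof -
  let ?S = "{H \<in> faces P. (l, H) \<in> leq P \<and> (H, u) \<in> leq P \<and> rk P H = rk P l + 1}"
  have "x \<in> ?S" "y \<in> ?S" "z \<in> ?S" using assms by (auto dest: leq_faces)
  moreover have "card ?S = 2" using polytope_diamond[OF P lu] .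
  then obtain p q where "?S = {p, q}" by (auto simp: card_2_iff)
  ultimately have "x \<in> {p, q}" "y \<in> {p, q}" "z \<in> {p, q}" by simp_all
  then show ?thesis using assms(13,14) by auto
qed

text \<open>Uniqueness of \<Phi>^j, where the flag is named by the face \<open>b\<close> that is
  given up instead of by its rank.\<close>

lemma adjacent_flags_unique:
  assumes P: "polytope d P" and fl: "\<Phi> \<in> flags P" "\<Psi> \<in> flags P" "\<Psi>' \<in> flags P"
    and adj: "adjacent \<Phi> \<Psi>" "adjacent \<Phi> \<Psi>'"
    and b: "b \<in> \<Phi>" "b \<notin> \<Psi>" "b \<notin> \<Psi>'"
  shows "\<Psi> = \<Psi>'"
proof -
  obtain c' l u where c: "\<Phi> - \<Psi> = {b}" "\<Psi> - \<Phi> = {c'}" "rk P c' = rk P b"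
    "l \<in> \<Phi> \<inter> \<Psi>" "u \<in> \<Phi> \<inter> \<Psi>" "rk P l = rk P b - 1" "rk P u = rk P b + 1"
    using adjacent_flagsE[OF P fl(1,2) adj(1)] b by (metis DiffI singletonD)
  obtain e' where e: "\<Phi> - \<Psi>' = {b}" "\<Psi>' - \<Phi> = {e'}" "rk P e' = rk P b"
    using adjacent_flagsE[OF P fl(1,3) adj(2)] b by (metis DiffI singletonD)
  have "l \<noteq> b" "u \<noteq> b" using c by auto
  then have lu: "l \<in> \<Psi>'" "u \<in> \<Psi>'" using c(4,5) e(1) by auto
  have inn: "c' \<in> \<Psi>" "e' \<in> \<Psi>'" "c' \<notin> \<Phi>" "e' \<notin> \<Phi>" using c e by auto
  have "c' = e'"
  proof (rule diamond_unique[OF P, of l u c' e' b])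
    show "(l, u) \<in> leq P" "(l, b) \<in> leq P" "(b, u) \<in> leq P"
      using flag_leq_iff[OF P fl(1)] c b by auto
    show "(l, c') \<in> leq P" "(c', u) \<in> leq P"
      using flag_leq_iff[OF P fl(2)] c inn by auto
    show "(l, e') \<in> leq P" "(e', u) \<in> leq P"
      using flag_leq_iff[OF P fl(3)] c e lu inn by auto
  qed (use c e b inn in auto)
  moreover have "\<Psi> = insert c' (\<Phi> - {b})" "\<Psi>' = insert e' (\<Phi> - {b})" using c e by auto
  ultimately show ?thesis by simp
qed

text \<open>Strong flag-connectedness as an induction rule. The invariant that all flags on the path
  contain \<open>\<Phi> \<inter> \<Psi>\<close> permits arguments confined to the flags through a
  fixed face.\<close>

lemma flag_connected_induct [consumes 3, case_names base step]:
  assumes P: "polytope d P" and \<Phi>: "\<Phi> \<in> flags P" and \<Psi>: "\<Psi> \<in> flags P"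
    and base: "Q \<Phi>"
    and step: "\<And>A B. A \<in> flags P \<Longrightarrow> B \<in> flags P \<Longrightarrow> \<Phi> \<inter> \<Psi> \<subseteq> A \<Longrightarrow> \<Phi> \<inter> \<Psi> \<subseteq> B \<Longrightarrow>
      adjacent A B \<Longrightarrow> Q A \<Longrightarrow> Q B"
  shows "Q \<Psi>"
proof -
  have "(\<Phi>, \<Psi>) \<in> {(A, B). A \<in> flags P \<and> B \<in> flags P \<and>
           \<Phi> \<inter> \<Psi> \<subseteq> A \<and> \<Phi> \<inter> \<Psi> \<subseteq> B \<and> adjacent A B}\<^sup>*"
    using P \<Phi> \<Psi> unfolding polytope_def strongly_flag_connected_def by blast
  then show ?thesis
    by (induction rule: rtrancl_induct) (use base step in auto)
qed

section \<open>Immersions\<close>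

text \<open>
  Between polytopes of the same rank these are the coverings (\<open>covers_iff_immersion\<close>), but the
  target may have larger rank, as for the inclusion of a facet.
\<close>

definition immersion :: "('a \<Rightarrow> 'b) \<Rightarrow> 'a ranked_poset \<Rightarrow> 'b ranked_poset \<Rightarrow> bool" where
  "immersion \<gamma> P Q \<longleftrightarrow>
     (\<forall>F\<in>faces P. rk Q (\<gamma> F) = rk P F) \<and>
     (\<forall>F G. (F, G) \<in> leq P \<longrightarrow> (\<gamma> F, \<gamma> G) \<in> leq Q) \<and>
     (\<forall>\<Phi>\<in>flags P. \<forall>\<Psi>\<in>flags P. adjacent \<Phi> \<Psi> \<longrightarrow> \<gamma> ` \<Phi> \<noteq> \<gamma> ` \<Psi>)"

lemma immersion_rk: "immersion \<gamma> P Q \<Longrightarrow> F \<in> faces P \<Longrightarrow> rk Q (\<gamma> F) = rk P F"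
  by (simp add: immersion_def)

lemma immersion_leq: "immersion \<gamma> P Q \<Longrightarrow> (F, G) \<in> leq P \<Longrightarrow> (\<gamma> F, \<gamma> G) \<in> leq Q"
  by (simp add: immersion_def)

lemma immersion_faces: "polytope d P \<Longrightarrow> immersion \<gamma> P Q \<Longrightarrow> F \<in> faces P \<Longrightarrow> \<gamma> F \<in> faces Q"
  using immersion_leq polytope_refl leq_faces by metis

section \<open>Rigidity of immersions\<close>

lemma immersion_distinct:
  assumes "immersion \<gamma> P Q" "\<Phi> \<in> flags P" "\<Psi> \<in> flags P" "adjacent \<Phi> \<Psi>"
    and "\<Phi> - \<Psi> = {b}" "\<Psi> - \<Phi> = {b'}"
  shows "\<gamma> b \<noteq> \<gamma> b'"
proof
  assume "\<gamma> b = \<gamma> b'"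
  moreover have "\<Phi> = insert b (\<Phi> \<inter> \<Psi>)" "\<Psi> = insert b' (\<Phi> \<inter> \<Psi>)" using assms by auto
  ultimately have "\<gamma> ` \<Phi> = \<gamma> ` \<Psi>" by (metis image_insert)
  then show False using assms by (auto simp: immersion_def)
qed

text \<open>Agreement spreads along a flag path: the image of a new face \<open>b'\<close> must be
  the second middle face of a diamond whose first middle face is the image of \<open>b\<close>. The
  path stays in flags through \<open>y\<close> and only faces below \<open>y\<close> are compared,
  so the result also applies to maps that agree on a facet and differ above it.\<close>

lemma immersion_agree_below:
  assumes P: "polytope n P" and Q: "polytope m Q"
    and i1: "immersion \<gamma> P Q" and i2: "immersion \<delta> P Q"
    and \<Phi>: "\<Phi> \<in> flags P" and y: "y \<in> \<Phi>"
    and agree: "\<And>F. F \<in> \<Phi> \<Longrightarrow> (F, y) \<in> leq P \<Longrightarrow> \<gamma> F = \<delta> F"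
    and F: "(F, y) \<in> leq P"
  shows "\<gamma> F = \<delta> F"
proof -
  obtain \<Psi> where \<Psi>: "\<Psi> \<in> flags P" "F \<in> \<Psi>" "y \<in> \<Psi>" using leq_in_flag[OF P F] by blast
  have "\<forall>G\<in>\<Psi>. (G, y) \<in> leq P \<longrightarrow> \<gamma> G = \<delta> G"
    using P \<Phi> \<Psi>(1)
  proof (induction rule: flag_connected_induct)
    case base
    then show ?case using agree by blast
  next
    case (step A B)
    have yAB: "y \<in> A" "y \<in> B" using step(3,4) y \<Psi>(3) by auto
    obtain b b' l u where b: "A - B = {b}" "B - A = {b'}" "rk P b' = rk P b"
      "l \<in> A \<inter> B" "u \<in> A \<inter> B" "rk P l = rk P b - 1" "rk P u = rk P b + 1"
      by (rule adjacent_flagsE[OF P step(1,2,5)])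
    have inn: "b \<in> A" "b' \<in> B" using b by auto
    have "\<gamma> b' = \<delta> b'" if b'y: "(b', y) \<in> leq P"
    proof -
      \<comment> \<open>As \<open>b'\<close> lies strictly below \<open>y\<close>, its upper
        neighbour \<open>u\<close> is still below \<open>y\<close>, so the induction hypothesis
        covers \<open>l\<close>, \<open>u\<close> and \<open>b\<close>.\<close>
      have "b' \<noteq> y" using b yAB by auto
      then have "rk P b' < rk P y" using polytope_rk_less[OF P b'y] by simp
      then have uy: "(u, y) \<in> leq P" using flag_leq_iff[OF P step(1)] b yAB by auto
      have le: "(l, u) \<in> leq P" "(l, b) \<in> leq P" "(b, u) \<in> leq P"
        using flag_leq_iff[OF P step(1)] b inn by auto
      have le': "(l, b') \<in> leq P" "(b', u) \<in> leq P"
        using flag_leq_iff[OF P step(2)] b inn by auto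
      have eq: "\<gamma> l = \<delta> l" "\<gamma> u = \<delta> u" "\<gamma> b = \<delta> b"
        using bspec[OF step(6)] polytope_trans[OF P le(1) uy] polytope_trans[OF P le(3) uy] uy b(4,5) inn(1)
        by simp_all
      have fc: "l \<in> faces P" "u \<in> faces P" "b \<in> faces P" "b' \<in> faces P"
        using le le' by (auto dest: leq_faces)
      show ?thesis
      proof (rule diamond_unique[OF Q, of "\<gamma> l" "\<gamma> u" _ _ "\<gamma> b"])
        show "(\<gamma> l, \<gamma> u) \<in> leq Q" "(\<gamma> l, \<gamma> b) \<in> leq Q" "(\<gamma> b, \<gamma> u) \<in> leq Q"
             "(\<gamma> l, \<gamma> b') \<in> leq Q" "(\<gamma> b', \<gamma> u) \<in> leq Q"
          by (intro immersion_leq[OF i1] le le')+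
        show "(\<gamma> l, \<delta> b') \<in> leq Q" "(\<delta> b', \<gamma> u) \<in> leq Q"
          unfolding eq by (intro immersion_leq[OF i2] le le')+
        show "rk Q (\<gamma> u) = rk Q (\<gamma> l) + 2" "rk Q (\<gamma> b') = rk Q (\<gamma> l) + 1"
          "rk Q (\<delta> b') = rk Q (\<gamma> l) + 1" "rk Q (\<gamma> b) = rk Q (\<gamma> l) + 1"
          by (simp_all add: fc b(3,6,7) immersion_rk[OF i1] immersion_rk[OF i2])
        show "\<gamma> b' \<noteq> \<gamma> b" "\<delta> b' \<noteq> \<gamma> b"
          using immersion_distinct[OF i1 step(1,2,5) b(1,2)]
            immersion_distinct[OF i2 step(1,2,5) b(1,2)] eq(3) by simp_all
      qed
    qed
    moreover have "G \<in> A" if "G \<in> B" "G \<noteq> b'" for G using that b by auto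
    ultimately show ?case using bspec[OF step(6)] by (metis (full_types))
  qed
  from bspec[OF this \<Psi>(2)] F show ?thesis by (rule mp)
qed

lemma immersion_agree:
  assumes P: "polytope n P" and Q: "polytope m Q"
    and i1: "immersion \<gamma> P Q" and i2: "immersion \<delta> P Q"
    and \<Phi>: "\<Phi> \<in> flags P" and agree: "\<And>F. F \<in> \<Phi> \<Longrightarrow> \<gamma> F = \<delta> F"
    and F: "F \<in> faces P"
  shows "\<gamma> F = \<delta> F"
proof -
  obtain M where M: "M \<in> faces P" "\<forall>G\<in>faces P. (G, M) \<in> leq P" using polytope_greatest[OF P] by blast
  show ?thesis
  proof (rule immersion_agree_below[OF P Q i1 i2 \<Phi>, where y = M])
    show "M \<in> \<Phi>" using greatest_in_flag[OF P \<Phi> M] .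
    show "(F, M) \<in> leq P" using M F by simp
  qed (rule agree)
qed

text \<open>Faces need not be matched one by one: ranks are preserved and a flag has a single face
  of each rank.\<close>

lemma immersion_agree_flag:
  assumes P: "polytope n P" and Q: "polytope m Q"
    and i1: "immersion \<gamma> P Q" and i2: "immersion \<delta> P Q"
    and \<Phi>: "\<Phi> \<in> flags P" and \<Psi>: "\<Psi> \<in> flags Q" "\<gamma> ` \<Phi> \<subseteq> \<Psi>" "\<delta> ` \<Phi> \<subseteq> \<Psi>"
    and F: "F \<in> faces P"
  shows "\<gamma> F = \<delta> F"
proof (rule immersion_agree[OF P Q i1 i2 \<Phi> _ F])
  fix F assume F: "F \<in> \<Phi>"
  then have "F \<in> faces P" using flag_faces[OF \<Phi>] by blast
  then have "rk Q (\<gamma> F) = rk Q (\<delta> F)" using immersion_rk[OF i1] immersion_rk[OF i2] by simp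
  moreover have "\<gamma> F \<in> \<Psi>" "\<delta> F \<in> \<Psi>" using F \<Psi> by auto
  ultimately show "\<gamma> F = \<delta> F" using flag_rk_inj[OF Q \<Psi>(1)] by blast
qed

section \<open>Images of flags and path lifting\<close>

lemma immersion_flag:
  assumes P: "polytope n P" and Q: "polytope n Q" and i: "immersion \<gamma> P Q" and \<Phi>: "\<Phi> \<in> flags P"
  shows "\<gamma> ` \<Phi> \<in> flags Q"
proof (rule flagI[OF Q])
  have "(\<gamma> x, \<gamma> y) \<in> leq Q \<or> (\<gamma> y, \<gamma> x) \<in> leq Q" if "x \<in> \<Phi>" "y \<in> \<Phi>" for x y
    using flag_comparable[OF \<Phi> that] immersion_leq[OF i] by blast
  then show "\<gamma> ` \<Phi> \<in> Chains (leq Q)" by (simp add: Chains_def)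
  have "rk Q (\<gamma> x) = rk P x" if "x \<in> \<Phi>" for x
    using flag_faces[OF \<Phi>] immersion_rk[OF i] that by blast
  then have "rk Q ` \<gamma> ` \<Phi> = rk P ` \<Phi>"
    unfolding image_image by (rule image_cong[OF refl])
  then show "{-1..int n} \<subseteq> rk Q ` \<gamma> ` \<Phi>" using flag_rk[OF P \<Phi>] by (simp add: bij_betw_def)
qed

lemma immersion_flag_eqI:
  assumes P: "polytope n P" and i: "immersion \<gamma> P P" and \<Phi>: "\<Phi> \<in> flags P" "\<gamma> ` \<Phi> = \<Phi>"
    and F: "F \<in> faces P"
  shows "\<gamma> F = F"
proof (rule immersion_agree_flag[OF P P i _ \<Phi>(1,1) _ _ F])
  show "immersion (\<lambda>x. x) P P" by (auto simp: immersion_def adjacent_def)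
qed (use \<Phi> in auto)

text \<open>The definition only asks that the two images differ. Preservation of rank makes
  \<open>\<gamma>\<close> injective on each flag, which upgrades inequality to adjacency.\<close>

lemma immersion_adjacent:
  assumes P: "polytope n P" and i: "immersion \<gamma> P Q"
    and \<Phi>: "\<Phi> \<in> flags P" and \<Psi>: "\<Psi> \<in> flags P" and adj: "adjacent \<Phi> \<Psi>"
  shows "adjacent (\<gamma> ` \<Phi>) (\<gamma> ` \<Psi>)"
proof -
  obtain b b' where b: "\<Phi> - \<Psi> = {b}" "\<Psi> - \<Phi> = {b'}" "rk P b' = rk P b"
    using adjacent_flagsE[OF P \<Phi> \<Psi> adj] by metis
  have ne: "\<gamma> b \<noteq> \<gamma> b'" using immersion_distinct[OF i \<Phi> \<Psi> adj b(1,2)] .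
  have inj: "x = y" if "x \<in> \<Theta>" "y \<in> \<Theta>" "\<gamma> x = \<gamma> y" "\<Theta> \<in> flags P" for x y \<Theta>
  proof -
    have "rk P x = rk P y"
      using that(3) immersion_rk[OF i, of x] immersion_rk[OF i, of y]
        subsetD[OF flag_faces[OF that(4)]] that(1,2) by simp
    then show ?thesis using flag_rk_inj[OF P that(4,1,2)] by blast
  qed
  have "\<gamma> b \<notin> \<gamma> ` \<Psi>"
  proof
    assume "\<gamma> b \<in> \<gamma> ` \<Psi>"
    then obtain x where x: "x \<in> \<Psi>" "\<gamma> x = \<gamma> b" by auto
    then have "x \<noteq> b'" using ne by auto
    then have "x \<in> \<Phi>" using b(2) x(1) by blast
    then show False using x b(1) inj[OF _ _ x(2) \<Phi>] by auto
  qed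
  moreover have "\<gamma> b' \<notin> \<gamma> ` \<Phi>"
  proof
    assume "\<gamma> b' \<in> \<gamma> ` \<Phi>"
    then obtain x where x: "x \<in> \<Phi>" "\<gamma> x = \<gamma> b'" by auto
    then have "x \<noteq> b" using ne by auto
    then have "x \<in> \<Psi>" using b(1) x(1) by blast
    then show False using x b(2) inj[OF _ _ x(2) \<Psi>] by auto
  qed
  moreover have "\<gamma> ` \<Phi> = insert (\<gamma> b) (\<gamma> ` (\<Phi> \<inter> \<Psi>))" "\<gamma> ` \<Psi> = insert (\<gamma> b') (\<gamma> ` (\<Phi> \<inter> \<Psi>))"
    using b(1,2) unfolding image_insert[symmetric] by (auto intro!: arg_cong[where f = "image \<gamma>"])
  ultimately have "\<gamma> ` \<Phi> - \<gamma> ` \<Psi> = {\<gamma> b}" "\<gamma> ` \<Psi> - \<gamma> ` \<Phi> = {\<gamma> b'}"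
    by auto
  then show ?thesis by (simp add: adjacent_def)
qed

text \<open>Path lifting: a flag path in \<open>Q\<close> that starts at the image of a flag is
  lifted step by step, by exchanging the face that lies over the one exchanged in
  \<open>Q\<close>.\<close>

lemma immersion_surj_flags:
  assumes P: "polytope n P" and Q: "polytope n Q" and i: "immersion \<gamma> P Q" and \<Psi>: "\<Psi> \<in> flags Q"
  shows "\<exists>\<Phi>\<in>flags P. \<gamma> ` \<Phi> = \<Psi>"
proof -
  obtain \<Phi> where \<Phi>: "\<Phi> \<in> flags P" using flags_nonempty[OF P] by blast
  have "\<gamma> ` \<Phi> \<in> flags Q" using immersion_flag[OF P Q i \<Phi>] .
  with Q show ?thesis using \<Psi>
  proof (induction rule: flag_connected_induct)
    case base
    then show ?case using \<Phi> by blast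
  next
    case (step A B)
    then obtain \<Theta> where \<Theta>: "\<Theta> \<in> flags P" "\<gamma> ` \<Theta> = A" by blast
    obtain b b' l u where b: "A - B = {b}" "B - A = {b'}" "rk Q b' = rk Q b"
      "l \<in> A \<inter> B" "u \<in> A \<inter> B" "rk Q l = rk Q b - 1" "rk Q u = rk Q b + 1"
      by (rule adjacent_flagsE[OF Q step(1,2,5)])
    have "b \<in> \<gamma> ` \<Theta>" using b(1) \<Theta>(2) by auto
    then obtain x where x: "x \<in> \<Theta>" "\<gamma> x = b" by auto
    have "l \<in> faces Q" "u \<in> faces Q" using b flag_faces[OF step(1)] by auto
    then have "-1 \<le> rk Q l" "rk Q u \<le> int n" using polytope_rk_range[OF Q] by auto
    moreover have "rk P x = rk Q b" using x immersion_rk[OF i, of x] subsetD[OF flag_faces[OF \<Theta>(1)]] by simp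
    ultimately have "-1 < rk P x" "rk P x < int n" using b by auto
    then obtain x' where x': "x' \<notin> \<Theta>" "rk P x' = rk P x" "insert x' (\<Theta> - {x}) \<in> flags P"
      using adjacent_flag_exists[OF P \<Theta>(1) x(1)] by blast
    let ?\<Theta> = "insert x' (\<Theta> - {x})"
    have adj: "adjacent \<Theta> ?\<Theta>" using adjacent_exchange[OF x(1) x'(1)] .
    have d: "\<Theta> - ?\<Theta> = {x}" "?\<Theta> - \<Theta> = {x'}" using x x' by auto
    have "b \<notin> \<gamma> ` ?\<Theta>"
    proof
      assume "b \<in> \<gamma> ` ?\<Theta>"
      then obtain z where z: "z \<in> ?\<Theta>" "\<gamma> z = b" by auto
      then have "rk P z = rk P x"
        using immersion_rk[OF i, of z] subsetD[OF flag_faces[OF x'(3)]] \<open>rk P x = rk Q b\<close> by simp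
      then have "z = x'" using flag_rk_inj[OF P x'(3) z(1)] x' by auto
      then show False using z x immersion_distinct[OF i \<Theta>(1) x'(3) adj d] by auto
    qed
    moreover have "adjacent A (\<gamma> ` ?\<Theta>)"
      using immersion_adjacent[OF P i \<Theta>(1) x'(3) adj] \<Theta>(2) by simp
    moreover have "b \<in> A" "b \<notin> B" using b(1) by auto
    ultimately have "\<gamma> ` ?\<Theta> = B"
      using adjacent_flags_unique[OF Q step(1) immersion_flag[OF P Q i x'(3)] step(2) _ step(5)] by blast
    then show ?case using x' by blast
  qed
qed

lemma immersion_surj:
  assumes P: "polytope n P" and Q: "polytope n Q" and i: "immersion \<gamma> P Q"
  shows "\<gamma> ` faces P = faces Q"
proof
  show "\<gamma> ` faces P \<subseteq> faces Q" using immersion_faces[OF P i] by blast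
  show "faces Q \<subseteq> \<gamma> ` faces P"
  proof
    fix F assume "F \<in> faces Q"
    then obtain \<Psi> where \<Psi>: "\<Psi> \<in> flags Q" "F \<in> \<Psi>"
      using leq_in_flag[OF Q, of F F] polytope_refl[OF Q] by blast
    then obtain \<Phi> where "\<Phi> \<in> flags P" "\<gamma> ` \<Phi> = \<Psi>" using immersion_surj_flags[OF P Q i] by blast
    then show "F \<in> \<gamma> ` faces P" using \<Psi> flag_faces by blast
  qed
qed

text \<open>The surjectivity demanded of a covering is automatic, by path lifting.\<close>

lemma covers_iff_immersion:
  assumes P: "polytope n P" and Q: "polytope n Q"
  shows "covers P Q \<longleftrightarrow> (\<exists>\<gamma>. immersion \<gamma> P Q)"
proof
  assume "covers P Q"
  then show "\<exists>\<gamma>. immersion \<gamma> P Q"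
    unfolding covers_def immersion_def by (force simp: adjacent_def)
next
  assume "\<exists>\<gamma>. immersion \<gamma> P Q"
  then obtain \<gamma> where i: "immersion \<gamma> P Q" by blast
  show "covers P Q"
    unfolding covers_def
    using immersion_surj[OF P Q i] immersion_rk[OF i] immersion_leq[OF i]
      immersion_flag[OF P Q i] immersion_adjacent[OF P i] by (intro exI[of _ \<gamma>]) auto
qed

lemma immersion_comp:
  assumes P: "polytope n P" and Q: "polytope n Q"
    and i: "immersion \<gamma> P Q" and j: "immersion \<delta> Q R"
  shows "immersion (\<delta> \<circ> \<gamma>) P R"
  unfolding immersion_def
proof (intro conjI ballI allI impI)
  fix \<Phi> \<Psi> assume fl: "\<Phi> \<in> flags P" "\<Psi> \<in> flags P" "adjacent \<Phi> \<Psi>"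
  from fl have "\<delta> ` \<gamma> ` \<Phi> \<noteq> \<delta> ` \<gamma> ` \<Psi>"
    using j immersion_flag[OF P Q i fl(1)] immersion_flag[OF P Q i fl(2)]
      immersion_adjacent[OF P i fl] by (simp add: immersion_def)
  then show "(\<delta> \<circ> \<gamma>) ` \<Phi> \<noteq> (\<delta> \<circ> \<gamma>) ` \<Psi>" by (simp add: image_comp)
next
  show "rk R ((\<delta> \<circ> \<gamma>) F) = rk P F" if "F \<in> faces P" for F
    using immersion_rk[OF j immersion_faces[OF P i that]] immersion_rk[OF i that] by simp
  show "((\<delta> \<circ> \<gamma>) F, (\<delta> \<circ> \<gamma>) G) \<in> leq R" if "(F, G) \<in> leq P" for F G
    using immersion_leq[OF j immersion_leq[OF i that]] by simp
qed

text \<open>Here \<open>Q\<close> may have larger rank than \<open>P\<close>, so images of flags of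
  \<open>P\<close> are not flags of \<open>Q\<close> and the condition on adjacent flags says
  nothing about them; injectivity of \<open>\<delta>\<close> takes its place.\<close>

lemma immersion_comp_inj:
  assumes P: "polytope n P" and i: "immersion \<gamma> P Q"
    and j: "immersion \<delta> Q R" and inj: "inj_on \<delta> (faces Q)"
  shows "immersion (\<delta> \<circ> \<gamma>) P R"
  unfolding immersion_def
proof (intro conjI ballI allI impI)
  fix \<Phi> \<Psi> assume fl: "\<Phi> \<in> flags P" "\<Psi> \<in> flags P" "adjacent \<Phi> \<Psi>"
  then have "\<gamma> ` \<Phi> \<noteq> \<gamma> ` \<Psi>" using i by (simp add: immersion_def)
  moreover have "\<gamma> ` \<Phi> \<subseteq> faces Q" "\<gamma> ` \<Psi> \<subseteq> faces Q"
    using subsetD[OF flag_faces[OF fl(1)]] subsetD[OF flag_faces[OF fl(2)]]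
    by (auto intro: immersion_faces[OF P i])
  ultimately show "(\<delta> \<circ> \<gamma>) ` \<Phi> \<noteq> (\<delta> \<circ> \<gamma>) ` \<Psi>"
    using inj_on_image_eq_iff[OF inj] unfolding image_comp[symmetric] by simp
next
  show "rk R ((\<delta> \<circ> \<gamma>) F) = rk P F" if "F \<in> faces P" for F
    using immersion_rk[OF j immersion_faces[OF P i that]] immersion_rk[OF i that] by simp
  show "((\<delta> \<circ> \<gamma>) F, (\<delta> \<circ> \<gamma>) G) \<in> leq R" if "(F, G) \<in> leq P" for F G
    using immersion_leq[OF j immersion_leq[OF i that]] by simp
qed

section \<open>Ranks recovered from the order\<close>

lemma flag_card_below:
  assumes R: "polytope k R" and \<Phi>: "\<Phi> \<in> flags R" "F \<in> \<Phi>"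
  shows "int (card {G \<in> \<Phi>. (G, F) \<in> leq R}) = rk R F + 2"
proof -
  have "F \<in> faces R" using subsetD[OF flag_faces[OF \<Phi>(1)] \<Phi>(2)] .
  then have r: "-1 \<le> rk R F" "rk R F \<le> int k" using polytope_rk_range[OF R] by auto
  have "bij_betw (rk R) {G \<in> \<Phi>. (G, F) \<in> leq R} {-1..rk R F}"
    unfolding bij_betw_def
  proof
    show "inj_on (rk R) {G \<in> \<Phi>. (G, F) \<in> leq R}"
      using flag_rk_inj[OF R \<Phi>(1)] by (auto simp: inj_on_def)
    show "rk R ` {G \<in> \<Phi>. (G, F) \<in> leq R} = {-1..rk R F}"
    proof
      have "rk R G \<in> {-1..rk R F}" if "G \<in> \<Phi>" "(G, F) \<in> leq R" for G
        using polytope_rk_le[OF R that(2)] polytope_rk_range[OF R, of G]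
          subsetD[OF flag_faces[OF \<Phi>(1)] that(1)] by simp
      then show "rk R ` {G \<in> \<Phi>. (G, F) \<in> leq R} \<subseteq> {-1..rk R F}" by auto
      show "{-1..rk R F} \<subseteq> rk R ` {G \<in> \<Phi>. (G, F) \<in> leq R}"
      proof
        fix i assume "i \<in> {-1..rk R F}"
        then obtain G where G: "G \<in> \<Phi>" "rk R G = i" "i \<le> rk R F"
          using flag_face_of_rank[OF R \<Phi>(1), of i] r by auto
        then have "(G, F) \<in> leq R" using flag_leq_iff[OF R \<Phi>(1) G(1) \<Phi>(2)] by simp
        then show "i \<in> rk R ` {G \<in> \<Phi>. (G, F) \<in> leq R}" using G by auto
      qed
    qed
  qed
  then have "card {G \<in> \<Phi>. (G, F) \<in> leq R} = card {-1..rk R F}" by (rule bij_betw_same_card)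
  then show ?thesis using r by simp
qed

text \<open>The rank of a face is the number of faces below it in a flag, minus two, hence an order
  invariant. By \<open>down\<close> the image is closed downwards, so a flag of \<open>Q\<close> has
  no additional faces below \<open>c F\<close>.\<close>

lemma order_embedding_rk:
  assumes P: "polytope n P" and Q: "polytope m Q"
    and sub: "c ` faces P \<subseteq> faces Q"
    and le: "\<And>F G. F \<in> faces P \<Longrightarrow> G \<in> faces P \<Longrightarrow> (F, G) \<in> leq P \<longleftrightarrow> (c F, c G) \<in> leq Q"
    and down: "\<And>F H. F \<in> faces P \<Longrightarrow> (H, c F) \<in> leq Q \<Longrightarrow> H \<in> c ` faces P"
    and F: "F \<in> faces P"
  shows "rk Q (c F) = rk P F"
proof -
  obtain \<Phi> where \<Phi>: "\<Phi> \<in> flags P" "F \<in> \<Phi>"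
    using leq_in_flag[OF P, of F F] polytope_refl[OF P F] by blast
  have \<Phi>s: "\<Phi> \<subseteq> faces P" using \<Phi> flag_faces by blast
  have "(c x, c y) \<in> leq Q \<or> (c y, c x) \<in> leq Q" if "x \<in> \<Phi>" "y \<in> \<Phi>" for x y
    using flag_comparable[OF \<Phi>(1) that] le[of x y] le[of y x] subsetD[OF \<Phi>s] that by simp
  then have "c ` \<Phi> \<in> Chains (leq Q)" by (simp add: Chains_def)
  from chain_in_flag[OF this] obtain \<Psi> where \<Psi>: "\<Psi> \<in> flags Q" "c ` \<Phi> \<subseteq> \<Psi>" by auto
  have "{H \<in> \<Psi>. (H, c F) \<in> leq Q} = c ` {G \<in> \<Phi>. (G, F) \<in> leq P}"
  proof
    show "c ` {G \<in> \<Phi>. (G, F) \<in> leq P} \<subseteq> {H \<in> \<Psi>. (H, c F) \<in> leq Q}"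
      using \<Psi>(2) le[OF _ F] \<Phi>s by auto
    show "{H \<in> \<Psi>. (H, c F) \<in> leq Q} \<subseteq> c ` {G \<in> \<Phi>. (G, F) \<in> leq P}"
    proof
      fix H assume H: "H \<in> {H \<in> \<Psi>. (H, c F) \<in> leq Q}"
      then have "H \<in> c ` faces P" using down[OF F] by simp
      then obtain G where G: "G \<in> faces P" "H = c G" by auto
      have "(G, X) \<in> leq P \<or> (X, G) \<in> leq P" if "X \<in> \<Phi>" for X
      proof -
        have "X \<in> faces P" "c X \<in> \<Psi>" using that \<Phi>s \<Psi>(2) by auto
        then show ?thesis
          using H flag_comparable[OF \<Psi>(1), of H "c X"] le[of G X] le[of X G] G by simp
      qed
      then have "G \<in> \<Phi>" by (rule flag_maximal[OF P \<Phi>(1) G(1)])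
      moreover have "(G, F) \<in> leq P" using le[OF G(1) F] G(2) H by simp
      ultimately show "H \<in> c ` {G \<in> \<Phi>. (G, F) \<in> leq P}" using G(2) by simp
    qed
  qed
  moreover have "inj_on c {G \<in> \<Phi>. (G, F) \<in> leq P}"
  proof (rule inj_onI)
    fix x y assume xy: "x \<in> {G \<in> \<Phi>. (G, F) \<in> leq P}" "y \<in> {G \<in> \<Phi>. (G, F) \<in> leq P}" "c x = c y"
    then have "x \<in> faces P" "y \<in> faces P" using \<Phi>s by auto
    then have "(x, y) \<in> leq P" "(y, x) \<in> leq P"
      using le[of x y] le[of y x] le[of x x] polytope_refl[OF P, of x] xy(3) by simp_all
    then show "x = y" by (rule polytope_antisym[OF P])
  qed
  ultimately have "card {H \<in> \<Psi>. (H, c F) \<in> leq Q} = card {G \<in> \<Phi>. (G, F) \<in> leq P}"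
    by (simp only: card_image)
  moreover have "int (card {G \<in> \<Phi>. (G, F) \<in> leq P}) = rk P F + 2"
    by (rule flag_card_below[OF P \<Phi>])
  moreover have "c F \<in> \<Psi>" using \<Psi>(2) \<Phi>(2) by auto
  then have "int (card {H \<in> \<Psi>. (H, c F) \<in> leq Q}) = rk Q (c F) + 2"
    by (rule flag_card_below[OF Q \<Psi>(1)])
  ultimately have "rk Q (c F) + 2 = rk P F + 2" by (simp only:)
  then show ?thesis by (simp only: add_right_cancel)
qed

lemma order_iso_rk:
  assumes "polytope n P" "polytope m Q" "order_iso f P Q" "F \<in> faces P"
  shows "rk Q (f F) = rk P F"
proof -
  have b: "f ` faces P = faces Q" using assms(3) by (simp add: order_iso_def bij_betw_def)
  show ?thesis
  proof (rule order_embedding_rk[OF assms(1,2) _ _ _ assms(4)])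
    show "(F, G) \<in> leq P \<longleftrightarrow> (f F, f G) \<in> leq Q" if "F \<in> faces P" "G \<in> faces P" for F G
      using assms(3) that by (simp add: order_iso_def)
    show "H \<in> f ` faces P" if "(H, f F) \<in> leq Q" for H F
      using leq_faces[OF that] b by simp
  qed (simp add: b)
qed

lemma order_iso_leq: "order_iso f P Q \<Longrightarrow> (F, G) \<in> leq P \<Longrightarrow> (f F, f G) \<in> leq Q"
  using leq_faces[of F G P] by (simp add: order_iso_def)

lemma order_iso_faces: "order_iso f P Q \<Longrightarrow> F \<in> faces P \<Longrightarrow> f F \<in> faces Q"
  by (auto simp: order_iso_def bij_betw_def)

lemma order_iso_inj: "order_iso f P Q \<Longrightarrow> inj_on f (faces P)"
  by (simp add: order_iso_def bij_betw_def)

lemma order_iso_immersion: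
  assumes P: "polytope n P" and Q: "polytope m Q" and f: "order_iso f P Q"
  shows "immersion f P Q"
  unfolding immersion_def
proof (intro conjI ballI allI impI)
  fix \<Phi> \<Psi> assume fl: "\<Phi> \<in> flags P" "\<Psi> \<in> flags P" "adjacent \<Phi> \<Psi>"
  then have "\<Phi> \<noteq> \<Psi>" by (auto simp: adjacent_def)
  then show "f ` \<Phi> \<noteq> f ` \<Psi>"
    using inj_on_image_eq_iff[OF order_iso_inj[OF f] flag_faces[OF fl(1)] flag_faces[OF fl(2)]] by simp
qed (simp_all add: order_iso_rk[OF P Q f] order_iso_leq[OF f])

lemma order_isoI:
  assumes P: "polytope n P" and Q: "polytope m Q"
    and le: "\<And>F G. (F, G) \<in> leq P \<Longrightarrow> (\<gamma> F, \<gamma> G) \<in> leq Q"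
      "\<And>F G. (F, G) \<in> leq Q \<Longrightarrow> (\<delta> F, \<delta> G) \<in> leq P"
    and inv: "\<And>F. F \<in> faces P \<Longrightarrow> \<delta> (\<gamma> F) = F" "\<And>F. F \<in> faces Q \<Longrightarrow> \<gamma> (\<delta> F) = F"
  shows "order_iso \<gamma> P Q"
  unfolding order_iso_def
proof (intro conjI ballI)
  have fP: "\<gamma> F \<in> faces Q" if "F \<in> faces P" for F
    using leq_faces[OF le(1)[OF polytope_refl[OF P that]]] by simp
  have fQ: "\<delta> F \<in> faces P" if "F \<in> faces Q" for F
    using leq_faces[OF le(2)[OF polytope_refl[OF Q that]]] by simp
  show "bij_betw \<gamma> (faces P) (faces Q)"
    by (rule bij_betw_byWitness[of _ \<delta>]) (use inv fP fQ in auto)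
  show "(F, G) \<in> leq P \<longleftrightarrow> (\<gamma> F, \<gamma> G) \<in> leq Q" if "F \<in> faces P" "G \<in> faces P" for F G
    using le(1)[of F G] le(2)[of "\<gamma> F" "\<gamma> G"] inv(1) that by auto
qed

lemma order_iso_inv_into_flag: "order_iso f P Q \<Longrightarrow> \<Phi> \<in> flags P \<Longrightarrow> inv_into (faces P) f ` f ` \<Phi> = \<Phi>"
  by (rule inv_into_image_cancel[OF order_iso_inj flag_faces])

section \<open>Flag-transitivity\<close>

lemma regular_polytopeI:
  assumes P: "polytope n P"
    and trans: "\<And>\<Phi> \<Psi>. \<Phi> \<in> flags P \<Longrightarrow> \<Psi> \<in> flags P \<Longrightarrow> \<exists>f. order_iso f P P \<and> f ` \<Phi> = \<Psi>"
  shows "regular_polytope n P"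
  unfolding regular_polytope_def
proof (intro conjI ballI P)
  fix \<Phi> \<Psi> assume fl: "\<Phi> \<in> flags P" "\<Psi> \<in> flags P"
  obtain f where f: "order_iso f P P" "f ` \<Phi> = \<Psi>" using trans[OF fl] by auto
  \<comment> \<open>Elements of \<open>aut_group\<close> are extensional, hence the
    restriction.\<close>
  let ?f = "restrict f (faces P)"
  have "order_iso ?f P P" using f(1) by (simp add: order_iso_def bij_betw_restrict_eq)
  have "?f \<in> Bij (faces P)"
    using f(1) by (simp add: Bij_def order_iso_def bij_betw_restrict_eq)
  have "?f ` \<Phi> = f ` \<Phi>"
    using subsetD[OF flag_faces[OF fl(1)]] by (intro image_cong) simp_all
  then have "?f ` \<Phi> = \<Psi>" using f(2) by (simp only:)
  moreover have "?f \<in> carrier (aut_group P)"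
    using \<open>order_iso ?f P P\<close> \<open>?f \<in> Bij (faces P)\<close> by (simp add: aut_group_def)
  ultimately show "\<exists>f\<in>carrier (aut_group P). f ` \<Phi> = \<Psi>" by (intro bexI[of _ ?f])
qed

lemma regular_polytope_transitive:
  assumes "regular_polytope n P" "\<Phi> \<in> flags P" "\<Psi> \<in> flags P"
  shows "\<exists>f. order_iso f P P \<and> f ` \<Phi> = \<Psi>"
  using assms by (fastforce simp: regular_polytope_def aut_group_def)

text \<open>Transitivity gives every self-immersion a right inverse that is again an immersion; a
  right inverse having a right inverse itself is two-sided. This turns maps obtained from the
  universal property into automorphisms.\<close>

lemma immersions_order_iso:
  assumes P: "polytope n P" and \<Phi>: "\<Phi> \<in> flags P"
    and trans: "\<And>\<Psi>. \<Psi> \<in> flags P \<Longrightarrow> \<exists>\<gamma>. immersion \<gamma> P P \<and> \<gamma> ` \<Phi> = \<Psi>"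
    and i: "immersion \<gamma> P P"
  shows "order_iso \<gamma> P P"
proof -
  have ri: "\<exists>\<delta>. immersion \<delta> P P \<and> (\<forall>F\<in>faces P. \<gamma> (\<delta> F) = F)" if i: "immersion \<gamma> P P" for \<gamma>
  proof -
    obtain \<Theta> where \<Theta>: "\<Theta> \<in> flags P" "\<gamma> ` \<Theta> = \<Phi>" using immersion_surj_flags[OF P P i \<Phi>] by auto
    obtain \<delta> where \<delta>: "immersion \<delta> P P" "\<delta> ` \<Phi> = \<Theta>" using trans[OF \<Theta>(1)] by auto
    have "(\<gamma> \<circ> \<delta>) ` \<Phi> = \<Phi>" using \<Theta>(2) \<delta>(2) unfolding image_comp[symmetric] by simp
    then have "(\<gamma> \<circ> \<delta>) F = F" if "F \<in> faces P" for F
      using immersion_flag_eqI[OF P immersion_comp[OF P P \<delta>(1) i] \<Phi> _ that] by simp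
    then show ?thesis using \<delta>(1) by auto
  qed
  obtain \<delta> where \<delta>: "immersion \<delta> P P" "\<forall>F\<in>faces P. \<gamma> (\<delta> F) = F" using ri[OF i] by auto
  obtain \<epsilon> where \<epsilon>: "immersion \<epsilon> P P" "\<forall>F\<in>faces P. \<delta> (\<epsilon> F) = F" using ri[OF \<delta>(1)] by auto
  have "\<delta> (\<gamma> F) = F" if F: "F \<in> faces P" for F
  proof -
    have "\<epsilon> F \<in> faces P" using immersion_faces[OF P \<epsilon>(1) F] .
    then have "\<gamma> (\<delta> (\<epsilon> F)) = \<epsilon> F" using \<delta>(2) by simp
    then have "\<gamma> F = \<epsilon> F" using \<epsilon>(2) F by simp
    then show ?thesis using \<epsilon>(2) F by simp
  qed
  then show ?thesis
    using \<delta>(2) immersion_leq[OF i] immersion_leq[OF \<delta>(1)] by (intro order_isoI[OF P P, where \<delta> = \<delta>]) auto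
qed

section \<open>Automorphism groups\<close>

text \<open>The torsion condition is phrased through iterates on faces, without extensional maps or
  \<open>ord\<close>, so that it transports along order isomorphisms between different
  types.\<close>

definition two_power_torsion :: "'a ranked_poset \<Rightarrow> bool" where
  "two_power_torsion P \<longleftrightarrow>
     (\<forall>g n. order_iso g P P \<and> n > 0 \<and> (\<forall>F\<in>faces P. (g ^^ n) F = F) \<longrightarrow>
        (\<exists>k. \<forall>F\<in>faces P. (g ^^ (2 ^ k)) F = F))"

lemma two_power_torsionD:
  assumes "two_power_torsion P" "order_iso g P P" "n > 0" "\<And>F. F \<in> faces P \<Longrightarrow> (g ^^ n) F = F"
  shows "\<exists>k. \<forall>F\<in>faces P. (g ^^ (2 ^ k)) F = F"
  using assms unfolding two_power_torsion_def by blast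

lemma order_iso_cong:
  assumes "\<And>F. F \<in> faces P \<Longrightarrow> f F = g F"
  shows "order_iso f P Q \<longleftrightarrow> order_iso g P Q"
proof -
  have "bij_betw f (faces P) (faces Q) \<longleftrightarrow> bij_betw g (faces P) (faces Q)"
    using assms by (rule bij_betw_cong)
  then show ?thesis using assms by (simp add: order_iso_def)
qed

lemma order_iso_id: "order_iso (\<lambda>x. x) P P"
  by (simp add: order_iso_def bij_betw_def)

lemma order_iso_funpow: "order_iso g P P \<Longrightarrow> order_iso (g ^^ n) P P"
  by (induction n) (auto simp: order_iso_id id_def intro: order_iso_trans)

lemma order_iso_inv_into:
  assumes "order_iso f P Q"
  shows "F \<in> faces P \<Longrightarrow> inv_into (faces P) f (f F) = F"
    and "G \<in> faces Q \<Longrightarrow> f (inv_into (faces P) f G) = G"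
  using assms unfolding order_iso_def by (blast intro: bij_betw_inv_into_left bij_betw_inv_into_right)+

lemma funpow_conj:
  assumes h: "order_iso h P Q" and g: "order_iso g Q Q" and z: "z \<in> faces P"
  shows "((inv_into (faces P) h \<circ> (g \<circ> h)) ^^ n) z = inv_into (faces P) h ((g ^^ n) (h z))"
proof (induction n)
  case 0
  then show ?case using order_iso_inv_into(1)[OF h z] by simp
next
  case (Suc n)
  have "(g ^^ n) (h z) \<in> faces Q"
    using order_iso_faces[OF order_iso_funpow[OF g] order_iso_faces[OF h z]] .
  then show ?case using Suc.IH order_iso_inv_into(2)[OF h] by simp
qed

lemma order_iso_conj:
  "order_iso h P Q \<Longrightarrow> order_iso g Q Q \<Longrightarrow> order_iso (inv_into (faces P) h \<circ> (g \<circ> h)) P P"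
  using order_iso_trans[OF order_iso_trans order_iso_inv] .

lemma two_power_torsion_iso:
  assumes T: "two_power_torsion P" and f: "order_iso f P Q"
  shows "two_power_torsion Q"
  unfolding two_power_torsion_def
proof (intro allI impI, elim conjE)
  fix g and n :: nat
  assume g: "order_iso g Q Q" and n: "n > 0" and fix_n: "\<forall>F\<in>faces Q. (g ^^ n) F = F"
  let ?f = "inv_into (faces P) f"
  let ?g = "?f \<circ> (g \<circ> f)"
  have o: "order_iso ?g P P" using order_iso_conj[OF f g] .
  have "(?g ^^ n) F = F" if F: "F \<in> faces P" for F
    using funpow_conj[OF f g F] fix_n order_iso_faces[OF f F] order_iso_inv_into(1)[OF f F] by simp
  from two_power_torsionD[OF T o n this] obtain k where k: "\<forall>F\<in>faces P. (?g ^^ (2 ^ k)) F = F" by auto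
  have "(g ^^ (2 ^ k)) F = F" if F: "F \<in> faces Q" for F
  proof -
    have F': "?f F \<in> faces P" using order_iso_faces[OF order_iso_inv[OF f] F] .
    have "?f ((g ^^ (2 ^ k)) F) = ?f F"
      using bspec[OF k F'] funpow_conj[OF f g F', of "2 ^ k"] order_iso_inv_into(2)[OF f F] by simp
    moreover have "(g ^^ (2 ^ k)) F \<in> faces Q" using order_iso_faces[OF order_iso_funpow[OF g] F] .
    ultimately show ?thesis using order_iso_inj[OF order_iso_inv[OF f]] F by (simp add: inj_on_eq_iff)
  qed
  then show "\<exists>k. \<forall>F\<in>faces Q. (g ^^ (2 ^ k)) F = F" by auto
qed

section \<open>The automorphism group as a group of extensional maps\<close>

lemma aut_group_carrier:
  "f \<in> carrier (aut_group P) \<longleftrightarrow> f \<in> extensional (faces P) \<and> order_iso f P P"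
  by (auto simp: aut_group_def Bij_def order_iso_def)

lemma aut_group_mult:
  "f \<in> carrier (aut_group P) \<Longrightarrow> g \<in> carrier (aut_group P) \<Longrightarrow>
    f \<otimes>\<^bsub>aut_group P\<^esub> g = compose (faces P) f g"
  by (simp add: aut_group_def BijGroup_def)

lemma aut_group_one: "\<one>\<^bsub>aut_group P\<^esub> = (\<lambda>F\<in>faces P. F)"
  by (simp add: aut_group_def BijGroup_def)

lemma restrict_aut_group: "order_iso f P P \<Longrightarrow> restrict f (faces P) \<in> carrier (aut_group P)"
  unfolding aut_group_carrier using order_iso_cong[of P "restrict f (faces P)" f P] by simp

lemma group_aut_group: "group (aut_group P)"
proof -
  let ?A = "{f \<in> Bij (faces P). order_iso f P P}"
  have "subgroup ?A (BijGroup (faces P))"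
  proof (rule group.subgroupI[OF group_BijGroup])
    show "?A \<subseteq> carrier (BijGroup (faces P))" by (auto simp: BijGroup_def)
    have "order_iso (\<lambda>F\<in>faces P. F) P P"
      using order_iso_cong[of P "\<lambda>F\<in>faces P. F" "\<lambda>F. F" P] order_iso_id by simp
    then show "?A \<noteq> {}" using id_Bij by auto
    fix f assume f: "f \<in> ?A"
    then have fB: "f \<in> Bij (faces P)" by simp
    have "order_iso (\<lambda>F\<in>faces P. inv_into (faces P) f F) P P"
      using order_iso_cong[of P "\<lambda>F\<in>faces P. inv_into (faces P) f F" "inv_into (faces P) f" P]
        order_iso_inv[of f P P] f by simp
    then show "inv\<^bsub>BijGroup (faces P)\<^esub> f \<in> ?A"
      unfolding inv_BijGroup[OF fB] using restrict_inv_into_Bij[OF fB] by simp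
    fix g assume g: "g \<in> ?A"
    have "order_iso (compose (faces P) f g) P P"
      using order_iso_cong[of P "compose (faces P) f g" "f \<circ> g" P] order_iso_trans[of g P P f P] f g
      by (simp add: compose_eq)
    then show "f \<otimes>\<^bsub>BijGroup (faces P)\<^esub> g \<in> ?A"
      using f g compose_Bij[of f "faces P" g] by (simp add: BijGroup_def)
  qed
  from subgroup.subgroup_is_group[OF this group_BijGroup] show ?thesis by (simp add: aut_group_def)
qed

lemma aut_group_eqI:
  assumes "f \<in> carrier (aut_group P)" "g \<in> carrier (aut_group P)" "\<And>F. F \<in> faces P \<Longrightarrow> f F = g F"
  shows "f = g"
  using assms by (intro extensionalityI[of f "faces P" g]) (auto simp: aut_group_carrier)

lemma aut_group_pow:
  assumes g: "g \<in> carrier (aut_group P)" and F: "F \<in> faces P"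
  shows "(g [^]\<^bsub>aut_group P\<^esub> (n::nat)) F = (g ^^ n) F"
proof -
  interpret group "aut_group P" by (rule group_aut_group)
  have o: "order_iso g P P" using g by (simp add: aut_group_carrier)
  show ?thesis
    using F
  proof (induction n arbitrary: F)
    case 0
    then show ?case by (simp add: aut_group_one)
  next
    case (Suc n)
    have "(g [^]\<^bsub>aut_group P\<^esub> Suc n) F = (g [^]\<^bsub>aut_group P\<^esub> n) (g F)"
      using aut_group_mult[OF nat_pow_closed[OF g] g] Suc.prems by (simp add: compose_eq)
    also have "\<dots> = (g ^^ n) (g F)" using Suc.IH order_iso_faces[OF o Suc.prems] by simp
    finally show ?case by (simp add: funpow_Suc_right del: funpow.simps)
  qed
qed

lemma aut_group_pow_eq_one:
  assumes g: "g \<in> carrier (aut_group P)"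
  shows "g [^]\<^bsub>aut_group P\<^esub> (n::nat) = \<one>\<^bsub>aut_group P\<^esub> \<longleftrightarrow> (\<forall>F\<in>faces P. (g ^^ n) F = F)"
proof -
  interpret group "aut_group P" by (rule group_aut_group)
  have "g [^]\<^bsub>aut_group P\<^esub> n = \<one>\<^bsub>aut_group P\<^esub> \<longleftrightarrow>
      (\<forall>F\<in>faces P. (g [^]\<^bsub>aut_group P\<^esub> n) F = \<one>\<^bsub>aut_group P\<^esub> F)"
    using aut_group_eqI[OF nat_pow_closed[OF g] one_closed] by auto
  then show ?thesis using aut_group_pow[OF g] by (simp add: aut_group_one)
qed

section \<open>Torsion, infinitude and finite generation\<close>

lemma two_power_torsion_iff:
  "two_power_torsion P \<longleftrightarrow>
     (\<forall>g\<in>carrier (aut_group P). group.ord (aut_group P) g \<noteq> 0 \<longrightarrow>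
        (\<exists>k::nat. group.ord (aut_group P) g = 2 ^ k))"
proof
  interpret group "aut_group P" by (rule group_aut_group)
  {
    assume T: "two_power_torsion P"
    show "\<forall>g\<in>carrier (aut_group P). ord g \<noteq> 0 \<longrightarrow> (\<exists>k::nat. ord g = 2 ^ k)"
    proof (intro ballI impI)
      fix g assume g: "g \<in> carrier (aut_group P)" and n: "ord g \<noteq> 0"
      have o: "order_iso g P P" using g by (simp add: aut_group_carrier)
      have "\<forall>F\<in>faces P. (g ^^ ord g) F = F"
        using aut_group_pow_eq_one[OF g] pow_ord_eq_1[OF g] by simp
      then obtain k where "\<forall>F\<in>faces P. (g ^^ (2 ^ k)) F = F"
        using two_power_torsionD[OF T o, of "ord g"] n by auto
      then have "ord g dvd 2 ^ k" using aut_group_pow_eq_one[OF g] pow_eq_id[OF g] by simp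
      then show "\<exists>k::nat. ord g = 2 ^ k" using divides_primepow_nat[OF two_is_prime_nat] by auto
    qed
  next
    assume T: "\<forall>g\<in>carrier (aut_group P). ord g \<noteq> 0 \<longrightarrow> (\<exists>k::nat. ord g = 2 ^ k)"
    show "two_power_torsion P"
      unfolding two_power_torsion_def
    proof (intro allI impI, elim conjE)
      fix g and n :: nat
      assume g: "order_iso g P P" and n: "n > 0" and fix_n: "\<forall>F\<in>faces P. (g ^^ n) F = F"
      let ?g = "restrict g (faces P)"
      have c: "?g \<in> carrier (aut_group P)" using restrict_aut_group[OF g] .
      have pow: "(?g ^^ i) F = (g ^^ i) F" if "F \<in> faces P" for i F
        using order_iso_faces[OF order_iso_funpow[OF g] that] by (induction i) (simp_all add: that)
      have "?g [^]\<^bsub>aut_group P\<^esub> n = \<one>\<^bsub>aut_group P\<^esub>"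
        using aut_group_pow_eq_one[OF c] fix_n pow by simp
      then have "ord ?g dvd n" using pow_eq_id[OF c] by simp
      then have "ord ?g \<noteq> 0" using n by auto
      then obtain k :: nat where "ord ?g = 2 ^ k" using bspec[OF T c] by auto
      then have "?g [^]\<^bsub>aut_group P\<^esub> ((2::nat) ^ k) = \<one>\<^bsub>aut_group P\<^esub>"
        using pow_ord_eq_1[OF c] by simp
      then have "\<forall>F\<in>faces P. (g ^^ (2 ^ k)) F = F" using aut_group_pow_eq_one[OF c] pow by simp
      then show "\<exists>k. \<forall>F\<in>faces P. (g ^^ (2 ^ k)) F = F" by auto
    qed
  }
qed

text \<open>Lagrange's theorem settles the finite case; for an infinite 2-group the condition is
  part of the definition.\<close>

lemma two_power_torsion_2_group:
  assumes "finite_2_group (aut_group P) \<or> infinite_2_group (aut_group P)"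
  shows "two_power_torsion P"
  unfolding two_power_torsion_iff
  using assms
proof
  interpret group "aut_group P" by (rule group_aut_group)
  assume "finite_2_group (aut_group P)"
  then obtain k :: nat where k: "order (aut_group P) = 2 ^ k" by (auto simp: finite_2_group_def)
  show "\<forall>g\<in>carrier (aut_group P). ord g \<noteq> 0 \<longrightarrow> (\<exists>k::nat. ord g = 2 ^ k)"
  proof (intro ballI impI)
    fix g assume "g \<in> carrier (aut_group P)"
    then have "ord g dvd 2 ^ k" using ord_dvd_group_order[of g] k by simp
    then show "\<exists>k::nat. ord g = 2 ^ k" using divides_primepow_nat[OF two_is_prime_nat] by auto
  qed
qed (simp add: infinite_2_group_def)

text \<open>A finite group acting transitively on flags leaves only finitely many flags, and these
  are finite sets covering all faces.\<close>

lemma infinite_aut_group: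
  assumes P: "regular_polytope n P" and inf: "infinite (faces P)"
  shows "infinite (carrier (aut_group P))"
proof
  assume fin: "finite (carrier (aut_group P))"
  have pP: "polytope n P" using P by (simp add: regular_polytope_def)
  obtain \<Phi> where \<Phi>: "\<Phi> \<in> flags P" using flags_nonempty[OF pP] by auto
  have "flags P \<subseteq> (\<lambda>f. f ` \<Phi>) ` carrier (aut_group P)"
  proof
    fix \<Psi> assume "\<Psi> \<in> flags P"
    then have "\<exists>f\<in>carrier (aut_group P). f ` \<Phi> = \<Psi>" using P \<Phi> by (simp add: regular_polytope_def)
    then show "\<Psi> \<in> (\<lambda>f. f ` \<Phi>) ` carrier (aut_group P)" by auto
  qed
  then have "finite (flags P)" using fin by (rule finite_surj[rotated])
  then have "finite (\<Union>(flags P))" using flag_finite[OF pP] by (rule finite_Union)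
  moreover have "faces P \<subseteq> \<Union>(flags P)"
  proof
    fix F assume "F \<in> faces P"
    from leq_in_flag[OF pP polytope_refl[OF pP this]] show "F \<in> \<Union>(flags P)" by auto
  qed
  ultimately show False using inf finite_subset[of "faces P"] by simp
qed

text \<open>The action on flags is free, by rigidity.\<close>

lemma aut_group_agree:
  assumes P: "polytope n P" and \<Phi>: "\<Phi> \<in> flags P"
    and fg: "f \<in> carrier (aut_group P)" "g \<in> carrier (aut_group P)" "f ` \<Phi> = g ` \<Phi>"
  shows "f = g"
proof (rule aut_group_eqI[OF fg(1,2)])
  have o: "order_iso f P P" "order_iso g P P" using fg by (auto simp: aut_group_carrier)
  fix F assume "F \<in> faces P"
  then show "f F = g F"
    using immersion_agree_flag[OF P P order_iso_immersion[OF P P o(1)] order_iso_immersion[OF P P o(2)] \<Phi>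
        order_iso_flags[OF o(1) \<Phi>]] fg(3) by simp
qed

text \<open>\<open>S\<close> consists of the distinguished generators \<rho>_i, the automorphisms
  that move the base flag to an adjacent one. Following a flag path from the base flag writes any
  automorphism as a product of them.\<close>

lemma finitely_generated_aut_group:
  assumes P: "regular_polytope n P"
  shows "\<exists>S. finite S \<and> S \<subseteq> carrier (aut_group P) \<and> generate (aut_group P) S = carrier (aut_group P)"
proof -
  interpret group "aut_group P" by (rule group_aut_group)
  have pP: "polytope n P" using P by (simp add: regular_polytope_def)
  have trans: "\<exists>f\<in>carrier (aut_group P). f ` A = B" if "A \<in> flags P" "B \<in> flags P" for A B
    using P that by (simp add: regular_polytope_def)
  have o: "order_iso f P P" if "f \<in> carrier (aut_group P)" for f using that by (simp add: aut_group_carrier)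
  obtain \<Phi> where \<Phi>: "\<Phi> \<in> flags P" using flags_nonempty[OF pP] by auto
  define S where "S = {s \<in> carrier (aut_group P). adjacent \<Phi> (s ` \<Phi>)}"
  have sub: "S \<subseteq> carrier (aut_group P)" by (auto simp: S_def)
  \<comment> \<open>The common part names the exchanged face, hence the adjacent flag, hence the
    automorphism; so \<open>S\<close> embeds into the power set of a finite flag.\<close>
  have "inj_on (\<lambda>s. \<Phi> \<inter> s ` \<Phi>) S"
  proof (rule inj_onI)
    fix s t assume st: "s \<in> S" "t \<in> S" "\<Phi> \<inter> s ` \<Phi> = \<Phi> \<inter> t ` \<Phi>"
    then have *: "s \<in> carrier (aut_group P)" "t \<in> carrier (aut_group P)"
      "adjacent \<Phi> (s ` \<Phi>)" "adjacent \<Phi> (t ` \<Phi>)" by (auto simp: S_def)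
    obtain b where b: "\<Phi> - s ` \<Phi> = {b}" using *(3) unfolding adjacent_def by (meson card_1_singletonE)
    then have "\<Phi> - t ` \<Phi> = {b}" using st(3) by blast
    then have "b \<in> \<Phi>" "b \<notin> s ` \<Phi>" "b \<notin> t ` \<Phi>" using b by auto
    from adjacent_flags_unique[OF pP \<Phi> order_iso_flags[OF o[OF *(1)] \<Phi>] order_iso_flags[OF o[OF *(2)] \<Phi>]
        *(3,4) this]
    show "s = t" by (rule aut_group_agree[OF pP \<Phi> *(1,2)])
  qed
  moreover have "(\<lambda>s. \<Phi> \<inter> s ` \<Phi>) ` S \<subseteq> Pow \<Phi>" by auto
  ultimately have fin: "finite S"
    using flag_finite[OF pP \<Phi>] by (metis finite_Pow_iff finite_imageD finite_subset)
  have gen: "\<exists>h\<in>generate (aut_group P) S. h ` \<Phi> = \<Psi>" if \<Psi>: "\<Psi> \<in> flags P" for \<Psi>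
    using pP \<Phi> \<Psi>
  proof (induction rule: flag_connected_induct)
    case base
    have "\<one>\<^bsub>aut_group P\<^esub> ` \<Phi> = (\<lambda>x. x) ` \<Phi>"
      using subsetD[OF flag_faces[OF \<Phi>]] by (intro image_cong) (simp_all add: aut_group_one)
    then show ?case using generate.one[of "aut_group P" S] by (intro bexI[of _ "\<one>\<^bsub>aut_group P\<^esub>"]) simp_all
  next
    case (step A B)
    then obtain h where h: "h \<in> generate (aut_group P) S" "h ` \<Phi> = A" by auto
    have hc: "h \<in> carrier (aut_group P)" using generate_in_carrier[OF sub h(1)] .
    let ?h = "inv_into (faces P) h"
    have oh: "order_iso ?h P P" using order_iso_inv[OF o[OF hc]] .
    have hA: "?h ` A = \<Phi>" using order_iso_inv_into_flag[OF o[OF hc] \<Phi>] h(2) by simp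
    \<comment> \<open>Pulled back by \<open>h\<close>, the step from \<open>A\<close> to
      \<open>B\<close> starts at \<Phi>, so a generator \<open>s\<close> realises it; the path is
      extended by multiplying \<open>h\<close> by \<open>s\<close> on the right.\<close>
    have "adjacent (?h ` A) (?h ` B)"
      using adjacent_image[OF order_iso_inj[OF oh] flag_faces[OF step(1)] flag_faces[OF step(2)] step(5)] .
    moreover obtain s where s: "s \<in> carrier (aut_group P)" "s ` \<Phi> = ?h ` B"
      using trans[OF \<Phi> order_iso_flags[OF oh step(2)]] by auto
    ultimately have "s \<in> S" using hA by (simp add: S_def)
    then have "h \<otimes>\<^bsub>aut_group P\<^esub> s \<in> generate (aut_group P) S"
      using generate.eng[OF h(1) generate.incl] by simp
    moreover have "(h \<otimes>\<^bsub>aut_group P\<^esub> s) ` \<Phi> = h ` s ` \<Phi>"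
      unfolding image_image aut_group_mult[OF hc s(1)]
      using subsetD[OF flag_faces[OF \<Phi>]] by (intro image_cong) (simp_all add: compose_eq)
    moreover have "h ` ?h ` B = B"
      using flag_faces[OF step(2)] o[OF hc] by (intro image_inv_into_cancel) (simp_all add: order_iso_def bij_betw_def)
    ultimately show ?case using s(2) by (intro bexI[of _ "h \<otimes>\<^bsub>aut_group P\<^esub> s"]) simp_all
  qed
  have "g \<in> generate (aut_group P) S" if g: "g \<in> carrier (aut_group P)" for g
  proof -
    obtain h where h: "h \<in> generate (aut_group P) S" "h ` \<Phi> = g ` \<Phi>"
      using gen[OF order_iso_flags[OF o[OF g] \<Phi>]] by auto
    have "h = g" using aut_group_agree[OF pP \<Phi> generate_in_carrier[OF sub h(1)] g h(2)] .
    then show ?thesis using h(1) by simp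
  qed
  then have "generate (aut_group P) S = carrier (aut_group P)"
    using generate_in_carrier[OF sub] by auto
  then show ?thesis using fin sub by auto
qed

text \<open>Regularity of \<open>P\<close> supplies an automorphism \<open>\<rho>\<close> that
  corrects \<open>\<delta>\<close> so that the round trip fixes a flag; rigidity then makes both
  composites the identity on faces.\<close>

lemma order_iso_of_immersions:
  assumes P: "regular_polytope n P" and Q: "polytope n Q"
    and i: "immersion \<gamma> P Q" and j: "immersion \<delta> Q P"
  shows "\<exists>f. order_iso f P Q"
proof -
  have pP: "polytope n P" using P by (simp add: regular_polytope_def)
  obtain \<Phi> where \<Phi>: "\<Phi> \<in> flags P" using flags_nonempty[OF pP] by auto
  have g\<Phi>: "\<gamma> ` \<Phi> \<in> flags Q" using immersion_flag[OF pP Q i \<Phi>] .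
  have "\<delta> ` \<gamma> ` \<Phi> \<in> flags P" using immersion_flag[OF Q pP j g\<Phi>] .
  from regular_polytope_transitive[OF P this \<Phi>]
  obtain \<rho> where \<rho>: "order_iso \<rho> P P" "\<rho> ` \<delta> ` \<gamma> ` \<Phi> = \<Phi>"
    by auto
  let ?\<delta> = "\<rho> \<circ> \<delta>"
  have j': "immersion ?\<delta> Q P"
    by (rule immersion_comp[OF Q pP j order_iso_immersion[OF pP pP \<rho>(1)]])
  have fl: "(?\<delta> \<circ> \<gamma>) ` \<Phi> = \<Phi>" using \<rho>(2) by (simp only: image_comp comp_assoc)
  have inv1: "(?\<delta> \<circ> \<gamma>) F = F" if "F \<in> faces P" for F
    by (rule immersion_flag_eqI[OF pP immersion_comp[OF pP Q i j'] \<Phi> fl that])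
  have fl': "(\<gamma> \<circ> ?\<delta>) ` (\<gamma> ` \<Phi>) = \<gamma> ` \<Phi>"
    using arg_cong[OF \<rho>(2), of "image \<gamma>"] by (simp only: image_comp comp_assoc)
  have inv2: "(\<gamma> \<circ> ?\<delta>) F = F" if "F \<in> faces Q" for F
    by (rule immersion_flag_eqI[OF Q immersion_comp[OF Q pP j' i] g\<Phi> fl' that])
  have "order_iso \<gamma> P Q"
  proof (rule order_isoI[OF pP Q, where \<delta> = ?\<delta>])
    show "?\<delta> (\<gamma> F) = F" if "F \<in> faces P" for F using inv1[OF that] by simp
    show "\<gamma> (?\<delta> F) = F" if "F \<in> faces Q" for F using inv2[OF that] by simp
  qed (rule immersion_leq[OF i] immersion_leq[OF j'], assumption)+
  then show ?thesis by auto
qed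

section \<open>Reduced words and the free extension\<close>

text \<open>
  The head of a list is the last letter of the word, so \<open>rmul x\<close> multiplies by the involution \<open>x\<close> on
  the right, and \<open>foldr rmul w u\<close> is the reduced form of the product of \<open>u\<close> and \<open>w\<close>.
\<close>

definition rmul :: "'a \<Rightarrow> 'a list \<Rightarrow> 'a list" where
  "rmul x w = (case w of [] \<Rightarrow> [x] | y # v \<Rightarrow> if x = y then v else x # w)"

lemma rmul_neq: "rmul x w \<noteq> w"
  by (cases w) (auto simp: rmul_def)

lemma rmul_cases: "rmul x w = x # w \<or> w = x # rmul x w"
  by (cases w) (auto simp: rmul_def)

lemma distinct_adj_rmul: "distinct_adj w \<Longrightarrow> distinct_adj (rmul x w)"
  by (cases w rule: remdups_adj.cases) (auto simp: rmul_def)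

lemma set_rmul: "set (rmul x w) \<subseteq> insert x (set w)"
  by (cases w) (auto simp: rmul_def)

lemma foldr_rmul_append: "distinct_adj (w @ u) \<Longrightarrow> foldr rmul w u = w @ u"
proof (induction w)
  case (Cons x w)
  then have "foldr rmul w u = w @ u" by (auto simp: distinct_adj_Cons)
  moreover have "rmul x (w @ u) = x # w @ u"
    using Cons.prems by (cases "w @ u") (auto simp: rmul_def)
  ultimately show ?case by simp
qed simp

locale reflection_words =
  fixes d :: nat and K :: "'a ranked_poset" and M :: 'a
  assumes K: "polytope d K" and d: "d \<ge> 1"
    and M: "M \<in> faces K" "\<forall>G\<in>faces K. (G, M) \<in> leq K"
begin

definition facets :: "'a set" where
  "facets = {x \<in> faces K. rk K x = int d - 1}"

definition words :: "'a list set" where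
  "words = {w. set w \<subseteq> facets \<and> distinct_adj w}"

text \<open>The letters \<open>x\<close> with \<open>F\<close> below \<open>x\<close> generate
  \<open>W_F\<close>. As the head of the list is the last letter of the word, dropping a maximal
  prefix of such letters leads to the shortest element of the coset.\<close>

definition strip :: "'a \<Rightarrow> 'a list \<Rightarrow> 'a list" where
  "strip F w = dropWhile (\<lambda>x. (F, x) \<in> leq K) w"

text \<open>The coset of \<open>w\<close> in the face \<open>F\<close>, represented by its shortest element.\<close>

definition cell :: "'a \<Rightarrow> 'a list \<Rightarrow> ('a \<times> 'a list) option" where
  "cell F w = Some (F, strip F w)"

text \<open>Two faces are incident when some single copy \<open>w\<close> contains both, which makes
  transitivity something to prove. \<open>None\<close> is the added greatest face.\<close>

definition ext :: "('a \<times> 'a list) option ranked_poset" where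
  "ext = \<lparr>leq = {(cell F w, cell G w) | F G w. (F, G) \<in> leq K \<and> w \<in> words} \<union>
                {(cell F w, None) | F w. F \<in> faces K \<and> w \<in> words} \<union> {(None, None)},
          rk = case_option (int d + 1) (\<lambda>(F, w). rk K F)\<rparr>"

definition lift :: "'a set \<Rightarrow> 'a list \<Rightarrow> ('a \<times> 'a list) option set" where
  "lift \<Phi> w = insert None ((\<lambda>F. cell F w) ` \<Phi>)"

section \<open>Facets, words and shortest coset representatives\<close>

lemma rk_M: "rk K M = int d"
proof -
  obtain N where "N \<in> faces K" "rk K N = int d" "\<forall>G\<in>faces K. (G, N) \<in> leq K"
    using polytope_greatest[OF K] by blast
  then have "N = M" using polytope_antisym[OF K, of N M] M by simp
  then show ?thesis using \<open>rk K N = int d\<close> by simp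
qed

lemma M_flag: "\<Phi> \<in> flags K \<Longrightarrow> M \<in> \<Phi>"
  using greatest_in_flag[OF K _ M] .

lemma leq_M: "F \<in> faces K \<Longrightarrow> (F, M) \<in> leq K"
  using M by simp

lemma rk_eq_M: "F \<in> faces K \<Longrightarrow> rk K F = int d \<Longrightarrow> F = M"
  using comparable_rk_inj[OF K, of F M] leq_M rk_M by simp

lemma facet_leq: "x \<in> facets \<Longrightarrow> y \<in> facets \<Longrightarrow> (x, y) \<in> leq K \<longleftrightarrow> x = y"
  using comparable_rk_inj[OF K, of x y] polytope_refl[OF K, of x] by (auto simp: facets_def)

lemma M_not_leq_facet: "x \<in> facets \<Longrightarrow> (M, x) \<notin> leq K"
  using polytope_rk_le[OF K, of M x] rk_M by (auto simp: facets_def)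

lemma words_Cons: "x # w \<in> words \<Longrightarrow> x \<in> facets \<and> w \<in> words"
  by (auto simp: words_def distinct_adj_Cons)

lemma Nil_words: "[] \<in> words"
  by (simp add: words_def)

lemma rmul_words: "x \<in> facets \<Longrightarrow> w \<in> words \<Longrightarrow> rmul x w \<in> words"
  using set_rmul[of x w] distinct_adj_rmul[of w x] by (auto simp: words_def)

lemma strip_Nil [simp]: "strip F [] = []"
  by (simp add: strip_def)

lemma strip_Cons: "strip F (x # w) = (if (F, x) \<in> leq K then strip F w else x # w)"
  by (simp add: strip_def)

lemma strip_strip: "(F, G) \<in> leq K \<Longrightarrow> strip F (strip G w) = strip F w"
  by (induction w) (auto simp: strip_Cons intro: polytope_trans[OF K])

text \<open>Copies that share the face \<open>G\<close> share everything below it.\<close>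

lemma strip_strip_eq: "(F, G) \<in> leq K \<Longrightarrow> strip G w = strip G v \<Longrightarrow> strip F w = strip F v"
  using strip_strip by metis

lemma strip_words: "w \<in> words \<Longrightarrow> strip F w \<in> words"
  by (induction w) (auto simp: strip_Cons dest: words_Cons)

lemma strip_M: "w \<in> words \<Longrightarrow> strip M w = w"
  by (cases w) (auto simp: strip_Cons M_not_leq_facet dest: words_Cons)

lemma strip_least:
  assumes "\<forall>G\<in>faces K. (E, G) \<in> leq K" "w \<in> words"
  shows "strip E w = []"
  using assms(2)
proof (induction w)
  case (Cons x w)
  have "x \<in> facets" "w \<in> words" using words_Cons[OF Cons.prems] by auto
  then show ?case using Cons.IH assms(1) by (simp add: strip_Cons facets_def)
qed simp

lemma strip_rmul: "(F, x) \<in> leq K \<Longrightarrow> strip F (rmul x w) = strip F w"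
  using rmul_cases[of x w] strip_Cons by metis

text \<open>Different facets are incomparable and neighbouring letters are different, so at most one
  letter is dropped.\<close>

lemma strip_facet:
  assumes "x \<in> facets" "w \<in> words"
  shows "strip x w = w \<or> w = x # strip x w"
proof (cases w)
  case (Cons y v)
  have y: "y \<in> facets" "v \<in> words" using words_Cons assms(2) Cons by auto
  show ?thesis
  proof (cases "y = x")
    case True
    have "strip x v = v"
    proof (cases v)
      case (Cons z u)
      have "z \<in> facets" using words_Cons y(2) Cons by auto
      moreover have "x \<noteq> z" using assms(2) \<open>w = y # v\<close> Cons True by (simp add: words_def)
      ultimately show ?thesis using facet_leq assms(1) Cons by (simp add: strip_Cons)
    qed simp
    then show ?thesis using Cons True facet_leq[OF assms(1,1)] by (simp add: strip_Cons)
  next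
    case False
    then show ?thesis using Cons facet_leq[OF assms(1) y(1)] by (simp add: strip_Cons)
  qed
qed simp

text \<open>The subgroup of a facet \<open>x\<close> has order 2, so exactly two copies contain a
  given facet.\<close>

lemma strip_facet_eq:
  assumes "x \<in> facets" "w \<in> words" "v \<in> words" "strip x w = strip x v"
  shows "v = w \<or> v = rmul x w"
proof -
  have r: "rmul x (x # u) = u" for u by (simp add: rmul_def)
  have r': "rmul x u = x # u" if "x # u \<in> words" for u
    using that by (cases u) (auto simp: rmul_def words_def)
  consider "strip x w = w" "strip x v = v" | "w = x # strip x w" "strip x v = v"
    | "strip x w = w" "v = x # strip x v" | "w = x # strip x w" "v = x # strip x v"
    using strip_facet[OF assms(1,2)] strip_facet[OF assms(1,3)] by blast
  then show ?thesis
  proof cases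
    case 2
    then have "w = x # v" using assms(4) by metis
    then show ?thesis using r[of v] by simp
  next
    case 3
    then have "v = x # w" using assms(4) by metis
    then show ?thesis using r'[of w] assms(3) by simp
  qed (use assms(4) in metis)+
qed

section \<open>Faces and order of the model\<close>

lemma cell_eq_iff: "cell F w = cell G v \<longleftrightarrow> F = G \<and> strip F w = strip F v"
  by (auto simp: cell_def)

lemma cell_not_None [simp]: "cell F w \<noteq> None" "None \<noteq> cell F w"
  by (simp_all add: cell_def)

lemma cell_M_eq_iff: "w \<in> words \<Longrightarrow> v \<in> words \<Longrightarrow> cell M w = cell M v \<longleftrightarrow> w = v"
  by (simp add: cell_eq_iff strip_M)

lemma cell_strip: "(F, G) \<in> leq K \<Longrightarrow> cell F (strip G w) = cell F w"
  by (simp add: cell_eq_iff strip_strip)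

lemma cell_rmul: "(F, x) \<in> leq K \<Longrightarrow> cell F (rmul x w) = cell F w"
  by (simp add: cell_eq_iff strip_rmul)

lemma rk_ext [simp]: "rk ext (cell F w) = rk K F" "rk ext None = int d + 1"
  by (simp_all add: ext_def cell_def)

lemma leq_cellI: "(F, G) \<in> leq K \<Longrightarrow> w \<in> words \<Longrightarrow> (cell F w, cell G w) \<in> leq ext"
  unfolding ext_def by auto

text \<open>If the upper face is common to the copies \<open>v\<close> and \<open>u\<close>, so is
  every face below it; hence the witnessing copy in the definition of \<open>ext\<close> can be
  replaced by \<open>v\<close>.\<close>

lemma leq_cell_iff:
  assumes "w \<in> words" "v \<in> words"
  shows "(cell F w, cell G v) \<in> leq ext \<longleftrightarrow> (F, G) \<in> leq K \<and> strip F w = strip F v"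
proof
  assume "(cell F w, cell G v) \<in> leq ext"
  then obtain F' G' u where "cell F w = cell F' u" "cell G v = cell G' u" "(F', G') \<in> leq K"
    by (auto simp: ext_def)
  then have *: "strip F w = strip F u" "strip G v = strip G u" "(F, G) \<in> leq K"
    by (auto simp: cell_eq_iff)
  then have "strip F v = strip F u" using strip_strip_eq[of F G v u] by simp
  then show "(F, G) \<in> leq K \<and> strip F w = strip F v" using * by simp
next
  assume *: "(F, G) \<in> leq K \<and> strip F w = strip F v"
  then have "cell F w = cell F v" by (simp add: cell_eq_iff)
  then show "(cell F w, cell G v) \<in> leq ext" using leq_cellI[OF _ assms(2), of F G] * by simp
qed

lemma faces_ext: "faces ext = {cell F w | F w. F \<in> faces K \<and> w \<in> words} \<union> {None}"
proof
  have "Field (leq ext) \<subseteq> {cell F w | F w. F \<in> faces K \<and> w \<in> words} \<union> {None}"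
    by (auto simp: Field_def ext_def dest: leq_faces)
  then show "faces ext \<subseteq> {cell F w | F w. F \<in> faces K \<and> w \<in> words} \<union> {None}"
    by (simp only: faces_def[of ext])
  have "(cell F w, cell F w) \<in> leq ext" if "F \<in> faces K" "w \<in> words" for F w
    using leq_cellI polytope_refl[OF K] that by blast
  moreover have "(None, None) \<in> leq ext" by (simp add: ext_def)
  ultimately show "{cell F w | F w. F \<in> faces K \<and> w \<in> words} \<union> {None} \<subseteq> faces ext"
    by (auto dest: leq_faces)
qed

lemma cell_faces: "F \<in> faces K \<Longrightarrow> w \<in> words \<Longrightarrow> cell F w \<in> faces ext"
  by (auto simp: faces_ext)

lemma faces_extE:
  assumes "z \<in> faces ext"
  obtains "z = None" | F w where "F \<in> faces K" "w \<in> words" "z = cell F w"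
  using assms by (auto simp: faces_ext)

lemma leq_None: "z \<in> faces ext \<Longrightarrow> (z, None) \<in> leq ext"
  by (erule faces_extE) (auto simp: ext_def)

lemma None_leq: "(None, z) \<in> leq ext \<Longrightarrow> z = None"
  by (auto simp: ext_def cell_def)

lemma leq_extE:
  assumes "(y, z) \<in> leq ext"
  obtains "z = None" "y \<in> faces ext"
  | F G w where "(F, G) \<in> leq K" "w \<in> words" "y = cell F w" "z = cell G w"
  using assms leq_faces[OF assms] by (auto simp: ext_def)

lemma ext_partial_order: "Partial_order (leq ext)"
  unfolding partial_order_on_def preorder_on_def faces_def[symmetric]
proof (intro conjI)
  show "leq ext \<subseteq> faces ext \<times> faces ext" by (auto dest: leq_faces)
  show "refl_on (faces ext) (leq ext)"
  proof (rule refl_onI)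
    fix z assume "z \<in> faces ext"
    then show "(z, z) \<in> leq ext"
    proof (cases rule: faces_extE)
      case 1
      then show ?thesis by (simp add: ext_def)
    next
      case (2 F w)
      then show ?thesis using leq_cellI polytope_refl[OF K] by simp
    qed
  qed
  show "trans (leq ext)"
  proof (rule transI)
    fix x y z assume xy: "(x, y) \<in> leq ext" and yz: "(y, z) \<in> leq ext"
    from yz show "(x, z) \<in> leq ext"
    proof (cases rule: leq_extE)
      case 1
      then show ?thesis using leq_None leq_faces[OF xy] by simp
    next
      case (2 F G w)
      from xy show ?thesis
      proof (cases rule: leq_extE)
        case 1
        then show ?thesis using 2 by simp
      next
        case (2 F' G' v)
        have eq: "G' = F" "strip F v = strip F w" using 2 \<open>y = cell F w\<close> by (auto simp: cell_eq_iff)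
        then have "strip F' v = strip F' w" using 2 strip_strip_eq[of F' F v w] by simp
        moreover have "(F', G) \<in> leq K"
          using 2 eq \<open>(F, G) \<in> leq K\<close> polytope_trans[OF K, of F' F G] by simp
        ultimately show ?thesis using leq_cell_iff 2 \<open>w \<in> words\<close> \<open>z = cell G w\<close> by simp
      qed
    qed
  qed
  show "antisym (leq ext)"
  proof (rule antisymI)
    fix x y assume xy: "(x, y) \<in> leq ext" and yx: "(y, x) \<in> leq ext"
    from xy show "x = y"
    proof (cases rule: leq_extE)
      case 1
      then show ?thesis using None_leq yx by simp
    next
      case (2 F G w)
      then have "(G, F) \<in> leq K" using yx leq_cell_iff by simp
      then show ?thesis using 2 polytope_antisym[OF K, of F G] by simp
    qed
  qed
qed

section \<open>Flags of the model and their adjacency\<close>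

lemma lift_flag:
  assumes \<Phi>: "\<Phi> \<in> flags K" and w: "w \<in> words"
  shows "lift \<Phi> w \<in> flags ext"
proof -
  have \<Phi>K: "\<Phi> \<subseteq> faces K" using flag_faces[OF \<Phi>] .
  have "(cell F w, cell G w) \<in> leq ext \<or> (cell G w, cell F w) \<in> leq ext" if "F \<in> \<Phi>" "G \<in> \<Phi>" for F G
    using flag_comparable[OF \<Phi> that] leq_cellI[OF _ w] by blast
  moreover have "(cell F w, None) \<in> leq ext" if "F \<in> \<Phi>" for F
    using leq_None[OF cell_faces[OF subsetD[OF \<Phi>K that] w]] .
  moreover have "(None, None) \<in> leq ext" by (simp add: ext_def)
  ultimately have "lift \<Phi> w \<in> Chains (leq ext)" by (auto simp: Chains_def lift_def)
  moreover have "z \<in> lift \<Phi> w" if C: "C \<in> Chains (leq ext)" "lift \<Phi> w \<subseteq> C" "z \<in> C" for C z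
  proof -
    have cmp: "(z, y) \<in> leq ext \<or> (y, z) \<in> leq ext" if "y \<in> lift \<Phi> w" for y
      using C that by (auto simp: Chains_def)
    have "z \<in> faces ext" using Chains_faces[OF C(1)] C(3) by blast
    then show ?thesis
    proof (cases rule: faces_extE)
      case 1
      then show ?thesis by (simp add: lift_def)
    next
      case (2 G v)
      have c: "((G, F) \<in> leq K \<or> (F, G) \<in> leq K) \<and> (strip G v = strip G w \<or> strip F w = strip F v)"
        if "F \<in> \<Phi>" for F
      proof -
        have "cell F w \<in> lift \<Phi> w" using that by (simp add: lift_def)
        then show ?thesis using cmp[of "cell F w"] 2 w by (auto simp: leq_cell_iff)
      qed
      \<comment> \<open>Comparison with the top face \<open>M\<close> of the copy \<open>w\<close>:
        the second alternative gives \<open>w = v\<close>, so \<open>z\<close> lies in the copy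
        \<open>w\<close> in both cases.\<close>
      have "strip G v = strip G w"
        using c[OF M_flag[OF \<Phi>]] strip_M[OF w] strip_M[OF 2(2)] by auto
      moreover have "G \<in> \<Phi>"
        by (rule flag_maximal[OF K \<Phi> 2(1)]) (simp add: c)
      ultimately show ?thesis using 2 by (auto simp: lift_def cell_eq_iff)
    qed
  qed
  ultimately show ?thesis by (auto simp: flags_def)
qed

text \<open>Every member other than \<open>None\<close> lies in any copy that contains the highest
  such member. In that copy the members form a chain of \<open>K\<close>, and maximality identifies
  \<Sigma> with the lift of a flag through this chain.\<close>

lemma flag_ext_lift:
  assumes \<Sigma>: "\<Sigma> \<in> flags ext"
  obtains \<Phi> w where "\<Phi> \<in> flags K" "w \<in> words" "\<Sigma> = lift \<Phi> w"
proof -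
  have chain: "\<Sigma> \<in> Chains (leq ext)" and fc: "\<Sigma> \<subseteq> faces ext"
    and max: "\<And>C. C \<in> Chains (leq ext) \<Longrightarrow> \<Sigma> \<subseteq> C \<Longrightarrow> C = \<Sigma>"
    using \<Sigma> flag_faces[OF \<Sigma>] by (auto simp: flags_def)
  have cmp: "(y, z) \<in> leq ext \<or> (z, y) \<in> leq ext" if "y \<in> \<Sigma>" "z \<in> \<Sigma>" for y z
    using flag_comparable[OF \<Sigma> that] .
  have "\<exists>w\<in>words. \<forall>z\<in>\<Sigma>. z = None \<or> (\<exists>F\<in>faces K. z = cell F w)"
  proof (cases "\<Sigma> \<subseteq> {None}")
    case True
    then show ?thesis using Nil_words by blast
  next
    case False
    let ?S = "\<Sigma> - {None}"
    have "rk ext z \<in> {-1..int d}" if z: "z \<in> ?S" for z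
    proof -
      have "z \<in> faces ext" using z fc by blast
      then show ?thesis
        using z polytope_rk_range[OF K] by (auto elim!: faces_extE)
    qed
    then have "rk ext ` ?S \<subseteq> {-1..int d}" by blast
    then have fin: "finite (rk ext ` ?S)" by (rule finite_subset) simp
    have "rk ext ` ?S \<noteq> {}" using False by blast
    then have "Max (rk ext ` ?S) \<in> rk ext ` ?S" using fin by simp
    then obtain z1 where z1: "z1 \<in> ?S" "Max (rk ext ` ?S) = rk ext z1" by (rule imageE)
    have max1: "rk ext z \<le> rk ext z1" if "z \<in> ?S" for z
      using Max_ge[OF fin imageI[OF that]] z1(2) by simp
    have "z1 \<in> faces ext" using z1 fc by blast
    then obtain F1 w1 where F1: "F1 \<in> faces K" "w1 \<in> words" "z1 = cell F1 w1"
      using z1 by (auto elim: faces_extE)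
    have "z = None \<or> (\<exists>F\<in>faces K. z = cell F w1)" if z: "z \<in> \<Sigma>" for z
    proof (cases "z = None")
      case False
      have "z \<in> faces ext" using z fc by blast
      then obtain F v where F: "F \<in> faces K" "v \<in> words" "z = cell F v"
        using False by (auto elim: faces_extE)
      have le: "rk K F \<le> rk K F1" using max1[of z] False z F F1 by simp
      have "(cell F v, cell F1 w1) \<in> leq ext \<or> (cell F1 w1, cell F v) \<in> leq ext"
        using cmp[OF z] z1 F F1 by blast
      then have "strip F v = strip F w1"
      proof
        assume "(cell F1 w1, cell F v) \<in> leq ext"
        then have *: "(F1, F) \<in> leq K" "strip F1 w1 = strip F1 v"
          using leq_cell_iff F F1 by auto
        then have "F1 = F" using polytope_rk_less[OF K *(1)] le by auto
        then show ?thesis using * by simp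
      qed (use leq_cell_iff F F1 in auto)
      then show ?thesis using F by (auto simp: cell_eq_iff)
    qed simp
    then show ?thesis using F1 by blast
  qed
  then obtain w where w: "w \<in> words" "\<And>z. z \<in> \<Sigma> \<Longrightarrow> z = None \<or> (\<exists>F\<in>faces K. z = cell F w)" by blast
  let ?C = "{F \<in> faces K. cell F w \<in> \<Sigma>}"
  have "?C \<in> Chains (leq K)"
    using cmp leq_cell_iff[OF w(1) w(1)] by (auto simp: Chains_def)
  from chain_in_flag[OF this] obtain \<Phi> where \<Phi>: "\<Phi> \<in> flags K" "?C \<subseteq> \<Phi>" by auto
  have "z \<in> lift \<Phi> w" if "z \<in> \<Sigma>" for z
    using w(2)[OF that] that \<Phi>(2) by (auto simp: lift_def)
  moreover have "lift \<Phi> w \<in> Chains (leq ext)"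
    using lift_flag[OF \<Phi>(1) w(1)] by (simp add: flags_def)
  ultimately have "lift \<Phi> w = \<Sigma>" by (intro max subsetI)
  from that[OF \<Phi>(1) w(1) this[symmetric]] show ?thesis .
qed

lemma facet_in_flag:
  assumes \<Phi>: "\<Phi> \<in> flags K"
  shows "\<exists>x\<in>\<Phi>. x \<in> facets \<and> (\<forall>F\<in>\<Phi>. F \<noteq> M \<longrightarrow> (F, x) \<in> leq K)"
proof -
  obtain x where x: "x \<in> \<Phi>" "rk K x = int d - 1"
    using flag_face_of_rank[OF K \<Phi>, of "int d - 1"] by auto
  have "(F, x) \<in> leq K" if F: "F \<in> \<Phi>" "F \<noteq> M" for F
  proof -
    have fF: "F \<in> faces K" using subsetD[OF flag_faces[OF \<Phi>] F(1)] .
    then have "rk K F \<noteq> int d" using rk_eq_M F(2) by blast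
    then have "rk K F \<le> rk K x" using polytope_rk_range[OF K fF] x(2) by simp
    then show ?thesis using flag_leq_iff[OF K \<Phi> F(1) x(1)] by simp
  qed
  moreover have "x \<in> facets" using x subsetD[OF flag_faces[OF \<Phi>] x(1)] by (simp add: facets_def)
  ultimately show ?thesis using x(1) by auto
qed

lemma cell_inj: "inj_on (\<lambda>F. cell F w) A"
  by (auto simp: inj_on_def cell_eq_iff)

lemma lift_Diff: "lift \<Phi> w - lift \<Psi> w = (\<lambda>F. cell F w) ` (\<Phi> - \<Psi>)"
  by (auto simp: lift_def cell_eq_iff)

lemma adjacent_lift_iff: "adjacent (lift \<Phi> w) (lift \<Psi> w) \<longleftrightarrow> adjacent \<Phi> \<Psi>"
  by (simp add: adjacent_def lift_Diff card_image[OF cell_inj])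

text \<open>The two copies share the facet \<open>x\<close> and all below it, so the lifts differ
  only in the top faces of the copies.\<close>

lemma adjacent_lift_rmul:
  assumes \<Phi>: "\<Phi> \<in> flags K" and w: "w \<in> words" and x: "x \<in> \<Phi>" "x \<in> facets"
  shows "adjacent (lift \<Phi> w) (lift \<Phi> (rmul x w))"
proof -
  have v: "rmul x w \<in> words" using rmul_words x w by blast
  obtain y where y: "y \<in> \<Phi>" "y \<in> facets" "\<forall>F\<in>\<Phi>. F \<noteq> M \<longrightarrow> (F, y) \<in> leq K"
    using facet_in_flag[OF \<Phi>] by auto
  have "x = y" using flag_rk_inj[OF K \<Phi> x(1) y(1)] x(2) y(2) by (simp add: facets_def)
  then have eq: "cell F (rmul x w) = cell F w" if "F \<in> \<Phi> - {M}" for F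
    using y(3) that cell_rmul by simp
  have ne: "cell M (rmul x w) \<noteq> cell M w" using cell_M_eq_iff[OF v w] rmul_neq by metis
  have "\<Phi> = insert M (\<Phi> - {M})" using M_flag[OF \<Phi>] by auto
  then have "lift \<Phi> u = insert (cell M u) (insert None ((\<lambda>F. cell F u) ` (\<Phi> - {M})))" for u
    unfolding lift_def by (metis image_insert insert_commute)
  moreover have "(\<lambda>F. cell F (rmul x w)) ` (\<Phi> - {M}) = (\<lambda>F. cell F w) ` (\<Phi> - {M})"
    using eq by (rule image_cong[OF refl])
  moreover have "cell M w \<notin> (\<lambda>F. cell F w) ` (\<Phi> - {M})"
    "cell M (rmul x w) \<notin> (\<lambda>F. cell F w) ` (\<Phi> - {M})"
    by (auto simp: cell_eq_iff)
  ultimately have "lift \<Phi> w - lift \<Phi> (rmul x w) = {cell M w}"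
    "lift \<Phi> (rmul x w) - lift \<Phi> w = {cell M (rmul x w)}"
    using ne by auto
  then show ?thesis by (simp add: adjacent_def)
qed

text \<open>If the copies differ, their top faces are the single pair exchanged. All other faces are
  then shared, in particular a facet, which leaves just one possibility for the second copy.\<close>

lemma adjacent_lift_cases:
  assumes fl: "\<Phi> \<in> flags K" "\<Psi> \<in> flags K" and w: "w \<in> words" "v \<in> words"
    and adj: "adjacent (lift \<Phi> w) (lift \<Psi> v)"
  obtains "w = v" "adjacent \<Phi> \<Psi>"
  | x where "w \<noteq> v" "\<Psi> = \<Phi>" "x \<in> \<Phi>" "x \<in> facets" "v = rmul x w"
proof (cases "w = v")
  case True
  then show ?thesis using that(1) adj adjacent_lift_iff by simp
next
  case False
  have MM: "M \<in> \<Phi>" "M \<in> \<Psi>" using M_flag fl by auto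
  have "cell M w \<in> lift \<Phi> w" using MM by (simp add: lift_def)
  moreover have "cell M w \<notin> lift \<Psi> v"
    using False strip_M[OF w(1)] strip_M[OF w(2)] by (auto simp: lift_def cell_eq_iff)
  ultimately have "cell M w \<in> lift \<Phi> w - lift \<Psi> v" by simp
  moreover obtain z where "lift \<Phi> w - lift \<Psi> v = {z}"
    using adj unfolding adjacent_def by (meson card_1_singletonE)
  ultimately have diff: "lift \<Phi> w - lift \<Psi> v = {cell M w}" by simp
  have sub: "F \<in> \<Psi> \<and> strip F w = strip F v" if "F \<in> \<Phi>" "F \<noteq> M" for F
  proof -
    have "cell F w \<noteq> cell M w" using that by (simp add: cell_eq_iff)
    moreover have "cell F w \<in> lift \<Phi> w" using that by (simp add: lift_def)
    ultimately have "cell F w \<in> lift \<Psi> v" using diff by auto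
    then show ?thesis by (auto simp: lift_def cell_eq_iff)
  qed
  then have "\<Phi> \<subseteq> \<Psi>" using MM by auto
  moreover have "\<Psi> \<in> Chains (leq K)" using fl(2) by (simp add: flags_def)
  ultimately have "\<Psi> = \<Phi>" using fl(1) by (simp add: flags_def)
  obtain x where x: "x \<in> \<Phi>" "x \<in> facets" using facet_in_flag[OF fl(1)] by auto
  have "x \<noteq> M" using x(2) rk_M by (auto simp: facets_def)
  then have "strip x w = strip x v" using sub x(1) by simp
  then have "v = rmul x w" using strip_facet_eq[OF x(2) w] False by auto
  then show ?thesis using that(2) False \<open>\<Psi> = \<Phi>\<close> x by simp
qed

section \<open>Strong flag-connectedness of the model\<close>

definition flag_step :: "('a \<times> 'a list) option set \<Rightarrow> (('a \<times> 'a list) option set) rel" where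
  "flag_step J = {(A, B). A \<in> flags ext \<and> B \<in> flags ext \<and> J \<subseteq> A \<and> J \<subseteq> B \<and> adjacent A B}"

lemma flag_step_sym: "(A, B) \<in> (flag_step J)\<^sup>* \<Longrightarrow> (B, A) \<in> (flag_step J)\<^sup>*"
proof -
  have "sym (flag_step J)" by (auto simp: sym_def flag_step_def adjacent_sym)
  then have "sym ((flag_step J)\<^sup>*)" by (rule sym_rtrancl)
  then show "(A, B) \<in> (flag_step J)\<^sup>* \<Longrightarrow> (B, A) \<in> (flag_step J)\<^sup>*" by (rule symD)
qed

text \<open>Paths are built with a convenient, larger common part and then reused for the actual
  intersection of two flags.\<close>

lemma flag_step_mono: "J \<subseteq> J' \<Longrightarrow> (A, B) \<in> (flag_step J')\<^sup>* \<Longrightarrow> (A, B) \<in> (flag_step J)\<^sup>*"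
  by (rule subsetD[OF rtrancl_mono]) (auto simp: flag_step_def)

lemma lift_mono: "\<Phi> \<subseteq> \<Psi> \<Longrightarrow> lift \<Phi> w \<subseteq> lift \<Psi> w"
  by (auto simp: lift_def)

lemma flag_path_in_cell:
  assumes fl: "\<Phi> \<in> flags K" "\<Psi> \<in> flags K" and w: "w \<in> words" and J: "J \<subseteq> lift (\<Phi> \<inter> \<Psi>) w"
  shows "(lift \<Phi> w, lift \<Psi> w) \<in> (flag_step J)\<^sup>*"
  using K fl
proof (induction rule: flag_connected_induct)
  case (step A B)
  have "J \<subseteq> lift A w" "J \<subseteq> lift B w"
    using J lift_mono[OF step(3), of w] lift_mono[OF step(4), of w] by auto
  then have "(lift A w, lift B w) \<in> flag_step J"
    using lift_flag[OF step(1) w] lift_flag[OF step(2) w] step(5)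
    by (simp add: flag_step_def adjacent_lift_iff)
  with step(6) show ?case by (rule rtrancl_into_rtrancl)
qed simp

text \<open>Walks from the copy \<open>w\<close> to the copy \<open>strip m w\<close> by crossing
  one facet per dropped letter, keeping all faces of \<Phi> below \<open>m\<close>. Before a
  crossing the flag is moved inside its copy to one through the facet \<open>x\<close>, which is
  possible because those faces lie below \<open>m\<close> and hence below \<open>x\<close>.\<close>

lemma flag_path_strip:
  assumes "\<Phi> \<in> flags K" "m \<in> \<Phi>" "w \<in> words"
  shows "\<exists>\<Psi>\<in>flags K. {F \<in> \<Phi>. (F, m) \<in> leq K} \<subseteq> \<Psi> \<and>
           (lift \<Phi> w, lift \<Psi> (strip m w)) \<in> (flag_step (lift {F \<in> \<Phi>. (F, m) \<in> leq K} w))\<^sup>*"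
  using assms
proof (induction w arbitrary: \<Phi>)
  case Nil
  then show ?case by (intro bexI[of _ \<Phi>]) auto
next
  case (Cons x w)
  let ?D = "\<lambda>\<Phi>. {F \<in> \<Phi>. (F, m) \<in> leq K}"
  have x: "x \<in> facets" and w: "w \<in> words" using words_Cons[OF Cons.prems(3)] by auto
  show ?case
  proof (cases "(m, x) \<in> leq K")
    case False
    then show ?thesis using Cons.prems by (intro bexI[of _ \<Phi>]) (auto simp: strip_Cons)
  next
    case True
    have Dx: "(F, x) \<in> leq K" if "F \<in> ?D \<Phi>" for F using that True polytope_trans[OF K, of F m x] by simp
    have "insert x (?D \<Phi>) \<in> Chains (leq K)"
      using Dx flag_comparable[OF Cons.prems(1)] x polytope_refl[OF K, of x]
      by (auto simp: Chains_def facets_def)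
    from chain_in_flag[OF this] obtain \<Theta> where \<Theta>: "\<Theta> \<in> flags K" "x \<in> \<Theta>" "?D \<Phi> \<subseteq> \<Theta>" by auto
    let ?J = "lift (?D \<Phi>) (x # w)"
    have "m \<in> ?D \<Phi>"
      using Cons.prems(2) polytope_refl[OF K, of m] subsetD[OF flag_faces[OF Cons.prems(1)]] by simp
    then have m\<Theta>: "m \<in> \<Theta>" using \<Theta>(3) by auto
    have "?D \<Phi> \<subseteq> \<Phi> \<inter> \<Theta>" using \<Theta>(3) by auto
    then have 1: "(lift \<Phi> (x # w), lift \<Theta> (x # w)) \<in> (flag_step ?J)\<^sup>*"
      using flag_path_in_cell[OF Cons.prems(1) \<Theta>(1) Cons.prems(3)] lift_mono by simp
    \<comment> \<open>Faces below \<open>x\<close> are the same cells in the copies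
      \<open>x # w\<close> and \<open>w\<close>.\<close>
    have J: "?J = lift (?D \<Phi>) w"
      using Dx by (auto simp: lift_def cell_eq_iff strip_Cons image_iff)
    have rm: "rmul x (x # w) = w" by (simp add: rmul_def)
    have "(lift \<Theta> (x # w), lift \<Theta> w) \<in> flag_step ?J"
      unfolding flag_step_def
    proof (intro CollectI case_prodI conjI)
      show "lift \<Theta> (x # w) \<in> flags ext" "lift \<Theta> w \<in> flags ext"
        using lift_flag \<Theta>(1) w Cons.prems(3) by auto
      show "?J \<subseteq> lift \<Theta> (x # w)" using lift_mono[OF \<Theta>(3)] .
      show "?J \<subseteq> lift \<Theta> w" unfolding J using lift_mono[OF \<Theta>(3)] .
      show "adjacent (lift \<Theta> (x # w)) (lift \<Theta> w)"
        using adjacent_lift_rmul[OF \<Theta>(1) Cons.prems(3) \<Theta>(2) x] rm by simp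
    qed
    with 1 have 2: "(lift \<Phi> (x # w), lift \<Theta> w) \<in> (flag_step ?J)\<^sup>*" by (rule rtrancl_into_rtrancl)
    obtain \<Psi> where \<Psi>: "\<Psi> \<in> flags K" "?D \<Theta> \<subseteq> \<Psi>"
      "(lift \<Theta> w, lift \<Psi> (strip m w)) \<in> (flag_step (lift (?D \<Theta>) w))\<^sup>*"
      using Cons.IH[OF \<Theta>(1) m\<Theta> w] by auto
    have sub: "?D \<Phi> \<subseteq> ?D \<Theta>" using \<Theta>(3) by auto
    have "?J \<subseteq> lift (?D \<Theta>) w" unfolding J using lift_mono[OF sub] .
    then have "(lift \<Theta> w, lift \<Psi> (strip m w)) \<in> (flag_step ?J)\<^sup>*"
      using flag_step_mono \<Psi>(3) by simp
    with 2 have "(lift \<Phi> (x # w), lift \<Psi> (strip m w)) \<in> (flag_step ?J)\<^sup>*" by (rule rtrancl_trans)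
    moreover have "strip m (x # w) = strip m w" using True by (simp add: strip_Cons)
    moreover have "?D \<Phi> \<subseteq> \<Psi>" using sub \<Psi>(2) by (rule subset_trans)
    ultimately show ?thesis using \<Psi>(1) by (intro bexI[of _ \<Psi>]) simp_all
  qed
qed

text \<open>Let \<open>m\<close> be the highest face of \<open>K\<close> at which the two flags
  coincide. Then their common part lies below \<open>m\<close>, and both flags can be led to the
  copy \<open>strip m w = strip m v\<close>, inside which the connectedness of \<open>K\<close>
  completes the path.\<close>

lemma strongly_flag_connected_ext: "strongly_flag_connected ext"
proof -
  have "(A, B) \<in> (flag_step (A \<inter> B))\<^sup>*" if AB: "A \<in> flags ext" "B \<in> flags ext" for A B
  proof -
    obtain \<Phi> w where \<Phi>: "\<Phi> \<in> flags K" "w \<in> words" "A = lift \<Phi> w" using flag_ext_lift[OF AB(1)] .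
    obtain \<Psi> v where \<Psi>: "\<Psi> \<in> flags K" "v \<in> words" "B = lift \<Psi> v" using flag_ext_lift[OF AB(2)] .
    let ?S = "{F \<in> \<Phi> \<inter> \<Psi>. strip F w = strip F v}"
    \<comment> \<open>All copies share the least face, so \<open>?S\<close> is nonempty and has a
      member of highest rank.\<close>
    obtain E where E: "E \<in> faces K" "\<forall>G\<in>faces K. (E, G) \<in> leq K" using polytope_least[OF K] by blast
    have "E \<in> \<Phi>" "E \<in> \<Psi>" using least_in_flag[OF K _ E] \<Phi>(1) \<Psi>(1) by auto
    then have "E \<in> ?S" using strip_least[OF E(2)] \<Phi>(2) \<Psi>(2) by simp
    then have ne: "rk K ` ?S \<noteq> {}" by blast
    have "finite ?S" using flag_finite[OF K \<Phi>(1)] by simp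
    then have fin: "finite (rk K ` ?S)" by simp
    have "Max (rk K ` ?S) \<in> rk K ` ?S" using Max_in[OF fin ne] .
    then obtain m where m: "m \<in> ?S" "Max (rk K ` ?S) = rk K m" by (rule imageE)
    have Sm: "(F, m) \<in> leq K" if "F \<in> ?S" for F
    proof -
      have "rk K F \<le> rk K m" using Max_ge[OF fin imageI[OF that]] m(2) by simp
      then show ?thesis using flag_leq_iff[OF K \<Phi>(1)] that m(1) by simp
    qed
    let ?J = "A \<inter> B"
    have JS: "?J \<subseteq> insert None ((\<lambda>F. cell F w) ` ?S)"
      unfolding \<Phi>(3) \<Psi>(3) by (auto simp: lift_def cell_eq_iff)
    have cS: "cell F w = cell F v" "cell F w = cell F (strip m w)" if "F \<in> ?S" for F
      using that cell_strip[OF Sm[OF that], of w] by (simp_all add: cell_eq_iff)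
    have J1: "?J \<subseteq> lift {F \<in> \<Phi>. (F, m) \<in> leq K} w"
      using JS Sm by (auto simp: lift_def)
    have "insert None ((\<lambda>F. cell F w) ` ?S) \<subseteq> lift {F \<in> \<Psi>. (F, m) \<in> leq K} v"
      using Sm cS(1) by (auto simp: lift_def)
    then have J2: "?J \<subseteq> lift {F \<in> \<Psi>. (F, m) \<in> leq K} v" using JS by (rule subset_trans[rotated])
    have m': "m \<in> \<Phi>" "m \<in> \<Psi>" "strip m v = strip m w" using m(1) by auto
    obtain \<Phi>' where \<Phi>': "\<Phi>' \<in> flags K" "{F \<in> \<Phi>. (F, m) \<in> leq K} \<subseteq> \<Phi>'"
      "(lift \<Phi> w, lift \<Phi>' (strip m w)) \<in> (flag_step (lift {F \<in> \<Phi>. (F, m) \<in> leq K} w))\<^sup>*"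
      using flag_path_strip[OF \<Phi>(1) m'(1) \<Phi>(2)] by auto
    obtain \<Psi>' where \<Psi>': "\<Psi>' \<in> flags K" "{F \<in> \<Psi>. (F, m) \<in> leq K} \<subseteq> \<Psi>'"
      "(lift \<Psi> v, lift \<Psi>' (strip m w)) \<in> (flag_step (lift {F \<in> \<Psi>. (F, m) \<in> leq K} v))\<^sup>*"
      using flag_path_strip[OF \<Psi>(1) m'(2) \<Psi>(2)] m'(3) by auto
    have "?S \<subseteq> \<Phi>' \<inter> \<Psi>'" using Sm \<Phi>'(2) \<Psi>'(2) by auto
    then have "insert None ((\<lambda>F. cell F w) ` ?S) \<subseteq> lift (\<Phi>' \<inter> \<Psi>') (strip m w)"
      using cS(2) by (auto simp: lift_def)
    then have "?J \<subseteq> lift (\<Phi>' \<inter> \<Psi>') (strip m w)" using JS by (rule subset_trans[rotated])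
    then have "(lift \<Phi>' (strip m w), lift \<Psi>' (strip m w)) \<in> (flag_step ?J)\<^sup>*"
      by (rule flag_path_in_cell[OF \<Phi>'(1) \<Psi>'(1) strip_words[OF \<Phi>(2)]])
    moreover have "(A, lift \<Phi>' (strip m w)) \<in> (flag_step ?J)\<^sup>*"
      using flag_step_mono[OF J1 \<Phi>'(3)] \<Phi>(3) by simp
    moreover have "(lift \<Psi>' (strip m w), B) \<in> (flag_step ?J)\<^sup>*"
      using flag_step_sym[OF flag_step_mono[OF J2 \<Psi>'(3)]] \<Psi>(3) by simp
    ultimately show ?thesis by (meson rtrancl_trans)
  qed
  then show ?thesis unfolding strongly_flag_connected_def flag_step_def by blast
qed

section \<open>Diamonds, ranks and facets of the model\<close>

lemma leq_cell_below: "(z, cell G w) \<in> leq ext \<Longrightarrow> w \<in> words \<Longrightarrow> \<exists>F. (F, G) \<in> leq K \<and> z = cell F w"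
proof -
  assume z: "(z, cell G w) \<in> leq ext" and w: "w \<in> words"
  from z show "\<exists>F. (F, G) \<in> leq K \<and> z = cell F w"
  proof (cases rule: leq_extE)
    case 1
    then show ?thesis by simp
  next
    case (2 F G' v)
    then have "G' = G" "strip G v = strip G w" by (auto simp: cell_eq_iff)
    then have "(F, G) \<in> leq K" "cell F v = cell F w"
      using 2(1) strip_strip_eq[of F G v w] by (auto simp: cell_eq_iff)
    then show ?thesis using 2(3) by auto
  qed
qed

text \<open>A diamond below \<open>None\<close> consists of the two copies glued along a facet; any
  other diamond lies inside one copy.\<close>

lemma ext_diamond:
  assumes le: "(y, z) \<in> leq ext" and rk: "rk ext z = rk ext y + 2"
  shows "card {H \<in> faces ext. (y, H) \<in> leq ext \<and> (H, z) \<in> leq ext \<and> rk ext H = rk ext y + 1} = 2"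
    (is "card ?S = 2")
  using le
proof (cases rule: leq_extE)
  case 1
  from 1(2) show ?thesis
  proof (cases rule: faces_extE)
    case 1
    then show ?thesis using rk \<open>z = None\<close> by simp
  next
    case (2 x w)
    have rkx: "rk K x = int d - 1" using rk 1 2 by simp
    then have x: "x \<in> facets" using 2 by (simp add: facets_def)
    have v: "rmul x w \<in> words" using rmul_words[OF x 2(2)] .
    have "?S = {cell M w, cell M (rmul x w)}"
    proof
      show "?S \<subseteq> {cell M w, cell M (rmul x w)}"
      proof
        fix H assume H: "H \<in> ?S"
        then have "H \<in> faces ext" by simp
        then show "H \<in> {cell M w, cell M (rmul x w)}"
        proof (cases rule: faces_extE)
          case 1
          then show ?thesis using H rkx 2 by simp
        next
          case (2 G u)
          have "rk K G = int d" using H 2 rkx \<open>y = cell x w\<close> by simp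
          then have "G = M" by (rule rk_eq_M[OF 2(1)])
          moreover have "strip x w = strip x u"
            using H 2(3) \<open>y = cell x w\<close> leq_cell_iff[OF \<open>w \<in> words\<close> 2(2)] by simp
          then have "u = w \<or> u = rmul x w" using strip_facet_eq[OF x \<open>w \<in> words\<close> 2(2)] by simp
          ultimately show ?thesis using 2 by auto
        qed
      qed
      have xM: "(x, M) \<in> leq K" by (rule leq_M[OF 2(1)])
      have "(cell x w, cell M w) \<in> leq ext" "(cell x w, cell M (rmul x w)) \<in> leq ext"
        using leq_cell_iff 2 v xM strip_rmul[of x x w] polytope_refl[OF K 2(1)] by simp_all
      moreover have "cell M w \<in> faces ext" "cell M (rmul x w) \<in> faces ext"
        using cell_faces M 2 v by auto
      ultimately show "{cell M w, cell M (rmul x w)} \<subseteq> ?S"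
        using leq_None 2(3) rkx rk_M \<open>z = None\<close> by simp
    qed
    moreover have "cell M w \<noteq> cell M (rmul x w)"
      using cell_M_eq_iff[OF 2(2) v] rmul_neq[of x w] by simp
    ultimately show ?thesis by simp
  qed
next
  case (2 F G w)
  let ?T = "{H \<in> faces K. (F, H) \<in> leq K \<and> (H, G) \<in> leq K \<and> rk K H = rk K F + 1}"
  have rkT: "rk K G = rk K F + 2" using rk 2 by simp
  have "?S = (\<lambda>H. cell H w) ` ?T"
  proof
    show "?S \<subseteq> (\<lambda>H. cell H w) ` ?T"
    proof
      fix X assume X: "X \<in> ?S"
      then have "(X, cell G w) \<in> leq ext" using 2 by simp
      from leq_cell_below[OF this 2(2)] obtain H where H: "(H, G) \<in> leq K" "X = cell H w" by auto
      then have "(F, H) \<in> leq K" using X 2 leq_cell_iff[OF 2(2) 2(2)] by simp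
      then have "H \<in> ?T" using X H 2(3) leq_faces[OF H(1)] by simp
      then show "X \<in> (\<lambda>H. cell H w) ` ?T" using H(2) by blast
    qed
    show "(\<lambda>H. cell H w) ` ?T \<subseteq> ?S"
    proof (rule image_subsetI)
      fix H assume H: "H \<in> ?T"
      then have "cell H w \<in> faces ext" "(cell F w, cell H w) \<in> leq ext" "(cell H w, cell G w) \<in> leq ext"
        using cell_faces leq_cellI 2(2) by simp_all
      then show "cell H w \<in> ?S" using H 2(3,4) by simp
    qed
  qed
  then have "card ?S = card ?T" using card_image[OF cell_inj] by simp
  also have "\<dots> = 2" using polytope_diamond[OF K 2(1) rkT] .
  finally show ?thesis .
qed

lemma bij_betw_rk_lift:
  assumes \<Phi>: "\<Phi> \<in> flags K" and w: "w \<in> words"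
  shows "bij_betw (rk ext) (lift \<Phi> w) {-1..int (Suc d)}"
  unfolding bij_betw_def
proof
  have lt: "rk K F < int d + 1" if "F \<in> \<Phi>" for F
    using polytope_rk_range[OF K subsetD[OF flag_faces[OF \<Phi>] that]] by simp
  have "inj_on (rk K) \<Phi>" using flag_rk[OF K \<Phi>] by (simp add: bij_betw_def)
  then have "inj_on (rk ext) ((\<lambda>F. cell F w) ` \<Phi>)" by (intro inj_on_imageI) (simp add: comp_def)
  moreover have "rk ext None \<notin> rk ext ` ((\<lambda>F. cell F w) ` \<Phi> - {None})" using lt by fastforce
  ultimately show "inj_on (rk ext) (lift \<Phi> w)" by (simp add: lift_def)
  have "rk ext ` lift \<Phi> w = insert (int d + 1) (rk K ` \<Phi>)" by (simp add: lift_def image_image)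
  also have "rk K ` \<Phi> = {-1..int d}" using flag_rk[OF K \<Phi>] by (simp add: bij_betw_def)
  also have "insert (int d + 1) {-1..int d} = {-1..int (Suc d)}" by auto
  finally show "rk ext ` lift \<Phi> w = {-1..int (Suc d)}" .
qed

lemma polytope_ext: "polytope (Suc d) ext"
  unfolding polytope_def
proof (intro conjI ballI impI)
  show "Partial_order (leq ext)" by (rule ext_partial_order)
  show "rk ext ` faces ext \<subseteq> {-1..int (Suc d)}"
  proof (rule image_subsetI)
    fix z assume "z \<in> faces ext"
    then show "rk ext z \<in> {-1..int (Suc d)}"
    proof (cases rule: faces_extE)
      case (2 F w)
      then show ?thesis using polytope_rk_range[OF K, of F] by simp
    qed simp
  qed
  fix y z assume "(y, z) \<in> leq ext \<and> y \<noteq> z"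
  then have yz: "(y, z) \<in> leq ext" "y \<noteq> z" by auto
  from yz(1) show "rk ext y < rk ext z"
  proof (cases rule: leq_extE)
    case 1
    then obtain F w where "F \<in> faces K" "y = cell F w" using yz(2) by (auto elim: faces_extE)
    then show ?thesis using 1 polytope_rk_range[OF K, of F] by simp
  next
    case (2 F G w)
    then show ?thesis using polytope_rk_less[OF K, of F G] yz(2) by auto
  qed
next
  obtain E where E: "E \<in> faces K" "rk K E = -1" "\<forall>G\<in>faces K. (E, G) \<in> leq K"
    using polytope_least[OF K] by blast
  have "(cell E [], z) \<in> leq ext" if "z \<in> faces ext" for z
    using that
  proof (cases rule: faces_extE)
    case 1
    then show ?thesis using leq_None cell_faces[OF E(1) Nil_words] by simp
  next
    case (2 G w)
    then show ?thesis using leq_cell_iff[OF Nil_words 2(2)] E(3) strip_least[OF E(3) 2(2)] by simp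
  qed
  then show "\<exists>E\<in>faces ext. rk ext E = -1 \<and> (\<forall>G\<in>faces ext. (E, G) \<in> leq ext)"
    using cell_faces[OF E(1) Nil_words] E(2) by (intro bexI[of _ "cell E []"]) auto
next
  show "\<exists>M\<in>faces ext. rk ext M = int (Suc d) \<and> (\<forall>G\<in>faces ext. (G, M) \<in> leq ext)"
    using leq_None faces_ext by (intro bexI[of _ None]) auto
next
  show "strongly_flag_connected ext" by (rule strongly_flag_connected_ext)
next
  fix \<Sigma> assume "\<Sigma> \<in> flags ext"
  then obtain \<Phi> w where "\<Phi> \<in> flags K" "w \<in> words" "\<Sigma> = lift \<Phi> w" by (rule flag_ext_lift)
  then show "bij_betw (rk ext) \<Sigma> {-1..int (Suc d)}" using bij_betw_rk_lift by simp
next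
  fix y z assume "(y, z) \<in> leq ext \<and> rk ext z = rk ext y + 2"
  then show "card {H \<in> faces ext. (y, H) \<in> leq ext \<and> (H, z) \<in> leq ext \<and> rk ext H = rk ext y + 1} = 2"
    using ext_diamond by blast
qed

text \<open>The faces of rank \<open>d\<close> are the top faces of the copies, and all that lies
  below such a face belongs to its copy.\<close>

lemma facet_section_iso:
  assumes E: "E \<in> faces ext" "rk ext E = -1" and F: "F \<in> faces ext" "rk ext F = int d"
  shows "isomorphic (face_section ext E F) K"
proof -
  obtain E0 where E0: "E0 \<in> faces ext" "rk ext E0 = -1" "\<forall>G\<in>faces ext. (E0, G) \<in> leq ext"
    using polytope_least[OF polytope_ext] by blast
  have "E0 = E"
    using comparable_rk_inj[OF polytope_ext, of E0 E] E E0 by simp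
  then have least: "(E, G) \<in> leq ext" if "G \<in> faces ext" for G using E0 that by simp
  from F(1) obtain w where w: "w \<in> words" "F = cell M w"
  proof (cases rule: faces_extE)
    case 1
    then show ?thesis using F(2) by simp
  next
    case (2 G v)
    then have "G = M" using F(2) rk_eq_M by simp
    then show ?thesis using that[OF 2(2)] 2(3) by simp
  qed
  have fc: "faces (face_section ext E F) = {H. (E, H) \<in> leq ext \<and> (H, F) \<in> leq ext}"
    using faces_section[OF ext_partial_order] .
  also have "\<dots> = (\<lambda>G. cell G w) ` faces K"
  proof
    show "{H. (E, H) \<in> leq ext \<and> (H, F) \<in> leq ext} \<subseteq> (\<lambda>G. cell G w) ` faces K"
    proof
      fix H assume "H \<in> {H. (E, H) \<in> leq ext \<and> (H, F) \<in> leq ext}"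
      then have "(H, cell M w) \<in> leq ext" using w by simp
      from leq_cell_below[OF this w(1)] obtain G where "(G, M) \<in> leq K" "H = cell G w" by auto
      then show "H \<in> (\<lambda>G. cell G w) ` faces K" using leq_faces[of G M K] by simp
    qed
    show "(\<lambda>G. cell G w) ` faces K \<subseteq> {H. (E, H) \<in> leq ext \<and> (H, F) \<in> leq ext}"
      using least cell_faces[OF _ w(1)] w(2) leq_cellI[OF leq_M w(1)] by auto
  qed
  finally have fS: "faces (face_section ext E F) = (\<lambda>G. cell G w) ` faces K" .
  have "order_iso (\<lambda>G. cell G w) K (face_section ext E F)"
    unfolding order_iso_def
  proof (intro conjI ballI)
    show "bij_betw (\<lambda>G. cell G w) (faces K) (faces (face_section ext E F))"
      unfolding fS bij_betw_def using cell_inj by simp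
    fix G H assume GH: "G \<in> faces K" "H \<in> faces K"
    have "cell G w \<in> faces (face_section ext E F)" "cell H w \<in> faces (face_section ext E F)"
      unfolding fS using GH by auto
    then have "(cell G w, cell H w) \<in> leq (face_section ext E F) \<longleftrightarrow> (cell G w, cell H w) \<in> leq ext"
      unfolding fc by (simp add: face_section_def)
    then show "(G, H) \<in> leq K \<longleftrightarrow> (cell G w, cell H w) \<in> leq (face_section ext E F)"
      using leq_cell_iff[OF w(1) w(1)] by simp
  qed
  from order_iso_inv[OF this] show ?thesis by (auto simp: isomorphic_def)
qed

section \<open>Universal property and regularity\<close>

text \<open>\<open>\<C>\<close> is a family of charts of \<open>K\<close> in \<open>Q\<close> that
  can be continued across every facet; reading a word as a sequence of continuations yields a chart
  for each copy. A general family permits two uses: all immersions of \<open>K\<close> into a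
  regular extension, and the twisted copies inside the model itself.\<close>

lemma immersion_from_ext:
  assumes Q: "polytope (Suc d) Q"
    and imm: "\<And>c. c \<in> \<C> \<Longrightarrow> immersion c K Q"
    and reflect: "\<And>c x. c \<in> \<C> \<Longrightarrow> x \<in> facets \<Longrightarrow>
      \<exists>c'\<in>\<C>. (\<forall>F. (F, x) \<in> leq K \<longrightarrow> c' F = c F) \<and> c' M \<noteq> c M"
    and c0: "c0 \<in> \<C>"
  shows "\<exists>\<gamma>. immersion \<gamma> ext Q \<and> (\<forall>F\<in>faces K. \<gamma> (cell F []) = c0 F)"
proof -
  obtain MQ where MQ: "MQ \<in> faces Q" "rk Q MQ = int d + 1" "\<forall>G\<in>faces Q. (G, MQ) \<in> leq Q"
    using polytope_greatest[OF Q] by auto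
  \<comment> \<open>A fixed choice of the neighbouring chart. It is iterated along reduced words
    only, so two successive choices never have to cancel.\<close>
  define st where "st x c = (SOME c'. c' \<in> \<C> \<and> (\<forall>F. (F, x) \<in> leq K \<longrightarrow> c' F = c F) \<and> c' M \<noteq> c M)" for x c
  have st: "st x c \<in> \<C> \<and> (\<forall>F. (F, x) \<in> leq K \<longrightarrow> st x c F = c F) \<and> st x c M \<noteq> c M"
    if "c \<in> \<C>" "x \<in> facets" for c x
  proof -
    have "\<exists>c'. c' \<in> \<C> \<and> (\<forall>F. (F, x) \<in> leq K \<longrightarrow> c' F = c F) \<and> c' M \<noteq> c M"
      using reflect[OF that] by auto
    from someI_ex[OF this] show ?thesis unfolding st_def .
  qed
  define chart where "chart w = foldr st w c0" for w
  have chart_C: "chart w \<in> \<C>" if "w \<in> words" for w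
    using that
  proof (induction w)
    case (Cons x w)
    then show ?case using st words_Cons[OF Cons.prems] by (simp add: chart_def)
  qed (simp add: chart_def c0)
  have chart_Cons: "(F, x) \<in> leq K \<Longrightarrow> chart (x # w) F = chart w F" "chart (x # w) M \<noteq> chart w M"
    if "x # w \<in> words" for x w F
    using st[OF chart_C, of w x] words_Cons[OF that] by (simp_all add: chart_def)
  have chart_strip: "chart (strip F w) F = chart w F" if "w \<in> words" for F w
    using that
  proof (induction w)
    case (Cons x w)
    then show ?case using chart_Cons(1)[OF Cons.prems, of F] words_Cons[OF Cons.prems] by (simp add: strip_Cons)
  qed simp
  \<comment> \<open>A coset is evaluated at its shortest representative; by
    \<open>chart_strip\<close> every other representative gives the same value.\<close>
  define \<gamma> where "\<gamma> z = (case z of None \<Rightarrow> MQ | Some (F, w) \<Rightarrow> chart w F)" for z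
  have \<gamma>: "\<gamma> (cell F w) = chart w F" "\<gamma> None = MQ" if "w \<in> words" for F w
    using chart_strip[OF that] by (simp_all add: \<gamma>_def cell_def)
  have iw: "immersion (chart w) K Q" if "w \<in> words" for w using imm[OF chart_C[OF that]] .
  have rk\<gamma>: "rk Q (\<gamma> z) = rk ext z" if "z \<in> faces ext" for z
    using that
  proof (cases rule: faces_extE)
    case 1
    then show ?thesis using MQ(2) \<gamma>(2)[OF Nil_words] by simp
  next
    case (2 F w)
    then show ?thesis using \<gamma>(1) immersion_rk[OF iw] by simp
  qed
  have "immersion \<gamma> ext Q"
    unfolding immersion_def
  proof (intro conjI ballI allI impI rk\<gamma>)
    fix y z assume "(y, z) \<in> leq ext"
    then show "(\<gamma> y, \<gamma> z) \<in> leq Q"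
    proof (cases rule: leq_extE)
      case 1
      from 1(2) have "\<gamma> y \<in> faces Q"
      proof (cases rule: faces_extE)
        case 1
        then show ?thesis using MQ(1) \<gamma>(2)[OF Nil_words] by simp
      next
        case (2 F w)
        then show ?thesis using \<gamma>(1) immersion_faces[OF K iw] by simp
      qed
      then show ?thesis using 1 MQ(3) \<gamma>(2)[OF Nil_words] by simp
    next
      case (2 F G w)
      then show ?thesis using \<gamma>(1) immersion_leq[OF iw] by simp
    qed
  next
    fix A B assume AB: "A \<in> flags ext" "B \<in> flags ext" "adjacent A B"
    obtain \<Phi> w where \<Phi>: "\<Phi> \<in> flags K" "w \<in> words" "A = lift \<Phi> w" using flag_ext_lift[OF AB(1)] .
    obtain \<Psi> v where \<Psi>: "\<Psi> \<in> flags K" "v \<in> words" "B = lift \<Psi> v" using flag_ext_lift[OF AB(2)] .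
    have im: "\<gamma> ` lift \<Theta> u = insert MQ (chart u ` \<Theta>)" if "u \<in> words" for \<Theta> u
      using \<gamma>(1)[OF that] \<gamma>(2)[OF that] by (simp add: lift_def image_image)
    have rkc: "rk Q (chart u F) = rk K F" "chart u F \<noteq> MQ"
      if "u \<in> words" "F \<in> \<Theta>" "\<Theta> \<in> flags K" for u \<Theta> F
    proof -
      have F: "F \<in> faces K" using subsetD[OF flag_faces[OF that(3)] that(2)] .
      then show "rk Q (chart u F) = rk K F" using immersion_rk[OF iw[OF that(1)]] by simp
      then show "chart u F \<noteq> MQ" using polytope_rk_range[OF K F] MQ(2) by auto
    qed
    have "adjacent (lift \<Phi> w) (lift \<Psi> v)" using AB(3) \<Phi>(3) \<Psi>(3) by simp
    then show "\<gamma> ` A \<noteq> \<gamma> ` B"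
    proof (cases rule: adjacent_lift_cases[OF \<Phi>(1) \<Psi>(1) \<Phi>(2) \<Psi>(2), consumes 1])
      case 1
      have "chart w ` \<Phi> \<noteq> chart w ` \<Psi>"
        using iw[OF \<Phi>(2)] 1(2) \<Phi>(1) \<Psi>(1) by (simp add: immersion_def)
      moreover have "MQ \<notin> chart w ` \<Phi>" "MQ \<notin> chart w ` \<Psi>"
        using rkc(2)[OF \<Phi>(2) _ \<Phi>(1)] rkc(2)[OF \<Phi>(2) _ \<Psi>(1)] by auto
      ultimately show ?thesis
        unfolding \<Phi>(3) \<Psi>(3) im[OF \<Phi>(2)] im[OF \<Psi>(2)] using 1(1) by (simp add: insert_ident)
    next
      case (2 x)
      \<comment> \<open>One word extends the other by the letter \<open>x\<close>, so the choice of
        \<open>st\<close> separates the images of their top faces.\<close>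
      have "x # w \<in> words \<and> v = x # w \<or> w = x # v"
        using rmul_cases[of x w] 2(5) \<Psi>(2) by auto
      then have ne: "chart w M \<noteq> chart v M"
        using chart_Cons(2)[of x w] chart_Cons(2)[of x v] \<Phi>(2) by auto
      have "chart w M \<notin> \<gamma> ` B"
      proof
        assume "chart w M \<in> \<gamma> ` B"
        then have "chart w M = MQ \<or> (\<exists>F\<in>\<Psi>. chart w M = chart v F)"
          unfolding \<Psi>(3) im[OF \<Psi>(2)] by auto
        then obtain F where F: "F \<in> \<Psi>" "chart w M = chart v F"
          using rkc(2)[OF \<Phi>(2) M_flag[OF \<Phi>(1)] \<Phi>(1)] by auto
        have "rk K F = int d"
          using rkc(1)[OF \<Phi>(2) M_flag[OF \<Phi>(1)] \<Phi>(1)] rkc(1)[OF \<Psi>(2) F(1) \<Psi>(1)] F(2) rk_M by simp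
        then have "F = M" using rk_eq_M subsetD[OF flag_faces[OF \<Psi>(1)] F(1)] by simp
        then show False using F(2) ne by simp
      qed
      moreover have "chart w M \<in> \<gamma> ` A"
        unfolding \<Phi>(3) im[OF \<Phi>(2)] using M_flag[OF \<Phi>(1)] by simp
      ultimately show ?thesis by metis
    qed
  qed
  moreover have "\<gamma> (cell F []) = c0 F" for F using \<gamma>(1)[OF Nil_words] by (simp add: chart_def)
  ultimately show ?thesis by (intro exI[of _ \<gamma>]) simp
qed

text \<open>An automorphism of \<open>Q\<close> that exchanges only the face of rank
  \<open>d\<close> of a flag over a flag through \<open>x\<close> fixes the other faces of that
  flag. Composed with \<open>c\<close> it gives a chart on the other side, and rigidity below
  \<open>x\<close> shows that both charts agree on the facet.\<close>

lemma reflect_immersion: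
  assumes Q: "regular_polytope (Suc d) Q" and c: "immersion c K Q" and x: "x \<in> facets"
  shows "\<exists>c'. immersion c' K Q \<and> (\<forall>F. (F, x) \<in> leq K \<longrightarrow> c' F = c F) \<and> c' M \<noteq> c M"
proof -
  have pQ: "polytope (Suc d) Q" using Q by (simp add: regular_polytope_def)
  obtain MQ where MQ: "MQ \<in> faces Q" "rk Q MQ = int d + 1" "\<forall>G\<in>faces Q. (G, MQ) \<in> leq Q"
    using polytope_greatest[OF pQ] by auto
  have xK: "x \<in> faces K" "rk K x = int d - 1" using x by (auto simp: facets_def)
  obtain \<Phi> where \<Phi>: "\<Phi> \<in> flags K" "x \<in> \<Phi>" using leq_in_flag[OF K polytope_refl[OF K xK(1)]] by auto
  have \<Phi>K: "F \<in> faces K" if "F \<in> \<Phi>" for F using subsetD[OF flag_faces[OF \<Phi>(1)] that] .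
  let ?A = "insert MQ (c ` \<Phi>)"
  have A: "?A \<in> flags Q"
  proof (rule flagI[OF pQ])
    have "(c F, c G) \<in> leq Q \<or> (c G, c F) \<in> leq Q" if "F \<in> \<Phi>" "G \<in> \<Phi>" for F G
      using flag_comparable[OF \<Phi>(1) that] immersion_leq[OF c, of F G] immersion_leq[OF c, of G F] by auto
    moreover have "(c F, MQ) \<in> leq Q" if "F \<in> \<Phi>" for F
      using MQ(3) immersion_faces[OF K c \<Phi>K[OF that]] by simp
    moreover have "(MQ, MQ) \<in> leq Q" using MQ by simp
    ultimately show "?A \<in> Chains (leq Q)" by (auto simp: Chains_def)
    have "rk Q ` c ` \<Phi> = rk K ` \<Phi>"
      unfolding image_image using immersion_rk[OF c \<Phi>K] by (rule image_cong[OF refl])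
    then have "rk Q ` ?A = insert (int d + 1) {-1..int d}"
      using flag_rk[OF K \<Phi>(1)] MQ(2) by (simp add: bij_betw_def)
    then show "{-1..int (Suc d)} \<subseteq> rk Q ` ?A" by auto
  qed
  have cM: "c M \<in> ?A" "rk Q (c M) = int d"
    using M_flag[OF \<Phi>(1)] immersion_rk[OF c M(1)] rk_M by auto
  obtain b' where b': "b' \<notin> ?A" "rk Q b' = rk Q (c M)" "insert b' (?A - {c M}) \<in> flags Q"
    using adjacent_flag_exists[OF pQ A cM(1)] cM(2) by auto
  let ?B = "insert b' (?A - {c M})"
  obtain f where f: "order_iso f Q Q" "f ` ?A = ?B" using regular_polytope_transitive[OF Q A b'(3)] by auto
  have fi: "immersion f Q Q" by (rule order_iso_immersion[OF pQ pQ f(1)])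
  have i: "immersion (f \<circ> c) K Q" by (rule immersion_comp_inj[OF K c fi order_iso_inj[OF f(1)]])
  have fA: "f y \<in> ?B" if "y \<in> ?A" for y unfolding f(2)[symmetric] using that by (rule imageI)
  have "rk Q (f (c M)) = rk Q b'"
    using b'(2) immersion_rk[OF fi immersion_faces[OF K c M(1)]] by simp
  from flag_rk_inj[OF pQ b'(3) fA[OF cM(1)] insertI1 this] have "f (c M) = b'" .
  then have "(f \<circ> c) M \<noteq> c M" using b'(1) cM(1) by auto
  moreover have "(f \<circ> c) F = c F" if Fx: "(F, x) \<in> leq K" for F
  proof (rule immersion_agree_below[OF K pQ i c \<Phi> _ Fx])
    fix G assume G: "G \<in> \<Phi>" "(G, x) \<in> leq K"
    have "rk K G < int d" using polytope_rk_le[OF K G(2)] xK(2) by simp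
    then have "c G \<noteq> c M" using immersion_rk[OF c \<Phi>K[OF G(1)]] cM(2) by auto
    then have 1: "c G \<in> ?B" using G(1) by simp
    have 2: "f (c G) \<in> ?B" by (rule fA) (use G(1) in simp)
    have "rk Q (f (c G)) = rk Q (c G)" using immersion_rk[OF fi immersion_faces[OF K c \<Phi>K[OF G(1)]]] .
    from flag_rk_inj[OF pQ b'(3) 2 1 this] show "(f \<circ> c) G = c G" by simp
  qed
  ultimately show ?thesis using i by (intro exI[of _ "f \<circ> c"] conjI allI impI)
qed

text \<open>The inclusion of a facet. The given isomorphism respects only the order, but the section
  over the least face is closed downwards, so \<open>order_embedding_rk\<close> recovers the
  ranks.\<close>

lemma immersion_section:
  assumes Q: "regular_extension d K Q"
  shows "\<exists>c. immersion c K Q"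
proof -
  have pQ: "polytope (Suc d) Q" using Q by (simp add: regular_extension_def regular_polytope_def)
  have po: "Partial_order (leq Q)" using pQ unfolding polytope_def by (rule conjunct1)
  obtain E where E: "E \<in> faces Q" "rk Q E = -1" "\<forall>G\<in>faces Q. (E, G) \<in> leq Q"
    using polytope_least[OF pQ] by auto
  obtain \<Psi> where \<Psi>: "\<Psi> \<in> flags Q" using flags_nonempty[OF pQ] by auto
  obtain F where F: "F \<in> \<Psi>" "rk Q F = int d" using flag_face_of_rank[OF pQ \<Psi>, of "int d"] by auto
  have FQ: "F \<in> faces Q" using subsetD[OF flag_faces[OF \<Psi>] F(1)] .
  have "isomorphic (face_section Q E F) K" using Q E FQ F(2) by (simp add: regular_extension_def)
  then obtain h where h: "order_iso h (face_section Q E F) K" by (auto simp: isomorphic_def)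
  let ?S = "face_section Q E F"
  define c where "c = inv_into (faces ?S) h"
  have c: "order_iso c K ?S" unfolding c_def using order_iso_inv[OF h] .
  have fS: "faces ?S = {H. (E, H) \<in> leq Q \<and> (H, F) \<in> leq Q}" using faces_section[OF po] .
  have cim: "c ` faces K = faces ?S" using c by (simp add: order_iso_def bij_betw_def)
  have le: "(A, B) \<in> leq K \<longleftrightarrow> (c A, c B) \<in> leq Q" if "A \<in> faces K" "B \<in> faces K" for A B
  proof -
    have "c A \<in> faces ?S" "c B \<in> faces ?S" using cim that by auto
    then have "(c A, c B) \<in> leq ?S \<longleftrightarrow> (c A, c B) \<in> leq Q" unfolding fS by (simp add: face_section_def)
    then show ?thesis using c that by (simp add: order_iso_def)
  qed
  have rk: "rk Q (c A) = rk K A" if "A \<in> faces K" for A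
  proof (rule order_embedding_rk[OF K pQ _ le _ that])
    show "c ` faces K \<subseteq> faces Q" unfolding cim fS by (auto dest: leq_faces)
    show "H \<in> c ` faces K" if "A \<in> faces K" "(H, c A) \<in> leq Q" for A H
    proof -
      have "c A \<in> faces ?S" using cim that(1) by auto
      then have "(H, F) \<in> leq Q" unfolding fS using polytope_trans[OF pQ that(2), of F] by simp
      moreover have "(E, H) \<in> leq Q" using E(3) leq_faces[OF that(2)] by simp
      ultimately show ?thesis unfolding cim fS by simp
    qed
  qed
  have "immersion c K Q"
    unfolding immersion_def
  proof (intro conjI ballI allI impI rk)
    show "(c A, c B) \<in> leq Q" if "(A, B) \<in> leq K" for A B using le leq_faces[OF that] that by simp
    fix \<Phi> \<Psi> assume fl: "\<Phi> \<in> flags K" "\<Psi> \<in> flags K" "adjacent \<Phi> \<Psi>"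
    then have "\<Phi> \<noteq> \<Psi>" by (auto simp: adjacent_def)
    then show "c ` \<Phi> \<noteq> c ` \<Psi>"
      using inj_on_image_eq_iff[OF order_iso_inj[OF c] flag_faces[OF fl(1)] flag_faces[OF fl(2)]] by simp
  qed
  then show ?thesis by auto
qed

lemma immersion_ext_regular_extension:
  assumes Q: "regular_extension d K Q"
  shows "\<exists>\<gamma>. immersion \<gamma> ext Q"
proof -
  have rQ: "regular_polytope (Suc d) Q" using Q by (simp add: regular_extension_def)
  then have pQ: "polytope (Suc d) Q" by (simp add: regular_polytope_def)
  obtain c where c: "immersion c K Q" using immersion_section[OF Q] by auto
  have "\<exists>\<gamma>. immersion \<gamma> ext Q \<and> (\<forall>F\<in>faces K. \<gamma> (cell F []) = c F)"
  proof (rule immersion_from_ext[OF pQ, where \<C> = "{c. immersion c K Q}"])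
    fix c x assume "c \<in> {c. immersion c K Q}" "x \<in> facets"
    then show "\<exists>c'\<in>{c. immersion c K Q}. (\<forall>F. (F, x) \<in> leq K \<longrightarrow> c' F = c F) \<and> c' M \<noteq> c M"
      using reflect_immersion[OF rQ, of c x] by simp
  qed (simp_all add: c)
  then show ?thesis by auto
qed

section \<open>Twisted translations of the model\<close>

lemma order_iso_M:
  assumes "order_iso \<alpha> K K"
  shows "\<alpha> M = M"
  using rk_eq_M[OF order_iso_faces[OF assms M(1)]] order_iso_rk[OF K K assms M(1)] rk_M by simp

lemma order_iso_facets: "order_iso \<alpha> K K \<Longrightarrow> x \<in> facets \<Longrightarrow> \<alpha> x \<in> facets"
  using order_iso_faces[of \<alpha> K K x] order_iso_rk[OF K K, of \<alpha> x] by (simp add: facets_def)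

lemma immersion_cell:
  assumes \<alpha>: "order_iso \<alpha> K K" and w: "w \<in> words"
  shows "immersion (\<lambda>F. cell (\<alpha> F) w) K ext"
proof -
  have "immersion (\<lambda>F. cell F w) K ext"
    unfolding immersion_def
  proof (intro conjI ballI allI impI)
    fix \<Phi> \<Psi> :: "'a set" assume "adjacent \<Phi> \<Psi>"
    then have "\<Phi> \<noteq> \<Psi>" by (auto simp: adjacent_def)
    then show "(\<lambda>F. cell F w) ` \<Phi> \<noteq> (\<lambda>F. cell F w) ` \<Psi>"
      using inj_on_image_eq_iff[OF cell_inj[where A = UNIV]] by simp
  qed (simp_all add: leq_cellI w)
  from immersion_comp_inj[OF K order_iso_immersion[OF K K \<alpha>] this cell_inj]
  show ?thesis by (simp add: comp_def)
qed

text \<open>Provides the map belonging to a pair of a twist \<open>\<alpha>\<close> and a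
  translation \<open>v\<close>; regularity of \<open>K\<close> later makes these maps act
  transitively on flags.\<close>

lemma immersion_ext_ext:
  assumes "order_iso \<alpha> K K" "v \<in> words"
  shows "\<exists>\<gamma>. immersion \<gamma> ext ext \<and> (\<forall>F\<in>faces K. \<gamma> (cell F []) = cell (\<alpha> F) v)"
proof -
  let ?C = "{(\<lambda>F. cell (\<alpha> F) v) | \<alpha> v. order_iso \<alpha> K K \<and> v \<in> words}"
  have inC: "(\<lambda>F. cell (\<beta> F) u) \<in> ?C" if "order_iso \<beta> K K" "u \<in> words" for \<beta> u
    by (rule CollectI, rule exI[of _ \<beta>], rule exI[of _ u]) (simp add: that)
  show ?thesis
  proof (rule immersion_from_ext[OF polytope_ext, where \<C> = ?C and ?c0.0 = "\<lambda>F. cell (\<alpha> F) v"])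
    show "immersion c K ext" if "c \<in> ?C" for c 
    proof -
      from that obtain \<beta> u where "order_iso \<beta> K K" "u \<in> words" "c = (\<lambda>F. cell (\<beta> F) u)" by auto
      then show ?thesis using immersion_cell[of \<beta> u] by simp
    qed
    show "(\<lambda>F. cell (\<alpha> F) v) \<in> ?C" by (rule inC[OF assms])
    fix c x assume c: "c \<in> ?C" and x: "x \<in> facets"
    then obtain \<beta> u where \<beta>: "order_iso \<beta> K K" "u \<in> words" "c = (\<lambda>F. cell (\<beta> F) u)" by auto
    \<comment> \<open>Under the twist, the facet \<open>x\<close> of the chart is the facet
      \<open>\<beta> x\<close> of the copy \<open>u\<close>, and this is the one to be
      crossed.\<close>
    let ?u = "rmul (\<beta> x) u"
    have u: "?u \<in> words" using rmul_words[OF order_iso_facets[OF \<beta>(1) x] \<beta>(2)] .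
    have "cell (\<beta> F) ?u = c F" if "(F, x) \<in> leq K" for F
      using cell_rmul[OF order_iso_leq[OF \<beta>(1) that]] \<beta>(3) by simp
    moreover have "cell (\<beta> M) ?u \<noteq> c M"
      using cell_M_eq_iff[OF u \<beta>(2)] rmul_neq \<beta>(3) order_iso_M[OF \<beta>(1)] by simp
    moreover have "(\<lambda>F. cell (\<beta> F) ?u) \<in> ?C" by (rule inC[OF \<beta>(1) u])
    ultimately show "\<exists>c'\<in>?C. (\<forall>F. (F, x) \<in> leq K \<longrightarrow> c' F = c F) \<and> c' M \<noteq> c M"
      by (intro bexI[of _ "\<lambda>F. cell (\<beta> F) ?u"]) simp_all
  qed
qed

lemma immersion_ext_None: "immersion \<gamma> ext ext \<Longrightarrow> \<gamma> None = None"
proof -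
  assume i: "immersion \<gamma> ext ext"
  have N: "None \<in> faces ext" by (simp add: faces_ext)
  from immersion_faces[OF polytope_ext i N] show "\<gamma> None = None"
  proof (cases rule: faces_extE)
    case (2 F w)
    then show ?thesis using immersion_rk[OF i N] polytope_rk_range[OF K 2(1)] by simp
  qed
qed

end

locale regular_reflection_words = reflection_words +
  assumes reg: "regular_polytope d K"
begin

lemma immersion_ext_flag:
  assumes \<Phi>: "\<Phi> \<in> flags K" and A: "A \<in> flags ext"
  shows "\<exists>\<gamma>. immersion \<gamma> ext ext \<and> \<gamma> ` lift \<Phi> [] = A"
proof -
  obtain \<Psi> w where \<Psi>: "\<Psi> \<in> flags K" "w \<in> words" "A = lift \<Psi> w" using flag_ext_lift[OF A] .
  obtain \<alpha> where \<alpha>: "order_iso \<alpha> K K" "\<alpha> ` \<Phi> = \<Psi>" using regular_polytope_transitive[OF reg \<Phi> \<Psi>(1)] by auto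
  obtain \<gamma> where \<gamma>: "immersion \<gamma> ext ext" "\<forall>F\<in>faces K. \<gamma> (cell F []) = cell (\<alpha> F) w"
    using immersion_ext_ext[OF \<alpha>(1) \<Psi>(2)] by auto
  have "\<gamma> ` (\<lambda>F. cell F []) ` \<Phi> = (\<lambda>F. cell F w) ` \<alpha> ` \<Phi>"
    unfolding image_image using \<gamma>(2) subsetD[OF flag_faces[OF \<Phi>]] by (intro image_cong) auto
  then have "\<gamma> ` lift \<Phi> [] = A"
    unfolding \<Psi>(3) lift_def image_insert \<alpha>(2) by (simp only: immersion_ext_None[OF \<gamma>(1)])
  then show ?thesis using \<gamma>(1) by auto
qed

lemma immersion_ext_order_iso:
  assumes "immersion \<gamma> ext ext"
  shows "order_iso \<gamma> ext ext"
proof -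
  obtain \<Phi> where \<Phi>: "\<Phi> \<in> flags K" using flags_nonempty[OF K] by auto
  show ?thesis
    using immersions_order_iso[OF polytope_ext lift_flag[OF \<Phi> Nil_words] immersion_ext_flag[OF \<Phi>] assms] .
qed

lemma ext_automorphism:
  assumes "order_iso \<alpha> K K" "v \<in> words"
  shows "\<exists>\<gamma>. order_iso \<gamma> ext ext \<and> (\<forall>F\<in>faces K. \<gamma> (cell F []) = cell (\<alpha> F) v)"
  using immersion_ext_ext[OF assms] immersion_ext_order_iso by auto

lemma regular_ext: "regular_polytope (Suc d) ext"
proof (rule regular_polytopeI[OF polytope_ext])
  fix A B assume A: "A \<in> flags ext" and B: "B \<in> flags ext"
  obtain \<Phi> where \<Phi>: "\<Phi> \<in> flags K" using flags_nonempty[OF K] by auto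
  let ?L = "lift \<Phi> []"
  have L: "?L \<in> flags ext" using lift_flag[OF \<Phi> Nil_words] .
  obtain \<gamma> where \<gamma>: "immersion \<gamma> ext ext" "\<gamma> ` ?L = A" using immersion_ext_flag[OF \<Phi> A] by auto
  obtain \<delta> where \<delta>: "immersion \<delta> ext ext" "\<delta> ` ?L = B" using immersion_ext_flag[OF \<Phi> B] by auto
  have o: "order_iso \<gamma> ext ext" "order_iso \<delta> ext ext" using immersion_ext_order_iso \<gamma>(1) \<delta>(1) by auto
  let ?f = "\<delta> \<circ> inv_into (faces ext) \<gamma>"
  have "order_iso ?f ext ext" using order_iso_trans[OF order_iso_inv[OF o(1)] o(2)] .
  moreover have "inv_into (faces ext) \<gamma> ` A = ?L" using order_iso_inv_into_flag[OF o(1) L] \<gamma>(2) by simp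
  then have "?f ` A = B" using \<delta>(2) unfolding image_comp[symmetric] by simp
  ultimately show "\<exists>f. order_iso f ext ext \<and> f ` A = B" by (intro exI[of _ ?f]) simp
qed

lemma regular_extension_ext: "regular_extension d K ext"
  using reg regular_ext facet_section_iso by (simp add: regular_extension_def)

section \<open>Automorphisms of finite order\<close>

text \<open>On a copy, \<open>g\<close> is an immersion of \<open>K\<close>. Regularity of
  \<open>K\<close> gives a twist \<open>\<beta>\<close> with the correct image of one flag, and
  rigidity spreads the agreement over the copy.\<close>

lemma aut_ext_on_cell:
  assumes g: "order_iso g ext ext" and w: "w \<in> words"
  shows "\<exists>\<beta> v. order_iso \<beta> K K \<and> v \<in> words \<and> (\<forall>F\<in>faces K. g (cell F w) = cell (\<beta> F) v)"
proof -
  obtain \<Phi> where \<Phi>: "\<Phi> \<in> flags K" using flags_nonempty[OF K] by auto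
  have gA: "g ` lift \<Phi> w \<in> flags ext" using order_iso_flags[OF g lift_flag[OF \<Phi> w]] .
  obtain \<Psi> v where \<Psi>: "\<Psi> \<in> flags K" "v \<in> words" "g ` lift \<Phi> w = lift \<Psi> v" using flag_ext_lift[OF gA] .
  obtain \<beta> where \<beta>: "order_iso \<beta> K K" "\<beta> ` \<Phi> = \<Psi>" using regular_polytope_transitive[OF reg \<Phi> \<Psi>(1)] by auto
  have i: "immersion (g \<circ> (\<lambda>F. cell F w)) K ext"
    by (rule immersion_comp_inj[OF K immersion_cell[OF order_iso_id w]
          order_iso_immersion[OF polytope_ext polytope_ext g] order_iso_inj[OF g]])
  have "(g \<circ> (\<lambda>F. cell F w)) ` \<Phi> \<subseteq> lift \<Psi> v"
    unfolding \<Psi>(3)[symmetric] by (auto simp: lift_def)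
  moreover have "(\<lambda>F. cell (\<beta> F) v) ` \<Phi> \<subseteq> lift \<Psi> v"
    using \<beta>(2) by (auto simp: lift_def)
  ultimately have "(g \<circ> (\<lambda>F. cell F w)) F = cell (\<beta> F) v" if "F \<in> faces K" for F
    by (rule immersion_agree_flag[OF K polytope_ext i immersion_cell[OF \<beta>(1) \<Psi>(2)] \<Phi>
          lift_flag[OF \<Psi>(1,2)] _ _ that])
  then show ?thesis using \<beta>(1) \<Psi>(2) by auto
qed

text \<open>Glued copies go to glued copies: the images share the facet \<open>\<beta> x\<close> and
  are distinct, which determines the second one. The twist is unchanged, as it is prescribed below
  \<open>x\<close> and at \<open>M\<close>, hence on a whole flag.\<close>

lemma aut_ext_rmul:
  assumes g: "order_iso g ext ext" and w: "w \<in> words" and x: "x \<in> facets"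
    and \<beta>: "order_iso \<beta> K K" and v: "v \<in> words"
    and gw: "\<And>F. F \<in> faces K \<Longrightarrow> g (cell F w) = cell (\<beta> F) v"
    and F: "F \<in> faces K"
  shows "g (cell F (rmul x w)) = cell (\<beta> F) (rmul (\<beta> x) v)"
proof -
  have xK: "x \<in> faces K" using x by (simp add: facets_def)
  have rw: "rmul x w \<in> words" using rmul_words[OF x w] .
  obtain \<beta>' v' where \<beta>': "order_iso \<beta>' K K" "v' \<in> words"
    "\<forall>F\<in>faces K. g (cell F (rmul x w)) = cell (\<beta>' F) v'"
    using aut_ext_on_cell[OF g rw] by auto
  have below: "\<beta>' G = \<beta> G \<and> strip (\<beta> G) v' = strip (\<beta> G) v" if Gx: "(G, x) \<in> leq K" for G
  proof -
    have G: "G \<in> faces K" using leq_faces[OF Gx] by simp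
    have "cell (\<beta>' G) v' = g (cell G (rmul x w))" using \<beta>'(3) G by simp
    also have "\<dots> = cell (\<beta> G) v" using cell_rmul[OF Gx] gw[OF G] by simp
    finally show ?thesis by (auto simp: cell_eq_iff)
  qed
  have "strip (\<beta> x) v = strip (\<beta> x) v'" using below[OF polytope_refl[OF K xK]] by simp
  then have "v' = v \<or> v' = rmul (\<beta> x) v"
    by (rule strip_facet_eq[OF order_iso_facets[OF \<beta> x] v \<beta>'(2)])
  moreover have "v' \<noteq> v"
  proof
    assume "v' = v"
    then have "g (cell M (rmul x w)) = g (cell M w)"
      using bspec[OF \<beta>'(3) M(1)] gw[OF M(1)] order_iso_M[OF \<beta>] order_iso_M[OF \<beta>'(1)] by simp
    then have "cell M (rmul x w) = cell M w"
      using inj_onD[OF order_iso_inj[OF g]] cell_faces[OF M(1)] rw w by simp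
    then show False using cell_M_eq_iff[OF rw w] rmul_neq[of x w] by simp
  qed
  ultimately have v': "v' = rmul (\<beta> x) v" by simp
  obtain \<Phi> where \<Phi>: "\<Phi> \<in> flags K" "x \<in> \<Phi>" using leq_in_flag[OF K polytope_refl[OF K xK]] by auto
  obtain y where y: "y \<in> \<Phi>" "y \<in> facets" "\<forall>F\<in>\<Phi>. F \<noteq> M \<longrightarrow> (F, y) \<in> leq K"
    using facet_in_flag[OF \<Phi>(1)] by auto
  have "x = y" using flag_rk_inj[OF K \<Phi>(1) \<Phi>(2) y(1)] x y(2) by (simp add: facets_def)
  have "\<beta>' F = \<beta> F"
  proof (rule immersion_agree[OF K K order_iso_immersion[OF K K \<beta>'(1)] order_iso_immersion[OF K K \<beta>] \<Phi>(1) _ F])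
    fix G assume "G \<in> \<Phi>"
    then have "G = M \<or> (G, x) \<in> leq K" using y(3) \<open>x = y\<close> by auto
    then show "\<beta>' G = \<beta> G" using below order_iso_M[OF \<beta>] order_iso_M[OF \<beta>'(1)] by auto
  qed
  then show ?thesis using bspec[OF \<beta>'(3) F] v' by simp
qed

text \<open>Encodes the action of \<open>g\<close> on copies as w |-> u . \<alpha>(w): since the
  last letter stands at the head, folding \<open>map \<alpha> w\<close> onto \<open>u\<close>
  multiplies by \<alpha>(w) on the right.\<close>

definition acts_as :: "(('a \<times> 'a list) option \<Rightarrow> ('a \<times> 'a list) option) \<Rightarrow> ('a \<Rightarrow> 'a) \<Rightarrow> 'a list \<Rightarrow> bool" where
  "acts_as g \<alpha> u \<longleftrightarrow> order_iso \<alpha> K K \<and>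
     (\<forall>w\<in>words. foldr rmul (map \<alpha> w) u \<in> words \<and>
        (\<forall>F\<in>faces K. g (cell F w) = cell (\<alpha> F) (foldr rmul (map \<alpha> w) u)))"

lemma acts_as_exists:
  assumes g: "order_iso g ext ext"
  shows "\<exists>\<alpha> u. acts_as g \<alpha> u"
proof -
  obtain \<alpha> u where \<alpha>: "order_iso \<alpha> K K" "u \<in> words" "\<forall>F\<in>faces K. g (cell F []) = cell (\<alpha> F) u"
    using aut_ext_on_cell[OF g Nil_words] by auto
  have "foldr rmul (map \<alpha> w) u \<in> words \<and> (\<forall>F\<in>faces K. g (cell F w) = cell (\<alpha> F) (foldr rmul (map \<alpha> w) u))"
    if "w \<in> words" for w
    using that
  proof (induction w)
    case Nil
    then show ?case using \<alpha> by simp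
  next
    case (Cons x w)
    have x: "x \<in> facets" and w: "w \<in> words" using words_Cons[OF Cons.prems] by auto
    let ?v = "foldr rmul (map \<alpha> w) u"
    have IH: "?v \<in> words" "\<forall>F\<in>faces K. g (cell F w) = cell (\<alpha> F) ?v" using Cons.IH[OF w] by auto
    have "rmul x w = x # w" using Cons.prems by (cases w) (auto simp: rmul_def words_def)
    then have "g (cell F (x # w)) = cell (\<alpha> F) (rmul (\<alpha> x) ?v)" if "F \<in> faces K" for F
      using aut_ext_rmul[OF g w x \<alpha>(1) IH(1) bspec[OF IH(2)] that] by simp
    moreover have "rmul (\<alpha> x) ?v \<in> words" using rmul_words[OF order_iso_facets[OF \<alpha>(1) x] IH(1)] .
    ultimately show ?case by simp
  qed
  then show ?thesis using \<alpha>(1) unfolding acts_as_def by auto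
qed

lemma acts_asD:
  assumes "acts_as g \<alpha> u"
  shows "order_iso \<alpha> K K" "w \<in> words \<Longrightarrow> foldr rmul (map \<alpha> w) u \<in> words"
    "w \<in> words \<Longrightarrow> F \<in> faces K \<Longrightarrow> g (cell F w) = cell (\<alpha> F) (foldr rmul (map \<alpha> w) u)" "u \<in> words"
proof -
  show "order_iso \<alpha> K K" "w \<in> words \<Longrightarrow> foldr rmul (map \<alpha> w) u \<in> words"
    "w \<in> words \<Longrightarrow> F \<in> faces K \<Longrightarrow> g (cell F w) = cell (\<alpha> F) (foldr rmul (map \<alpha> w) u)"
    using assms by (simp_all add: acts_as_def)
  have "foldr rmul (map \<alpha> []) u \<in> words" using assms Nil_words unfolding acts_as_def by blast
  then show "u \<in> words" by simp
qed

lemma acts_as_M: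
  assumes "acts_as g \<alpha> u" "w \<in> words"
  shows "g (cell M w) = cell M (foldr rmul (map \<alpha> w) u)"
  using acts_asD(3)[OF assms M(1)] order_iso_M[OF acts_asD(1)[OF assms(1)]] by simp

section \<open>Cyclic reduction and torsion\<close>

lemma append_words:
  "w \<in> words \<Longrightarrow> u \<in> words \<Longrightarrow> w = [] \<or> u = [] \<or> last w \<noteq> hd u \<Longrightarrow> w @ u \<in> words"
  by (auto simp: words_def distinct_adj_append_iff)

lemma map_words:
  assumes \<alpha>: "order_iso \<alpha> K K" and w: "w \<in> words"
  shows "map \<alpha> w \<in> words"
proof -
  have sub: "set w \<subseteq> facets" using w by (simp add: words_def)
  then have "set w \<subseteq> faces K" by (auto simp: facets_def)
  then have "inj_on \<alpha> (set w)" using order_iso_inj[OF \<alpha>] by (rule inj_on_subset[rotated])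
  then have "distinct_adj (map \<alpha> w)" using w by (intro distinct_adj_mapI) (auto simp: words_def)
  then show ?thesis using sub order_iso_facets[OF \<alpha>] by (auto simp: words_def)
qed

text \<open>In reversed lists \<open>hd u\<close> is the last letter of the word and
  \<open>last u\<close> its first. Each iterate \<open>v\<close> again begins with the first letter
  of u, so the hypothesis excludes any cancellation between u and \<alpha>(v).\<close>

lemma funpow_cyclically_reduced:
  assumes g: "acts_as g \<alpha> u" and u: "u \<noteq> []" "hd u \<noteq> \<alpha> (last u)"
  shows "\<exists>v\<in>words. (g ^^ n) (cell M []) = cell M v \<and> length v = n * length u \<and> (v = [] \<or> last v = last u)"
proof (induction n)
  case 0
  then show ?case using Nil_words by (intro bexI[of _ "[]"]) simp_all
next
  case (Suc n)
  then obtain v where v: "v \<in> words" "(g ^^ n) (cell M []) = cell M v" "length v = n * length u"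
    "v = [] \<or> last v = last u" by auto
  have mv: "map \<alpha> v \<in> words" using map_words[OF acts_asD(1)[OF g] v(1)] .
  have "map \<alpha> v = [] \<or> u = [] \<or> last (map \<alpha> v) \<noteq> hd u"
    using v(4) u(2) by (auto simp: last_map)
  then have vu: "map \<alpha> v @ u \<in> words" by (rule append_words[OF mv acts_asD(4)[OF g]])
  then have "distinct_adj (map \<alpha> v @ u)" by (simp add: words_def)
  then have "(g ^^ Suc n) (cell M []) = cell M (map \<alpha> v @ u)"
    using acts_as_M[OF g v(1)] v(2) by (simp add: foldr_rmul_append)
  then show ?case using vu v(3) u(1) by (intro bexI[of _ "map \<alpha> v @ u"]) simp_all
qed

lemma square_fixes_cell:
  assumes "order_iso g ext ext" "acts_as g \<alpha> u" "n > 0" "\<And>z. z \<in> faces ext \<Longrightarrow> (g ^^ n) z = z"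
  shows "\<exists>w\<in>words. g (g (cell M w)) = cell M w"
  using assms
proof (induction "length u" arbitrary: g \<alpha> u rule: less_induct)
  case less
  note g = less.prems(1) and act = less.prems(2) and fix_n = less.prems(4)
  have \<alpha>: "order_iso \<alpha> K K" and uw: "u \<in> words" using acts_asD[OF act] by auto
  have g0: "g (cell M []) = cell M u" using acts_as_M[OF act Nil_words] by simp
  \<comment> \<open>If the last letter is the image of the first, either both are the same position,
    so that the only letter is fixed by \<open>\<alpha>\<close>, or the word is s . u' . \<alpha>(s)
    up to the reversal of the list.\<close>
  consider "u = []" | "u \<noteq> []" "hd u \<noteq> \<alpha> (last u)" | s where "u = [s]" "\<alpha> s = s"
    | s u' where "u = \<alpha> s # u' @ [s]"
  proof (cases "u = [] \<or> hd u \<noteq> \<alpha> (last u)")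
    case False
    then obtain t where t: "u = \<alpha> (last u) # t" by (metis list.collapse)
    show ?thesis
    proof (cases "t = []")
      case True
      then have "u = [\<alpha> (last u)]" using t by simp
      then show ?thesis using that(3)[of "last u"] by (metis last.simps)
    next
      case False
      then have "last u = last t" using t by (metis last_ConsR)
      then have "u = \<alpha> (last u) # butlast t @ [last u]" using t False by (metis append_butlast_last_id)
      then show ?thesis using that(4) by blast
    qed
  qed (use that(1,2) in blast)
  then show ?case
  proof cases
    case 1
    then show ?thesis using g0 Nil_words by (intro bexI[of _ "[]"]) simp_all
  next
    case 2
    obtain v where v: "v \<in> words" "(g ^^ n) (cell M []) = cell M v" "length v = n * length u"
      using funpow_cyclically_reduced[OF act 2, of n] by auto
    have "cell M v = cell M []" using v(2) fix_n[OF cell_faces[OF M(1) Nil_words]] by simp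
    then have "v = []" using cell_M_eq_iff[OF v(1) Nil_words] by simp
    then show ?thesis using v(3) less.prems(3) 2(1) by simp
  next
    case (3 s)
    \<comment> \<open>\<open>g\<close> exchanges the copies \<open>[]\<close> and
      \<open>[s]\<close>, which share the facet \<open>s\<close>; so the base copy is fixed by the
      square although it is moved by \<open>g\<close>.\<close>
    have "g (cell M [s]) = cell M []" using acts_as_M[OF act uw] 3 by (simp add: rmul_def)
    then show ?thesis using g0 3 Nil_words by (intro bexI[of _ "[]"]) simp_all
  next
    case (4 s u')
    have sw: "[s] \<in> words" and u': "u' @ [s] \<in> words"
      using uw 4 by (auto simp: words_def distinct_adj_Cons)
    then have u'w: "u' \<in> words" by (auto simp: words_def)
    \<comment> \<open>\<open>h\<close> is left translation by r_s. Conjugation by it replaces u by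
      r_s u r_{\<alpha>(s)}, which cancels both ends and leaves \<open>u'\<close>.\<close>
    obtain h where h: "order_iso h ext ext" "\<forall>F\<in>faces K. h (cell F []) = cell F [s]"
      using ext_automorphism[OF order_iso_id sw] by auto
    obtain \<beta> v where hact: "acts_as h \<beta> v" using acts_as_exists[OF h(1)] by auto
    have \<beta>: "\<beta> F = F \<and> strip F v = strip F [s]" if "F \<in> faces K" for F
      using acts_asD(3)[OF hact Nil_words that] bspec[OF h(2) that] by (auto simp: cell_eq_iff)
    have "v = [s]" using \<beta>[OF M(1)] strip_M[OF acts_asD(4)[OF hact]] strip_M[OF sw] by simp
    have map_id: "map \<beta> w = w" if "w \<in> words" for w
      using that \<beta> by (intro map_idI) (auto simp: words_def facets_def)
    have hM: "h (cell M w) = cell M (foldr rmul w [s])" if "w \<in> words" for w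
      using acts_as_M[OF hact that] map_id[OF that] \<open>v = [s]\<close> by simp
    let ?h = "inv_into (faces ext) h"
    let ?k = "?h \<circ> (g \<circ> h)"
    have k: "order_iso ?k ext ext" using order_iso_conj[OF h(1) g] .
    obtain \<alpha>' u'' where kact: "acts_as ?k \<alpha>' u''" using acts_as_exists[OF k] by auto
    have hk: "h (?k z) = g (h z)" if "z \<in> faces ext" for z
      using order_iso_inv_into(2)[OF h(1) order_iso_faces[OF g order_iso_faces[OF h(1) that]]] by simp
    have Mf: "cell M w \<in> faces ext" if "w \<in> words" for w using cell_faces[OF M(1) that] .
    \<comment> \<open>The translation part is read off the image of the base copy, using
      \<open>h \<circ> ?k = g \<circ> h\<close> on faces.\<close>
    have "u'' = u'"
    proof -
      have "h (cell M u'') = h (?k (cell M []))" using acts_as_M[OF kact Nil_words] by simp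
      also have "\<dots> = g (cell M [s])" unfolding hk[OF Mf[OF Nil_words]] using hM[OF Nil_words] by simp
      also have "\<dots> = cell M (u' @ [s])" using acts_as_M[OF act sw] 4 by (simp add: rmul_def)
      also have "\<dots> = h (cell M u')" using hM[OF u'w] u' by (simp add: foldr_rmul_append words_def)
      finally have "cell M u'' = cell M u'"
        using inj_onD[OF order_iso_inj[OF h(1)]] Mf u'w acts_asD(4)[OF kact] by simp
      then show ?thesis using cell_M_eq_iff[OF acts_asD(4)[OF kact] u'w] by simp
    qed
    have "(?k ^^ n) z = z" if "z \<in> faces ext" for z
      using funpow_conj[OF h(1) g that, of n] fix_n[OF order_iso_faces[OF h(1) that]]
        order_iso_inv_into(1)[OF h(1) that] by simp
    moreover have "length u'' < length u" using 4 \<open>u'' = u'\<close> by simp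
    ultimately obtain w where w: "w \<in> words" "?k (?k (cell M w)) = cell M w"
      using less.hyps[OF _ k kact less.prems(3)] by auto
    have kf: "?k (cell M w) \<in> faces ext" using order_iso_faces[OF k Mf[OF w(1)]] .
    have "g (g (h (cell M w))) = h (cell M w)"
      using hk[OF kf] hk[OF Mf[OF w(1)]] w(2) by simp
    moreover have "h (cell M w) = cell M (foldr rmul w [s])" using hM[OF w(1)] .
    moreover have "foldr rmul w [s] \<in> words"
      using acts_asD(2)[OF hact w(1)] map_id[OF w(1)] \<open>v = [s]\<close> by simp
    ultimately show ?thesis by (intro bexI[of _ "foldr rmul w [s]"]) simp_all
  qed
qed

text \<open>On the fixed copy, g^2 is an automorphism \<open>\<beta>\<close> of \<open>K\<close>. A
  power of it with exponent \<open>2 ^ j\<close> is trivial there, hence fixes a flag of the model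
  and is trivial everywhere; for \<open>g\<close> the exponent becomes
  \<open>2 ^ Suc j\<close>.\<close>

lemma two_power_torsion_ext:
  assumes T: "two_power_torsion K"
  shows "two_power_torsion ext"
  unfolding two_power_torsion_def
proof (intro allI impI, elim conjE)
  fix g and n :: nat
  assume g: "order_iso g ext ext" and n: "n > 0" and fix_n: "\<forall>z\<in>faces ext. (g ^^ n) z = z"
  obtain \<alpha> u where "acts_as g \<alpha> u" using acts_as_exists[OF g] by auto
  from square_fixes_cell[OF g this n bspec[OF fix_n]]
  obtain w where w: "w \<in> words" "g (g (cell M w)) = cell M w" by auto
  define k where "k = g ^^ 2"
  have k: "order_iso k ext ext" unfolding k_def by (rule order_iso_funpow[OF g])
  obtain \<beta> v where \<beta>: "order_iso \<beta> K K" "v \<in> words" "\<forall>F\<in>faces K. k (cell F w) = cell (\<beta> F) v"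
    using aut_ext_on_cell[OF k w(1)] by auto
  have "cell M v = cell M w"
    using bspec[OF \<beta>(3) M(1)] w(2) order_iso_M[OF \<beta>(1)] by (simp add: k_def numeral_2_eq_2)
  then have "v = w" using cell_M_eq_iff[OF \<beta>(2) w(1)] by simp
  have kp: "(k ^^ i) (cell F w) = cell ((\<beta> ^^ i) F) w" if "F \<in> faces K" for i F
  proof (induction i)
    case (Suc i)
    then show ?case
      using bspec[OF \<beta>(3) order_iso_faces[OF order_iso_funpow[OF \<beta>(1)] that], of i] \<open>v = w\<close> by simp
  qed simp
  \<comment> \<open>The exponent \<open>n\<close> that annihilates \<open>g\<close> also annihilates
    its square, and so makes \<open>\<beta>\<close> an element of finite order.\<close>
  have kn: "(k ^^ n) z = z" if "z \<in> faces ext" for z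
  proof -
    have "(k ^^ n) z = (g ^^ (n + n)) z" unfolding k_def by (simp add: funpow_mult mult_2)
    also have "\<dots> = (g ^^ n) ((g ^^ n) z)" by (simp add: funpow_add)
    finally show ?thesis using fix_n that by simp
  qed
  have "(\<beta> ^^ n) F = F" if "F \<in> faces K" for F
    using kp[OF that, of n] kn[OF cell_faces[OF that w(1)]] by (simp add: cell_eq_iff)
  from two_power_torsionD[OF T \<beta>(1) n this] obtain j where j: "\<forall>F\<in>faces K. (\<beta> ^^ (2 ^ j)) F = F" by auto
  obtain \<Phi> where \<Phi>: "\<Phi> \<in> flags K" using flags_nonempty[OF K] by auto
  have o: "order_iso (k ^^ (2 ^ j)) ext ext" using order_iso_funpow[OF k] .
  have i: "immersion (k ^^ (2 ^ j)) ext ext" by (rule order_iso_immersion[OF polytope_ext polytope_ext o])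
  have "(k ^^ (2 ^ j)) z = z" if "z \<in> lift \<Phi> w" for z
  proof -
    from that consider "z = None" | F where "F \<in> \<Phi>" "z = cell F w" by (auto simp: lift_def)
    then show ?thesis
    proof cases
      case (2 F)
      have F: "F \<in> faces K" using subsetD[OF flag_faces[OF \<Phi>] 2(1)] .
      show ?thesis using kp[OF F] bspec[OF j F] 2(2) by simp
    qed (simp add: immersion_ext_None[OF i])
  qed
  then have fl: "(k ^^ (2 ^ j)) ` lift \<Phi> w = lift \<Phi> w" by (simp add: image_def)
  have "(g ^^ (2 ^ Suc j)) z = z" if "z \<in> faces ext" for z
  proof -
    have "g ^^ (2 ^ Suc j) = k ^^ (2 ^ j)" unfolding k_def by (simp add: funpow_mult)
    then show ?thesis using immersion_flag_eqI[OF polytope_ext i lift_flag[OF \<Phi> w(1)] fl that] by simp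
  qed
  then show "\<exists>k. \<forall>z\<in>faces ext. (g ^^ (2 ^ k)) z = z" by blast
qed

text \<open>Here \<open>d \<ge> 1\<close> enters: the rank \<open>d - 1\<close> lies strictly
  between -1 and \<open>d\<close>, so the facet of a flag can be exchanged.\<close>

lemma two_facets: "\<exists>x\<in>facets. \<exists>y\<in>facets. x \<noteq> y"
proof -
  obtain \<Phi> where \<Phi>: "\<Phi> \<in> flags K" using flags_nonempty[OF K] by auto
  obtain x where x: "x \<in> \<Phi>" "x \<in> facets" using facet_in_flag[OF \<Phi>] by auto
  have rk: "rk K x = int d - 1" using x(2) by (simp add: facets_def)
  obtain y where y: "y \<notin> \<Phi>" "rk K y = rk K x" "insert y (\<Phi> - {x}) \<in> flags K"
    using adjacent_flag_exists[OF K \<Phi> x(1)] rk d by auto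
  have "y \<in> facets" using flag_faces[OF y(3)] y(2) rk by (simp add: facets_def)
  moreover have "x \<noteq> y" using x(1) y(1) by auto
  ultimately show ?thesis using x(2) by auto
qed

text \<open>Two letters suffice for a reduced word of every length, and different words give copies
  with different top faces.\<close>

lemma infinite_ext: "infinite (faces ext)"
proof
  assume fin: "finite (faces ext)"
  obtain x y where xy: "x \<in> facets" "y \<in> facets" "x \<noteq> y" using two_facets by auto
  have len: "\<exists>w\<in>words. length w = n" for n
  proof (induction n)
    case 0
    then show ?case using Nil_words by auto
  next
    case (Suc n)
    then obtain w where w: "w \<in> words" "length w = n" by auto
    obtain z where "z \<in> facets" "w = [] \<or> z \<noteq> hd w" using xy by metis
    then have "z # w \<in> words" using w(1) by (auto simp: words_def distinct_adj_Cons)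
    then show ?case using w(2) by (intro bexI[of _ "z # w"]) simp_all
  qed
  have "(\<lambda>w. cell M w) ` words \<subseteq> faces ext" using cell_faces[OF M(1)] by auto
  then have "finite ((\<lambda>w. cell M w) ` words)" using fin by (rule finite_subset)
  moreover have "inj_on (\<lambda>w. cell M w) words" using cell_M_eq_iff by (auto simp: inj_on_def)
  ultimately have "finite words" by (rule finite_imageD)
  then have "finite (length ` words)" by simp
  moreover have "length ` words = UNIV"
  proof (intro equalityI subsetI UNIV_I)
    fix n show "n \<in> length ` words" using len[of n] by auto
  qed
  ultimately show False by simp
qed

section \<open>Existence and uniqueness of the free extension\<close>

lemma free_extension_nat_exists: "\<exists>N :: nat ranked_poset. free_extension d K N"
proof -
  \<comment> \<open>The model has its faces in a type built over \<open>'a\<close>; countability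
    moves it to the natural numbers.\<close>
  obtain N :: "nat ranked_poset" and f where f: "order_iso f N ext" and rk: "\<forall>F\<in>faces N. rk ext (f F) = rk N F"
    using polytope_copy_on_nat[OF polytope_ext] by auto
  let ?g = "inv_into (faces N) f"
  have g: "order_iso ?g ext N" using order_iso_inv[OF f] .
  have "rk N (?g z) = rk ext z" if "z \<in> faces ext" for z
    using bspec[OF rk order_iso_faces[OF g that]] order_iso_inv_into(2)[OF f that] by simp
  then have N: "regular_extension d K N" by (rule regular_extension_iso[OF regular_extension_ext g])
  then have pN: "polytope (Suc d) N" by (simp add: regular_extension_def regular_polytope_def)
  have "covers N Q" if Q: "regular_extension d K Q" for Q :: "nat ranked_poset"
  proof -
    have pQ: "polytope (Suc d) Q" using Q by (simp add: regular_extension_def regular_polytope_def)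
    obtain \<gamma> where \<gamma>: "immersion \<gamma> ext Q" using immersion_ext_regular_extension[OF Q] by auto
    have "immersion (\<gamma> \<circ> f) N Q"
      by (rule immersion_comp[OF pN polytope_ext order_iso_immersion[OF pN polytope_ext f] \<gamma>])
    then show ?thesis using covers_iff_immersion[OF pN pQ] by auto
  qed
  then show ?thesis using N by (auto simp: free_extension_def)
qed

text \<open>The model and \<open>P\<close> cover each other. The covering of the model by
  \<open>P\<close> comes from \<open>free_extension_covers\<close>, since the faces of the model are
  not natural numbers.\<close>

lemma free_extension_order_iso:
  assumes P: "free_extension d K P"
  shows "\<exists>f. order_iso f ext P"
proof -
  have rP: "regular_extension d K P" using P by (simp add: free_extension_def)
  then have pP: "polytope (Suc d) P" by (simp add: regular_extension_def regular_polytope_def)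
  obtain \<gamma> where \<gamma>: "immersion \<gamma> ext P" using immersion_ext_regular_extension[OF rP] by auto
  obtain \<delta> where \<delta>: "immersion \<delta> P ext"
    using free_extension_covers[OF P regular_extension_ext] covers_iff_immersion[OF pP polytope_ext] by auto
  show ?thesis by (rule order_iso_of_immersions[OF regular_ext pP \<gamma> \<delta>])
qed

end

theorem theorem7p1:
  fixes d :: nat and K :: "'a ranked_poset"
  assumes "d \<ge> 1"
    and "regular_polytope d K"
    and "finite_2_group (aut_group K) \<or> infinite_2_group (aut_group K)"
  shows "(\<exists>P :: nat ranked_poset. free_extension d K P) \<and>
         (\<forall>P :: 'b ranked_poset. free_extension d K P \<longrightarrow>
            regular_polytope (d + 1) P \<and> infinite_2_group (aut_group P))"
proof -
  have K: "polytope d K" using assms(2) by (simp add: regular_polytope_def)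
  obtain M where M: "M \<in> faces K" "\<forall>G\<in>faces K. (G, M) \<in> leq K" using polytope_greatest[OF K] by auto
  interpret regular_reflection_words d K M
    by unfold_locales (use K assms M in auto)
  have T: "two_power_torsion ext" using two_power_torsion_ext[OF two_power_torsion_2_group[OF assms(3)]] .
  have "regular_polytope (d + 1) P \<and> infinite_2_group (aut_group P)"
    if P: "free_extension d K P" for P :: "'b ranked_poset"
  proof -
    have rP: "regular_polytope (Suc d) P" using P by (simp add: free_extension_def regular_extension_def)
    obtain f where f: "order_iso f ext P" using free_extension_order_iso[OF P] by auto
    \<comment> \<open>Torsion and the infinity of the face set come from the model; finite
      generation follows from the regularity of \<open>P\<close> itself.\<close>
    have "two_power_torsion P" using two_power_torsion_iso[OF T f] .
    moreover have "infinite (faces P)"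
      using f infinite_ext bij_betw_finite unfolding order_iso_def by auto
    ultimately have "infinite_2_group (aut_group P)"
      unfolding infinite_2_group_def two_power_torsion_iff
      using group_aut_group finitely_generated_aut_group[OF rP] infinite_aut_group[OF rP] by simp
    then show ?thesis using rP by simp
  qed
  then show ?thesis using free_extension_nat_exists by simp
qed

end
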